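(* Let $G\leq\operatorname{Aut}(T)$ be a finitely generated group acting weakly branch on a locally finite rooted tree $T$ (without leaves), and let $c\colon\partial T\times\partial T\to\mathbb N\cup\{\infty\}$, $c(\xi,\eta)=|\xi\wedge\eta|$, be the overlap function associated to $T$. For each $\alpha\in\operatorname{Aut}(G)$ define $c^\alpha(\xi,\eta)=c(\alpha\cdot\xi,\alpha\cdot\eta)$, where $\operatorname{Aut}(G)$ acts on $\partial T$ via the canonical boundary action. Define $$\widehat c(\xi,\eta)=\inf_{\alpha\in\operatorname{Aut}(G)}c^\alpha(\xi,\eta).$$ Then the following hold. (i) The function $\widehat c$ is an admissible $G$-invariant overlap function on $\partial T$. Moreover, it is invariant under the canonical action of $\operatorname{Aut}(G)$ on $\partial T$. Consequently, $\widehat c$ determines a locally finite rooted tree, denoted $\widehat T=T_{\widehat c}$. (ii) There is a natural level-preserving surjective simplicial $G$-map $p\colon\widehat T\to T$. Under the natural identification $\partial\widehat T\cong\partial T$ (given by $\pi_{\widehat c}$), the induced map on boundaries is the identity. (iii) The action of $G$ on $\widehat T$ is faithful and weakly branch. Moreover, the action of $G$ on $\widehat T$ is branch if and only if the action of $G$ on $T$ is branch. (iv) The canonical action of $\operatorname{Aut}(G)$ on $\partial T$ is induced by a faithful action of $\operatorname{Aut}(G)$ on $\widehat T$ by rooted tree automorphisms, and conjugation induces an isomorphism $N_{\operatorname{Aut}(\widehat T)}(G)\cong\operatorname{Aut}(G)$. (v) The group $\operatorname{Aut}(G)$ is weakly branch in its action on $\widehat T$. The action of $\operatorname{Inn}(G)$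 on $\widehat T$ is the action of $G$ under the isomorphism $G\cong\operatorname{Inn}(G)$.
   Context: Rooted trees are locally finite and have no leaves. For a rooted tree $T$ with root $o$, $T_n$ is the set of vertices at distance $n$ from $o$ (level $n$), and $T_v$ is the subtree consisting of $v$ and its descendants. $\operatorname{Aut}(T)$ is the group of graph automorphisms of $T$ fixing $o$. The boundary $\partial T$ is the set of infinite non-backtracking rays from $o$, with basis of topology the cylinders $\operatorname{Cyl}(v)$ (rays through $v$). For $\xi,\eta\in\partial T$, $|\xi\wedge\eta|$ is the length of the maximal common initial segment, and is $\infty$ if $\xi=\eta$. $\mathbb N$ contains $0$. For $G\le\operatorname{Aut}(T)$: the rigid stabiliser of $v$ is $\operatorname{Rist}_G(v)=\{g\in G: gw=w \text{ for all } w\notin T_v\}$, and $\operatorname{Rist}_G(n)=\langle \operatorname{Rist}_G(v): v\in T_n\rangle$. $G$ is level-transitive if it is transitive on every $T_n$. $G$ is weakly branch on $T$ if it is level-transitive and $\operatorname{Rist}_G(v)\ne 1$ for all vertices $v$. $G$ is branch on $T$ if it is level-transitive and $[G:\operatorname{Rist}_G(n)]<\infty$ for all $n\ge 0$. A weakly branch group has trivial centre, so $G\cong\operatorname{Inn}(G)$. Canonical boundary action (known theorem of Lavreniuk and Nekrashevych): if $G\le \operatorname{Aut}(T)$ is weakly branch on a locally finite rooted tree, then the centraliser of $G$ in $\operatorname{Homeo}(\partial T)$ is trivial and conjugation induces an isomorphism $N_{\operatorname{Homeo}(\partial T)}(G)\cong\operatorname{Aut}(G)$. Hence each $\alpha\in\operatorname{Aut}(G)$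 corresponds to a unique homeomorphism $\xi\mapsto\alpha\cdot\xi$ of $\partial T$ with $\alpha\cdot(g\xi)=\alpha(g)(\alpha\cdot\xi)$ for all $g\in G$, $\xi\in\partial T$; this is a faithful action of $\operatorname{Aut}(G)$ on $\partial T$, called canonical. An overlap function on a set $X$ is a function $c\colon X\times X\to\mathbb N\cup\{\infty\}$ with $c(\xi,\xi)=\infty$, $c(\xi,\eta)=c(\eta,\xi)$ and $c(\xi,\zeta)\ge\min\{c(\xi,\eta),c(\eta,\zeta)\}$. Its level-$n$ equivalence relation is $\xi\sim^c_n\eta\iff c(\xi,\eta)\ge n$. If $X$ is compact and totally disconnected, $c$ is admissible if each $\sim^c_n$ has finitely many classes, all clopen, and $c(\xi,\eta)=\infty$ implies $\xi=\eta$. $c$ is invariant under a group $\Gamma$ acting on $X$ if $c(\gamma\xi,\gamma\eta)=c(\xi,\eta)$ for all $\gamma\in\Gamma$. For admissible $c$, $T_c$ is the rooted tree whose level-$n$ vertices are the $\sim_n^c$-classes, with a class at level $n+1$ adjacent to the class at level $n$ containing it; $\pi_c\colon X\to\partial T_c$, $\xi\mapsto([\xi]_{\sim^c_n})_{n\ge0}$, is the natural homeomorphism. A group acting on $X$ and leaving $c$ invariant acts on $T_c$ by $g[\xi]_{\sim_n^c}=[g\xi]_{\sim_n^c}$. The natural map $p\colon\widehat T\to T$ sends $[\xi]_{\sim_n^{\widehat c}}$ to the level-$n$ vertex of $T$ on the ray $\xi$. *)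

theory Defs
  imports
    "HOL-Analysis.Abstract_Topology"
    "HOL-Algebra.Group_Action"
    "HOL-Algebra.Generated_Groups"
    "HOL-Library.Extended_Nat"
begin

section \<open>Rooted trees\<close>

record 'v rgraph =
  tverts :: "'v set"
  tedges :: "('v \<times> 'v) set"
  troot :: "'v"

definition is_walk :: "'v rgraph \<Rightarrow> 'v \<Rightarrow> 'v list \<Rightarrow> 'v \<Rightarrow> bool" where
  "is_walk T u xs v \<longleftrightarrow> xs \<noteq> [] \<and> hd xs = u \<and> last xs = v \<and> set xs \<subseteq> tverts T \<and>
     successively (\<lambda>x y. (x, y) \<in> tedges T) xs"

definition is_path :: "'v rgraph \<Rightarrow> 'v \<Rightarrow> 'v list \<Rightarrow> 'v \<Rightarrow> bool" where
  "is_path T u xs v \<longleftrightarrow> is_walk T u xs v \<and> distinct xs"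

text \<open>Edges are stored as a symmetric, irreflexive relation.\<close>

definition rooted_tree :: "'v rgraph \<Rightarrow> bool" where
  "rooted_tree T \<longleftrightarrow>
     tedges T \<subseteq> tverts T \<times> tverts T \<and> sym (tedges T) \<and> irrefl (tedges T) \<and>
     troot T \<in> tverts T \<and>
     (\<forall>u\<in>tverts T. \<forall>v\<in>tverts T. \<exists>!xs. is_path T u xs v)"

definition graph_dist :: "'v rgraph \<Rightarrow> 'v \<Rightarrow> 'v \<Rightarrow> nat" where
  "graph_dist T u v = (LEAST n. \<exists>xs. is_walk T u xs v \<and> length xs = Suc n)"

definition level :: "'v rgraph \<Rightarrow> nat \<Rightarrow> 'v set" where
  "level T n = {v \<in> tverts T. graph_dist T (troot T) v = n}"

definition subtree :: "'v rgraph \<Rightarrow> 'v \<Rightarrow> 'v set" where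
  "subtree T v = {w \<in> tverts T. \<exists>xs. is_path T (troot T) xs w \<and> v \<in> set xs}"

definition locally_finite :: "'v rgraph \<Rightarrow> bool" where
  "locally_finite T \<longleftrightarrow> (\<forall>v\<in>tverts T. finite {w. (v, w) \<in> tedges T})"

text \<open>A leaf of a rooted tree is a vertex without children; in particular a root of
  degree one is not a leaf.\<close>

definition leafless :: "'v rgraph \<Rightarrow> bool" where
  "leafless T \<longleftrightarrow> (\<forall>n. \<forall>v\<in>level T n. \<exists>w\<in>level T (Suc n). (v, w) \<in> tedges T)"

definition lf_rooted_tree :: "'v rgraph \<Rightarrow> bool" where
  "lf_rooted_tree T \<longleftrightarrow> rooted_tree T \<and> locally_finite T \<and> leafless T"

text \<open>As in \<open>BijGroup\<close>, automorphisms are functions that are undefined outside the vertex set,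
  so that equality of automorphisms is equality of functions.\<close>

definition tree_auts :: "'v rgraph \<Rightarrow> ('v \<Rightarrow> 'v) set" where
  "tree_auts T = {f \<in> Bij (tverts T). f (troot T) = troot T \<and>
     (\<forall>u\<in>tverts T. \<forall>v\<in>tverts T. (f u, f v) \<in> tedges T \<longleftrightarrow> (u, v) \<in> tedges T)}"

definition tree_Aut :: "'v rgraph \<Rightarrow> ('v \<Rightarrow> 'v) monoid" where
  "tree_Aut T = BijGroup (tverts T) \<lparr>carrier := tree_auts T\<rparr>"

abbreviation sub_grp :: "'v rgraph \<Rightarrow> ('v \<Rightarrow> 'v) set \<Rightarrow> ('v \<Rightarrow> 'v) monoid" where
  "sub_grp T G \<equiv> tree_Aut T \<lparr>carrier := G\<rparr>"


section \<open>Weakly branch and branch groups\<close>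

definition rist :: "'v rgraph \<Rightarrow> ('v \<Rightarrow> 'v) set \<Rightarrow> 'v \<Rightarrow> ('v \<Rightarrow> 'v) set" where
  "rist T G v = {g \<in> G. \<forall>w \<in> tverts T - subtree T v. g w = w}"

definition rist_level :: "'v rgraph \<Rightarrow> ('v \<Rightarrow> 'v) set \<Rightarrow> nat \<Rightarrow> ('v \<Rightarrow> 'v) set" where
  "rist_level T G n = generate (tree_Aut T) (\<Union>v\<in>level T n. rist T G v)"

definition level_transitive :: "'v rgraph \<Rightarrow> ('v \<Rightarrow> 'v) set \<Rightarrow> bool" where
  "level_transitive T G \<longleftrightarrow> (\<forall>n. \<forall>v\<in>level T n. \<forall>w\<in>level T n. \<exists>g\<in>G. g v = w)"

definition weakly_branch :: "'v rgraph \<Rightarrow> ('v \<Rightarrow> 'v) set \<Rightarrow> bool" where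
  "weakly_branch T G \<longleftrightarrow> subgroup G (tree_Aut T) \<and> level_transitive T G \<and>
     (\<forall>v\<in>tverts T. rist T G v \<noteq> {\<one>\<^bsub>tree_Aut T\<^esub>})"

definition branch :: "'v rgraph \<Rightarrow> ('v \<Rightarrow> 'v) set \<Rightarrow> bool" where
  "branch T G \<longleftrightarrow> subgroup G (tree_Aut T) \<and> level_transitive T G \<and>
     (\<forall>n. finite (rcosets\<^bsub>sub_grp T G\<^esub> (rist_level T G n)))"

definition finitely_generated :: "('a, 'b) monoid_scheme \<Rightarrow> bool" where
  "finitely_generated \<Gamma> \<longleftrightarrow> (\<exists>S. finite S \<and> S \<subseteq> carrier \<Gamma> \<and> generate \<Gamma> S = carrier \<Gamma>)"


section \<open>The boundary and the canonical action\<close>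

definition rays :: "'v rgraph \<Rightarrow> (nat \<Rightarrow> 'v) set" where
  "rays T = {\<xi>. \<xi> 0 = troot T \<and> (\<forall>n. (\<xi> n, \<xi> (Suc n)) \<in> tedges T) \<and>
     (\<forall>n. \<xi> (Suc (Suc n)) \<noteq> \<xi> n)}"

definition Cyl :: "'v rgraph \<Rightarrow> 'v \<Rightarrow> (nat \<Rightarrow> 'v) set" where
  "Cyl T v = {\<xi> \<in> rays T. v \<in> range \<xi>}"

definition boundary :: "'v rgraph \<Rightarrow> (nat \<Rightarrow> 'v) topology" where
  "boundary T = topology_generated_by {Cyl T v | v. v \<in> tverts T}"

definition ray_act :: "'v rgraph \<Rightarrow> ('v \<Rightarrow> 'v) \<Rightarrow> (nat \<Rightarrow> 'v) \<Rightarrow> (nat \<Rightarrow> 'v)" where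
  "ray_act T g = (\<lambda>\<xi>\<in>rays T. g \<circ> \<xi>)"

definition Homeo :: "'x topology \<Rightarrow> ('x \<Rightarrow> 'x) set" where
  "Homeo X = {h \<in> extensional (topspace X). homeomorphic_map X X h}"

text \<open>For weakly branch \<open>G\<close> the homeomorphism below exists and is unique by the theorem of
  Lavreniuk and Nekrashevych.\<close>

definition canonical_act ::
    "'v rgraph \<Rightarrow> ('v \<Rightarrow> 'v) set \<Rightarrow> (('v \<Rightarrow> 'v) \<Rightarrow> ('v \<Rightarrow> 'v)) \<Rightarrow> (nat \<Rightarrow> 'v) \<Rightarrow> (nat \<Rightarrow> 'v)" where
  "canonical_act T G \<alpha> = (THE h. h \<in> Homeo (boundary T) \<and>
     (\<forall>g\<in>G. \<forall>\<xi>\<in>rays T. h (ray_act T g \<xi>) = ray_act T (\<alpha> g) (h \<xi>)))"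

definition inner_auto :: "('a, 'b) monoid_scheme \<Rightarrow> 'a \<Rightarrow> 'a \<Rightarrow> 'a" where
  "inner_auto \<Gamma> g = (\<lambda>h\<in>carrier \<Gamma>. g \<otimes>\<^bsub>\<Gamma>\<^esub> h \<otimes>\<^bsub>\<Gamma>\<^esub> inv\<^bsub>\<Gamma>\<^esub> g)"

definition InnGroup :: "('a, 'b) monoid_scheme \<Rightarrow> ('a \<Rightarrow> 'a) monoid" where
  "InnGroup \<Gamma> = AutoGroup \<Gamma> \<lparr>carrier := inner_auto \<Gamma> ` carrier \<Gamma>\<rparr>"


section \<open>Overlap functions\<close>

definition overlap_function :: "'x set \<Rightarrow> ('x \<Rightarrow> 'x \<Rightarrow> enat) \<Rightarrow> bool" where
  "overlap_function X c \<longleftrightarrow>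
     (\<forall>\<xi>\<in>X. c \<xi> \<xi> = \<infinity>) \<and>
     (\<forall>\<xi>\<in>X. \<forall>\<eta>\<in>X. c \<xi> \<eta> = c \<eta> \<xi>) \<and>
     (\<forall>\<xi>\<in>X. \<forall>\<eta>\<in>X. \<forall>\<zeta>\<in>X. c \<xi> \<zeta> \<ge> min (c \<xi> \<eta>) (c \<eta> \<zeta>))"

definition overlap_rel :: "'x set \<Rightarrow> ('x \<Rightarrow> 'x \<Rightarrow> enat) \<Rightarrow> nat \<Rightarrow> ('x \<times> 'x) set" where
  "overlap_rel X c n = {(\<xi>, \<eta>). \<xi> \<in> X \<and> \<eta> \<in> X \<and> c \<xi> \<eta> \<ge> enat n}"

definition totally_disconnected_space :: "'x topology \<Rightarrow> bool" where
  "totally_disconnected_space X \<longleftrightarrow> (\<forall>S. connectedin X S \<longrightarrow> (\<exists>x. S \<subseteq> {x}))"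

text \<open>Admissibility is a notion for compact totally disconnected spaces only, so these
  two properties of the space are part of the definition.\<close>

definition admissible :: "'x topology \<Rightarrow> ('x \<Rightarrow> 'x \<Rightarrow> enat) \<Rightarrow> bool" where
  "admissible X c \<longleftrightarrow> compact_space X \<and> totally_disconnected_space X \<and>
     overlap_function (topspace X) c \<and>
     (\<forall>n. finite (topspace X // overlap_rel (topspace X) c n) \<and>
        (\<forall>C \<in> topspace X // overlap_rel (topspace X) c n. openin X C \<and> closedin X C)) \<and>
     (\<forall>\<xi>\<in>topspace X. \<forall>\<eta>\<in>topspace X. c \<xi> \<eta> = \<infinity> \<longrightarrow> \<xi> = \<eta>)"

definition overlap_invariant ::
    "('g, 'b) monoid_scheme \<Rightarrow> ('g \<Rightarrow> 'x \<Rightarrow> 'x) \<Rightarrow> 'x set \<Rightarrow> ('x \<Rightarrow> 'x \<Rightarrow> enat) \<Rightarrow> bool" where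
  "overlap_invariant \<Gamma> \<phi> X c \<longleftrightarrow>
     (\<forall>\<gamma>\<in>carrier \<Gamma>. \<forall>\<xi>\<in>X. \<forall>\<eta>\<in>X. c (\<phi> \<gamma> \<xi>) (\<phi> \<gamma> \<eta>) = c \<xi> \<eta>)"

text \<open>Classes of different levels may coincide as sets, so a vertex of \<open>T\<^sub>c\<close> carries its level
  as first component. The root is the only class \<open>X\<close> of level \<open>0\<close>.\<close>

definition overlap_tree :: "'x set \<Rightarrow> ('x \<Rightarrow> 'x \<Rightarrow> enat) \<Rightarrow> (nat \<times> 'x set) rgraph" where
  "overlap_tree X c =
     (let V = {(n, C) | n C. C \<in> X // overlap_rel X c n};
          E = {((n, C), (Suc n, D)) | n C D. (n, C) \<in> V \<and> (Suc n, D) \<in> V \<and> D \<subseteq> C}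
      in \<lparr>tverts = V, tedges = E \<union> E\<inverse>, troot = (0, X)\<rparr>)"

definition overlap_vertex ::
    "'x set \<Rightarrow> ('x \<Rightarrow> 'x \<Rightarrow> enat) \<Rightarrow> nat \<Rightarrow> 'x \<Rightarrow> nat \<times> 'x set" where
  "overlap_vertex X c n \<xi> = (n, overlap_rel X c n `` {\<xi>})"

definition overlap_pi :: "'x set \<Rightarrow> ('x \<Rightarrow> 'x \<Rightarrow> enat) \<Rightarrow> 'x \<Rightarrow> (nat \<Rightarrow> nat \<times> 'x set)" where
  "overlap_pi X c \<xi> = (\<lambda>n. overlap_vertex X c n \<xi>)"

text \<open>The map of \<open>T\<^sub>c\<close> induced by a map \<open>h\<close> of \<open>X\<close> that leaves \<open>c\<close> invariant, taking the class
  of \<open>\<xi>\<close> to the class of \<open>h \<xi>\<close>. The union is over equal sets, as in the library's treatment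
  of functions on quotients.\<close>

definition overlap_tree_act ::
    "'x set \<Rightarrow> ('x \<Rightarrow> 'x \<Rightarrow> enat) \<Rightarrow> ('x \<Rightarrow> 'x) \<Rightarrow> nat \<times> 'x set \<Rightarrow> nat \<times> 'x set" where
  "overlap_tree_act X c h =
     (\<lambda>(n, C) \<in> tverts (overlap_tree X c). (n, \<Union>\<xi>\<in>C. overlap_rel X c n `` {h \<xi>}))"


section \<open>The overlap function of a tree and its refinement\<close>

text \<open>Length is counted in edges: rays sharing only the root have overlap \<open>0\<close>.\<close>

definition ray_overlap :: "(nat \<Rightarrow> 'v) \<Rightarrow> (nat \<Rightarrow> 'v) \<Rightarrow> enat" where
  "ray_overlap \<xi> \<eta> = (SUP n \<in> {n. \<forall>i\<le>n. \<xi> i = \<eta> i}. enat n)"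

definition c_hat :: "'v rgraph \<Rightarrow> ('v \<Rightarrow> 'v) set \<Rightarrow> (nat \<Rightarrow> 'v) \<Rightarrow> (nat \<Rightarrow> 'v) \<Rightarrow> enat" where
  "c_hat T G \<xi> \<eta> = (INF \<alpha> \<in> auto (sub_grp T G).
     ray_overlap (canonical_act T G \<alpha> \<xi>) (canonical_act T G \<alpha> \<eta>))"

definition T_hat :: "'v rgraph \<Rightarrow> ('v \<Rightarrow> 'v) set \<Rightarrow> (nat \<times> (nat \<Rightarrow> 'v) set) rgraph" where
  "T_hat T G = overlap_tree (rays T) (c_hat T G)"

definition pi_hat :: "'v rgraph \<Rightarrow> ('v \<Rightarrow> 'v) set \<Rightarrow> (nat \<Rightarrow> 'v) \<Rightarrow> (nat \<Rightarrow> nat \<times> (nat \<Rightarrow> 'v) set)" where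
  "pi_hat T G = overlap_pi (rays T) (c_hat T G)"

definition G_act_hat ::
    "'v rgraph \<Rightarrow> ('v \<Rightarrow> 'v) set \<Rightarrow> ('v \<Rightarrow> 'v) \<Rightarrow> nat \<times> (nat \<Rightarrow> 'v) set \<Rightarrow> nat \<times> (nat \<Rightarrow> 'v) set" where
  "G_act_hat T G g = overlap_tree_act (rays T) (c_hat T G) (ray_act T g)"

definition Aut_act_hat ::
    "'v rgraph \<Rightarrow> ('v \<Rightarrow> 'v) set \<Rightarrow> (('v \<Rightarrow> 'v) \<Rightarrow> ('v \<Rightarrow> 'v)) \<Rightarrow>
     nat \<times> (nat \<Rightarrow> 'v) set \<Rightarrow> nat \<times> (nat \<Rightarrow> 'v) set" where
  "Aut_act_hat T G \<alpha> = overlap_tree_act (rays T) (c_hat T G) (canonical_act T G \<alpha>)"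


section \<open>Maps and actions on trees\<close>

definition level_preserving :: "'v rgraph \<Rightarrow> 'w rgraph \<Rightarrow> ('v \<Rightarrow> 'w) \<Rightarrow> bool" where
  "level_preserving S T p \<longleftrightarrow> (\<forall>n. p ` level S n \<subseteq> level T n)"

text \<open>Simplicial maps may collapse edges in general; surjectivity is meant on vertices and
  on edges.\<close>

definition simplicial :: "'v rgraph \<Rightarrow> 'w rgraph \<Rightarrow> ('v \<Rightarrow> 'w) \<Rightarrow> bool" where
  "simplicial S T p \<longleftrightarrow> p ` tverts S \<subseteq> tverts T \<and>
     (\<forall>(x, y) \<in> tedges S. p x = p y \<or> (p x, p y) \<in> tedges T)"

definition surjective_simplicial :: "'v rgraph \<Rightarrow> 'w rgraph \<Rightarrow> ('v \<Rightarrow> 'w) \<Rightarrow> bool" where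
  "surjective_simplicial S T p \<longleftrightarrow> simplicial S T p \<and> tverts T \<subseteq> p ` tverts S \<and>
     tedges T \<subseteq> map_prod p p ` tedges S"

definition faithful_tree_action ::
    "('g, 'b) monoid_scheme \<Rightarrow> 'v rgraph \<Rightarrow> ('g \<Rightarrow> 'v \<Rightarrow> 'v) \<Rightarrow> bool" where
  "faithful_tree_action \<Gamma> T \<phi> \<longleftrightarrow>
     faithful_action \<Gamma> (tverts T) \<phi> \<and> \<phi> ` carrier \<Gamma> \<subseteq> tree_auts T"

end

(* Lavreniuk and Nekrashevych's theorem is proved through supports. A subgroup A of G with finitely
   many conjugates has a clopen support: translates of the support form a finite family of open
   sets, some cylinder is decided by all of them, and level-transitivity spreads this to a whole
   level. Two commuting such subgroups have disjoint supports, since otherwise double commutators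
   with elements of a rigid stabiliser would put a non-abelian set into both. Hence an automorphism
   alpha maps U to the support of alpha (Rist U), which is an automorphism of the algebra of clopen
   sets; Stone duality then gives the homeomorphism.

   The level-n relation of c_hat has finitely many clopen classes because G is finitely generated:
   the action of alpha(g) on level n is determined by those of alpha(s) for generators s, so up to
   finitely many g all alpha(g) agree on level n, and G-orbits are dense. Vertices of T_hat are
   clopen, so rigid stabilisers of T and T_hat are cofinal in each other. *)

theory Submission
  imports Defs
begin

section \<open>Graded trees\<close>

text \<open>Double commutators help because of an independence: if \<open>a\<close> moves a cylinder
  off itself and \<open>r\<close>, \<open>s\<close> are supported in it, then
  \<open>comm (comm a r) s\<close> equals \<open>comm (inv r) s\<close>, whatever \<open>a\<close>
  is. If \<open>r\<close> and \<open>s\<close> normalize a subgroup containing \<open>a\<close>,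
  this element lies in the subgroup. So the same elements land in two groups at once. Normalizing
  elements exist by pigeonhole: rigid stabilisers of cylinders are infinite, while the conjugates
  are finite in number.

  The analysis of automorphisms takes place in \<open>boundary_action\<close>, for a group permuting
  a set of sequences, without edges or paths. The tree side is confined to
  \<open>graded_tree\<close>, whose level and parent functions fit both \<open>T\<close> and the
  tree of classes.

  The relation \<open>enat n \<le> c_hat T G \<xi> \<eta>\<close> says that the images of the two
  rays under each automorphism agree at level n. Its classes are closed, and finitely many closed
  classes covering the boundary are open. For the normalizer, the point is that automorphisms of the
  tree of classes are the same as bijections of the boundary preserving \<open>c_hat\<close>; these
  are homeomorphisms, so uniqueness of the canonical homeomorphism applies to them.\<close>

lemma is_walk_Cons:
  "is_walk T u (x # xs) v \<longleftrightarrow> x = u \<and> u \<in> tverts T \<and>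
    (if xs = [] then u = v else (u, hd xs) \<in> tedges T \<and> is_walk T (hd xs) xs v)"
  by (cases xs) (auto simp: is_walk_def)

lemma is_walk_rev:
  assumes "sym (tedges T)" "is_walk T u xs v" shows "is_walk T v (rev xs) u"
proof -
  have "successively (\<lambda>x y. (x, y) \<in> tedges T) xs \<longleftrightarrow> successively (\<lambda>x y. (y, x) \<in> tedges T) xs"
    using assms(1) by (intro successively_cong) (auto dest: symD)
  then show ?thesis using assms(2) by (auto simp: is_walk_def hd_rev last_rev)
qed

lemma is_path_rev: "sym (tedges T) \<Longrightarrow> is_path T u xs v \<Longrightarrow> is_path T v (rev xs) u"
  by (simp add: is_path_def is_walk_rev)

lemma is_path_suffix: "is_path T u (as @ x # bs) v \<Longrightarrow> is_path T x (x # bs) v"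
  by (auto simp: is_path_def is_walk_def successively_append_iff)

lemma is_path_prefix: "is_path T u (as @ x # bs) v \<Longrightarrow> is_path T u (as @ [x]) x"
  by (cases as) (auto simp: is_path_def is_walk_def successively_append_iff successively_Cons
      hd_append split: if_splits)

lemma is_path_snoc:
  assumes "is_path T u xs v" "(v, w) \<in> tedges T" "w \<in> tverts T" "w \<notin> set xs"
  shows "is_path T u (xs @ [w]) w"
  using assms by (auto simp: is_path_def is_walk_def successively_append_iff)

text \<open>The tree \<open>T\<close> is given through unique paths, \<open>overlap_tree\<close>
  through levels and parent classes. Describing edges by \<open>l\<close> and \<open>par\<close>
  suits both: \<open>rooted_tree\<close> derives unique paths from it, and
  \<open>rooted_tree_graded\<close> supplies it for a tree given by paths.\<close>

locale graded_tree =
  fixes T :: "'v rgraph" and l :: "'v \<Rightarrow> nat" and par :: "'v \<Rightarrow> 'v"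
  assumes edge_iff: "(u, v) \<in> tedges T \<longleftrightarrow>
      (u \<in> tverts T \<and> u \<noteq> troot T \<and> v = par u) \<or> (v \<in> tverts T \<and> v \<noteq> troot T \<and> u = par v)"
    and root_vert: "troot T \<in> tverts T" and l_root: "l (troot T) = 0"
    and par_vert: "\<lbrakk>v \<in> tverts T; v \<noteq> troot T\<rbrakk> \<Longrightarrow> par v \<in> tverts T"
    and l_par: "\<lbrakk>v \<in> tverts T; v \<noteq> troot T\<rbrakk> \<Longrightarrow> l v = Suc (l (par v))"
begin

lemma l_0_iff: "v \<in> tverts T \<Longrightarrow> l v = 0 \<longleftrightarrow> v = troot T"
  using l_par l_root by fastforce

lemma edges_sym: "sym (tedges T)"
  by (auto simp: sym_def edge_iff)

lemma edges_irrefl: "irrefl (tedges T)"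
  by (auto simp: irrefl_def edge_iff dest: l_par)

lemma edges_sub: "tedges T \<subseteq> tverts T \<times> tverts T"
  by (auto simp: edge_iff par_vert)

lemma edge_level: "(u, v) \<in> tedges T \<Longrightarrow> l v \<le> Suc (l u)"
  using edge_iff[of u v] l_par[of u] l_par[of v] by auto

lemma walk_level: "is_walk T u xs v \<Longrightarrow> l v < l u + length xs"
proof (induction xs arbitrary: u)
  case (Cons x xs)
  show ?case
  proof (cases "xs = []")
    case False
    then have "(u, hd xs) \<in> tedges T" "l v < l (hd xs) + length xs"
      using Cons by (auto simp: is_walk_Cons)
    then show ?thesis using edge_level[of u "hd xs"] by simp
  qed (use Cons in \<open>auto simp: is_walk_Cons\<close>)
qed (simp add: is_walk_def)

lemma root_walk: "v \<in> tverts T \<Longrightarrow> \<exists>xs. is_walk T (troot T) xs v \<and> length xs = Suc (l v)"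
proof (induction "l v" arbitrary: v)
  case 0
  then have "v = troot T" by (simp add: l_0_iff)
  then show ?case using root_vert l_root by (intro exI[of _ "[v]"]) (simp add: is_walk_def)
next
  case (Suc n)
  then have r: "v \<noteq> troot T" using l_root by auto
  then have p: "par v \<in> tverts T" "l v = Suc (l (par v))" "(par v, v) \<in> tedges T"
    using Suc par_vert l_par edge_iff by auto
  then obtain xs where xs: "is_walk T (troot T) xs (par v)" "length xs = Suc (l (par v))"
    using Suc by auto
  have "is_walk T (troot T) (xs @ [v]) v"
    using xs p Suc.prems by (auto simp: is_walk_def successively_append_iff)
  then show ?case using xs p by (intro exI[of _ "xs @ [v]"]) simp
qed

lemma graph_dist_root: "v \<in> tverts T \<Longrightarrow> graph_dist T (troot T) v = l v"
  unfolding graph_dist_def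
proof (rule Least_equality)
  fix n assume "\<exists>xs. is_walk T (troot T) xs v \<and> length xs = Suc n"
  then show "l v \<le> n" using walk_level l_root by fastforce
qed (use root_walk in blast)

lemma level_eq: "level T n = {v \<in> tverts T. l v = n}"
  using graph_dist_root by (auto simp: level_def)

lemma path_exists: "\<lbrakk>u \<in> tverts T; v \<in> tverts T\<rbrakk> \<Longrightarrow> \<exists>xs. is_path T u xs v"
proof -
  \<comment> \<open>Prepending \<open>u\<close> could repeat a vertex; if \<open>u\<close> is
    already on the path, the suffix starting there is taken instead.\<close>
  have ext: "\<exists>ys. is_path T u ys v" if p: "is_path T u' xs v" and e: "(u, u') \<in> tedges T" for u u' xs v
  proof (cases "u \<in> set xs")
    case True
    then obtain as bs where "xs = as @ u # bs" by (meson split_list)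
    then show ?thesis using is_path_suffix[of T u' as u bs v] p by auto
  next
    case False
    then show ?thesis using p e edges_sub
      by (intro exI[of _ "u # xs"]) (auto simp: is_path_def is_walk_def successively_Cons)
  qed
  have up: "\<exists>xs. is_path T u xs (troot T)" if "u \<in> tverts T" for u
    using that
  proof (induction "l u" arbitrary: u)
    case 0
    then show ?case by (intro exI[of _ "[u]"]) (simp add: l_0_iff is_path_def is_walk_def)
  next
    case (Suc n)
    then have "u \<noteq> troot T" using l_root by auto
    then have "par u \<in> tverts T" "l u = Suc (l (par u))" "(u, par u) \<in> tedges T"
      using Suc par_vert l_par edge_iff by auto
    then show ?case using Suc ext by (metis nat.inject)
  qed
  assume u: "u \<in> tverts T" and v: "v \<in> tverts T"
  show ?thesis using u
  proof (induction "l u" arbitrary: u)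
    case 0
    then show ?case using up[OF v] is_path_rev[OF edges_sym] by (auto simp: l_0_iff)
  next
    case (Suc n)
    then have "u \<noteq> troot T" using l_root by auto
    then have "par u \<in> tverts T" "l u = Suc (l (par u))" "(u, par u) \<in> tedges T"
      using Suc par_vert l_par edge_iff by auto
    then show ?case using Suc ext by (metis nat.inject)
  qed
qed

text \<open>Once a path has stepped from a parent to a child, it can only go on descending: the sole
  ascending step would return to the vertex just left, which distinctness forbids.\<close>

lemma descending_path:
  assumes "is_path T u (u # x # xs) v" "x \<noteq> troot T" "u = par x"
  shows "l u < l v"
  using assms
proof (induction xs arbitrary: u x)
  case Nil
  then have "x = v" "x \<in> tverts T" by (auto simp: is_path_def is_walk_def)
  then show ?case using l_par Nil by simp
next
  case (Cons y ys)
  then have p: "is_path T x (x # y # ys) v" by (auto simp: is_path_def is_walk_def)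
  have "x \<in> tverts T" "(x, y) \<in> tedges T" "y \<noteq> u" using Cons.prems(1) by (auto simp: is_path_def is_walk_def)
  then have "l u < l x" "y \<noteq> troot T" "x = par y" using l_par Cons.prems edge_iff by auto
  then show ?case using Cons.IH[OF p] by simp
qed

text \<open>By \<open>descending_path\<close> a first step away from the root would make
  \<open>v\<close> deeper than \<open>u\<close>, so the first step leads to the parent.\<close>

lemma path_step:
  assumes "is_path T u xs v" "u \<noteq> v" "l v \<le> l u"
  shows "u \<noteq> troot T \<and> (\<exists>zs. xs = u # zs \<and> is_path T (par u) zs v)"
proof -
  obtain ys where ys: "xs = u # ys" using assms(1) by (cases xs) (auto simp: is_path_def is_walk_def)
  obtain x zs where zs: "ys = x # zs"
    using assms ys by (cases ys) (auto simp: is_path_def is_walk_def)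
  have e: "(u, x) \<in> tedges T" and p: "is_path T x (x # zs) v"
    using assms(1) ys zs by (auto simp: is_path_def is_walk_def)
  have "\<not> (x \<in> tverts T \<and> x \<noteq> troot T \<and> u = par x)"
    using descending_path[of u x zs v] assms ys zs by auto
  then have "u \<noteq> troot T" "x = par u" using e edge_iff by auto
  then show ?thesis using p ys zs by blast
qed

text \<open>Both paths leave the deeper endpoint through its parent, so stripping that endpoint
  lowers the sum of the levels. If the deeper endpoint is \<open>v\<close>, the reversed paths are
  compared.\<close>

lemma path_unique: "is_path T u xs v \<Longrightarrow> is_path T u ys v \<Longrightarrow> xs = ys"
proof (induction "l u + l v" arbitrary: u v xs ys rule: less_induct)
  case less
  have uv: "u \<in> tverts T" "v \<in> tverts T" using less.prems(1)
    by (auto simp: is_path_def is_walk_def)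
  show ?case
  proof (cases "u = v")
    case True
    have "zs = [u]" if "is_path T u zs u" for zs
      using that by (cases zs) (auto simp: is_path_def is_walk_def split: if_splits)
    then show ?thesis using less.prems True by auto
  next
    case ne: False
    have main: "xs' = ys'"
      if p: "is_path T u' xs' v'" "is_path T u' ys' v'" "l v' \<le> l u'" "u' \<in> tverts T" "u' \<noteq> v'"
        "l u' + l v' = l u + l v" for u' v' xs' ys'
    proof -
      obtain zs ws where z: "xs' = u' # zs" "is_path T (par u') zs v'"
        "ys' = u' # ws" "is_path T (par u') ws v'" "u' \<noteq> troot T"
        using path_step[OF p(1,5,3)] path_step[OF p(2,5,3)] by blast
      then have "l (par u') + l v' < l u + l v" using l_par[of u'] p by simp
      then show ?thesis using less.hyps z by blast
    qed
    show ?thesis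
    proof (cases "l v \<le> l u")
      case True
      then show ?thesis using main less.prems uv ne by blast
    next
      case False
      then have "rev xs = rev ys"
        using main[of v "rev xs" u "rev ys"] less.prems uv ne is_path_rev[OF edges_sym] by auto
      then show ?thesis by simp
    qed
  qed
qed

lemma rooted_tree: "rooted_tree T"
  unfolding rooted_tree_def
  using edges_sub edges_sym edges_irrefl root_vert path_exists path_unique by blast

text \<open>Non-backtracking forces descent: the root has only children as neighbours, and a vertex
  reached from its parent can only be left for a child.\<close>

lemma rays_iff: "\<xi> \<in> rays T \<longleftrightarrow> (\<forall>n. \<xi> n \<in> tverts T \<and> l (\<xi> n) = n \<and> par (\<xi> (Suc n)) = \<xi> n)"
proof
  assume r: "\<xi> \<in> rays T"
  have "\<xi> (Suc n) \<in> tverts T \<and> \<xi> (Suc n) \<noteq> troot T \<and> par (\<xi> (Suc n)) = \<xi> n \<and> l (\<xi> n) = n" for n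
  proof (induction n)
    case 0
    have "\<xi> 0 = troot T" "(\<xi> 0, \<xi> (Suc 0)) \<in> tedges T" using r unfolding rays_def by blast+
    then show ?case using edge_iff[of "\<xi> 0" "\<xi> (Suc 0)"] l_root by auto
  next
    case (Suc n)
    have e: "(\<xi> (Suc n), \<xi> (Suc (Suc n))) \<in> tedges T" "\<xi> (Suc (Suc n)) \<noteq> \<xi> n"
      using r by (auto simp: rays_def)
    then have "\<xi> (Suc (Suc n)) \<noteq> par (\<xi> (Suc n))" using Suc by simp
    then show ?case using e Suc edge_iff[of "\<xi> (Suc n)" "\<xi> (Suc (Suc n))"] l_par[of "\<xi> (Suc n)"] by auto
  qed
  moreover have "\<xi> 0 \<in> tverts T" using r root_vert by (simp add: rays_def)
  ultimately show "\<forall>n. \<xi> n \<in> tverts T \<and> l (\<xi> n) = n \<and> par (\<xi> (Suc n)) = \<xi> n"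
    by (metis not0_implies_Suc)
next
  assume *: "\<forall>n. \<xi> n \<in> tverts T \<and> l (\<xi> n) = n \<and> par (\<xi> (Suc n)) = \<xi> n"
  then have "\<xi> 0 = troot T" using l_0_iff by blast
  moreover have "(\<xi> n, \<xi> (Suc n)) \<in> tedges T" for n
  proof -
    have "l (\<xi> (Suc n)) = Suc n" using * by blast
    then have "\<xi> (Suc n) \<noteq> troot T" using l_root by auto
    then show ?thesis using * edge_iff[of "\<xi> n" "\<xi> (Suc n)"] by simp
  qed
  moreover have "\<xi> (Suc (Suc n)) \<noteq> \<xi> n" for n
    using * by (metis Suc_n_not_le_n le_SucI order_refl)
  ultimately show "\<xi> \<in> rays T" by (simp add: rays_def)
qed

lemma ray_vert: "\<xi> \<in> rays T \<Longrightarrow> \<xi> n \<in> tverts T"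
  and ray_level: "\<xi> \<in> rays T \<Longrightarrow> l (\<xi> n) = n"
  and ray_par: "\<xi> \<in> rays T \<Longrightarrow> par (\<xi> (Suc n)) = \<xi> n"
  by (auto simp: rays_iff)

lemma ray_prefix:
  assumes "\<xi> \<in> rays T" "\<eta> \<in> rays T" "\<xi> n = \<eta> n" "m \<le> n" shows "\<xi> m = \<eta> m"
  using assms(4,3)
proof (induction rule: inc_induct)
  case (step k)
  then show ?case using ray_par assms(1,2) by metis
qed

text \<open>Limits of rays are rays, in the form needed for diagonal constructions. Each condition
  in \<open>rays_iff\<close> involves only two successive values.\<close>

lemma rays_closed:
  assumes "\<And>n. \<exists>\<xi>\<in>rays T. \<forall>i\<le>n. \<xi> i = f i" shows "f \<in> rays T"
  unfolding rays_iff
proof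
  fix n
  obtain \<xi> where "\<xi> \<in> rays T" "\<forall>i\<le>Suc n. \<xi> i = f i" using assms by blast
  then show "f n \<in> tverts T \<and> l (f n) = n \<and> par (f (Suc n)) = f n"
    using ray_vert ray_level ray_par by (metis le_SucI order_refl)
qed

lemma ray_path: "\<xi> \<in> rays T \<Longrightarrow> is_path T (troot T) (map \<xi> [0..<Suc n]) (\<xi> n)"
proof (induction n)
  case 0
  then show ?case using root_vert by (simp add: is_path_def is_walk_def rays_def)
next
  case (Suc n)
  have "\<xi> (Suc n) \<noteq> \<xi> i" if "i \<le> n" for i
    using ray_level[OF Suc.prems, of "Suc n"] ray_level[OF Suc.prems, of i] that by auto
  then have "\<xi> (Suc n) \<notin> set (map \<xi> [0..<Suc n])" by (fastforce simp: less_Suc_eq_le simp del: upt_Suc)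
  then have "is_path T (troot T) (map \<xi> [0..<Suc n] @ [\<xi> (Suc n)]) (\<xi> (Suc n))"
    using Suc ray_vert by (intro is_path_snoc[of T _ _ "\<xi> n"]) (auto simp: rays_def)
  then show ?case by simp
qed

text \<open>Membership in \<open>subtree\<close> is defined by the root path, and the root path to
  \<open>\<xi> n\<close> is an initial segment of \<open>\<xi>\<close>.\<close>

lemma subtree_ray_iff:
  assumes "\<xi> \<in> rays T" shows "\<xi> n \<in> subtree T v \<longleftrightarrow> l v \<le> n \<and> \<xi> (l v) = v"
proof -
  have "\<xi> n \<in> subtree T v \<longleftrightarrow> v \<in> set (map \<xi> [0..<Suc n])"
    using ray_path[OF assms, of n] path_unique ray_vert[OF assms, of n] unfolding subtree_def by blast
  also have "\<dots> \<longleftrightarrow> (\<exists>k\<le>n. \<xi> k = v)" by (auto simp: less_Suc_eq_le image_iff simp del: upt_Suc)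
  also have "\<dots> \<longleftrightarrow> l v \<le> n \<and> \<xi> (l v) = v" using ray_level[OF assms] by auto
  finally show ?thesis .
qed

lemma Cyl_eq: "v \<in> tverts T \<Longrightarrow> Cyl T v = {\<xi> \<in> rays T. \<xi> (l v) = v}"
  using ray_level by (auto simp: Cyl_def) (metis rangeI)

end

text \<open>The level of a vertex is the length of its root path, minus one because paths are lists
  of vertices; the parent is the last vertex but one. At the end \<open>graph_dist_root\<close>
  replaces this level by \<open>graph_dist\<close>.\<close>

theorem rooted_tree_graded:
  assumes T: "rooted_tree T"
  shows "\<exists>par. graded_tree T (graph_dist T (troot T)) par"
proof -
  define P where "P v = (THE xs. is_path T (troot T) xs v)" for v
  have ex1: "\<exists>!xs. is_path T u xs v" if "u \<in> tverts T" "v \<in> tverts T" for u v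
    using T that by (simp add: rooted_tree_def)
  have root: "troot T \<in> tverts T" and E: "tedges T \<subseteq> tverts T \<times> tverts T" "sym (tedges T)" "irrefl (tedges T)"
    using T by (auto simp: rooted_tree_def)
  have P: "is_path T (troot T) (P v) v" if "v \<in> tverts T" for v
    unfolding P_def by (rule theI', rule ex1[OF root that])
  have PI: "P v = xs" if "is_path T (troot T) xs v" for v xs
  proof -
    have "v \<in> tverts T" using that by (auto simp: is_path_def is_walk_def)
    then show ?thesis using P that ex1[OF root] by blast
  qed
  define l where "l v = length (P v) - 1" for v
  define par where "par v = last (butlast (P v))" for v
  \<comment> \<open>If \<open>v\<close> lies on the root path to \<open>u\<close>, the part from
    \<open>v\<close> on is the unique path from \<open>v\<close> to \<open>u\<close>, hence just the
    edge; otherwise the edge prolongs the root path.\<close>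
  have P_edge: "P v = P u @ [v] \<or> P u = P v @ [u]" if e: "(u, v) \<in> tedges T" for u v
  proof (cases "v \<in> set (P u)")
    case False
    then show ?thesis using PI is_path_snoc[OF P e] e E by auto
  next
    case True
    have uv: "u \<in> tverts T" "v \<in> tverts T" "u \<noteq> v" using e E by (auto simp: irrefl_def)
    obtain as bs where ab: "P u = as @ v # bs" using True by (meson split_list)
    then have "is_path T v (v # bs) u" "P v = as @ [v]"
      using P[OF uv(1)] is_path_suffix is_path_prefix PI by metis+
    moreover have "is_path T v [v, u] u" using e E uv by (auto simp: is_path_def is_walk_def dest: symD)
    ultimately show ?thesis using ex1[OF uv(2,1)] ab by auto
  qed
  have P_root: "P (troot T) = [troot T]"
    using root by (intro PI) (simp add: is_path_def is_walk_def)
  have P_ne: "P v \<noteq> []" if "v \<in> tverts T" for v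
    using P[OF that] by (auto simp: is_path_def is_walk_def)
  have child: "v \<noteq> troot T \<and> par v = u" if "P v = P u @ [v]" "u \<in> tverts T" for u v
  proof -
    have "last (P u) = u" using P[OF that(2)] by (simp add: is_path_def is_walk_def)
    moreover have "P v \<noteq> [troot T]" using that P_ne[OF that(2)] by auto
    ultimately show ?thesis using that(1) P_root by (auto simp: par_def)
  qed
  have parP: "par v \<in> tverts T \<and> P v = P (par v) @ [v] \<and> (par v, v) \<in> tedges T"
    if v: "v \<in> tverts T" "v \<noteq> troot T" for v
  proof -
    have lv: "last (P v) = v" "hd (P v) = troot T" using P[OF v(1)] by (auto simp: is_path_def is_walk_def)
    then have b: "P v = butlast (P v) @ [v]" using P_ne[OF v(1)] append_butlast_last_id by metis
    then have "butlast (P v) \<noteq> []" using lv v(2) by (metis append_Nil list.sel(1))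
    then have b2: "P v = butlast (butlast (P v)) @ par v # [v]"
      unfolding par_def using b append_butlast_last_id by (metis append.assoc append_Cons append_Nil)
    have pv: "is_path T (troot T) (butlast (butlast (P v)) @ [par v]) (par v)"
      using P[OF v(1)] b2 is_path_prefix by metis
    then have "P (par v) = butlast (butlast (P v)) @ [par v]" by (rule PI)
    moreover have "par v \<in> tverts T" using pv by (auto simp: is_path_def is_walk_def)
    moreover have "is_path T (par v) [par v, v] v" using P[OF v(1)] b2 is_path_suffix by metis
    ultimately show ?thesis using b2 by (auto simp: is_path_def is_walk_def)
  qed
  interpret graded_tree T l par
  proof
    fix u v
    show "(u, v) \<in> tedges T \<longleftrightarrow>
      (u \<in> tverts T \<and> u \<noteq> troot T \<and> v = par u) \<or> (v \<in> tverts T \<and> v \<noteq> troot T \<and> u = par v)"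
    proof
      assume e: "(u, v) \<in> tedges T"
      then have "u \<in> tverts T" "v \<in> tverts T" using E(1) by auto
      then show "(u \<in> tverts T \<and> u \<noteq> troot T \<and> v = par u) \<or> (v \<in> tverts T \<and> v \<noteq> troot T \<and> u = par v)"
        using P_edge[OF e] child[of v u] child[of u v] by metis
    qed (use parP symD[OF E(2)] in blast)
    show "v \<in> tverts T \<Longrightarrow> v \<noteq> troot T \<Longrightarrow> l v = Suc (l (par v))"
      using parP[of v] P_ne[of "par v"] by (auto simp: l_def Suc_le_eq)
  qed (use root P_root parP in \<open>auto simp: l_def\<close>)
  have "graded_tree T (graph_dist T (troot T)) par"
    by unfold_locales (auto simp: edge_iff root_vert graph_dist_root par_vert l_root l_par)
  then show ?thesis by blast
qed

section \<open>Automorphisms and boundaries of trees\<close>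

lemma BijGroup_mult_apply: "\<lbrakk>f \<in> Bij S; g \<in> Bij S; x \<in> S\<rbrakk> \<Longrightarrow> (f \<otimes>\<^bsub>BijGroup S\<^esub> g) x = f (g x)"
  by (simp add: BijGroup_def compose_def)

context graded_tree begin

lemma tree_auts_Bij: "f \<in> tree_auts T \<Longrightarrow> f \<in> Bij (tverts T)"
  by (simp add: tree_auts_def)

lemma tree_auts_bij: "f \<in> tree_auts T \<Longrightarrow> bij_betw f (tverts T) (tverts T)"
  by (simp add: tree_auts_def Bij_def)

lemma tree_auts_vert [simp]: "\<lbrakk>f \<in> tree_auts T; v \<in> tverts T\<rbrakk> \<Longrightarrow> f v \<in> tverts T"
  using tree_auts_bij bij_betwE by blast

lemma tree_auts_edge:
  "\<lbrakk>f \<in> tree_auts T; u \<in> tverts T; v \<in> tverts T\<rbrakk> \<Longrightarrow> (f u, f v) \<in> tedges T \<longleftrightarrow> (u, v) \<in> tedges T"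
  by (simp add: tree_auts_def)

lemma tree_auts_subgroup: "subgroup (tree_auts T) (BijGroup (tverts T))"
proof
  show "tree_auts T \<subseteq> carrier (BijGroup (tverts T))" by (auto simp: tree_auts_def BijGroup_def)
  show "\<one>\<^bsub>BijGroup (tverts T)\<^esub> \<in> tree_auts T"
    using root_vert by (auto simp: tree_auts_def BijGroup_def id_Bij)
  fix f assume f: "f \<in> tree_auts T"
  show "f \<otimes>\<^bsub>BijGroup (tverts T)\<^esub> g \<in> tree_auts T" if g: "g \<in> tree_auts T" for g
    using f g root_vert compose_Bij[of f "tverts T" g]
    by (simp add: tree_auts_edge tree_auts_Bij) (simp add: tree_auts_def BijGroup_def compose_def
        Bij_imp_funcset[THEN funcset_mem])
  let ?i = "restrict (inv_into (tverts T) f) (tverts T)"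
  have i: "?i v \<in> tverts T" "f (?i v) = v" if "v \<in> tverts T" for v
    using tree_auts_bij[OF f] that by (auto simp: bij_betw_def inv_into_into f_inv_into_f)
  have "?i (troot T) = troot T"
    using f root_vert bij_betw_inv_into_left[OF tree_auts_bij[OF f] root_vert]
    by (simp add: tree_auts_def)
  moreover have "(?i u, ?i v) \<in> tedges T \<longleftrightarrow> (u, v) \<in> tedges T"
    if "u \<in> tverts T" "v \<in> tverts T" for u v
    using tree_auts_edge[OF f i(1)[OF that(1)] i(1)[OF that(2)]] i(2)[OF that(1)] i(2)[OF that(2)]
    by (simp only:)
  ultimately show "inv\<^bsub>BijGroup (tverts T)\<^esub> f \<in> tree_auts T"
    unfolding inv_BijGroup[OF tree_auts_Bij[OF f]] tree_auts_def
    using restrict_inv_into_Bij[OF tree_auts_Bij[OF f]] by (simp del: restrict_apply)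
qed

lemma group_tree_Aut: "group (tree_Aut T)"
  unfolding tree_Aut_def by (rule subgroup.subgroup_is_group[OF tree_auts_subgroup group_BijGroup])

lemma tree_Aut_carrier [simp]: "carrier (tree_Aut T) = tree_auts T"
  by (simp add: tree_Aut_def)

lemma tree_Aut_one: "\<one>\<^bsub>tree_Aut T\<^esub> = (\<lambda>v\<in>tverts T. v)"
  by (simp add: tree_Aut_def BijGroup_def)

lemma tree_Aut_mult_apply:
  "\<lbrakk>f \<in> tree_auts T; g \<in> tree_auts T; v \<in> tverts T\<rbrakk> \<Longrightarrow> (f \<otimes>\<^bsub>tree_Aut T\<^esub> g) v = f (g v)"
  by (simp add: tree_Aut_def BijGroup_mult_apply tree_auts_Bij)

lemma tree_auts_eqI:
  "\<lbrakk>f \<in> tree_auts T; g \<in> tree_auts T; \<And>v. v \<in> tverts T \<Longrightarrow> f v = g v\<rbrakk> \<Longrightarrow> f = g"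
  by (auto simp: tree_auts_def Bij_def intro: extensionalityI)

lemma aut_ray: "\<lbrakk>f \<in> tree_auts T; \<xi> \<in> rays T\<rbrakk> \<Longrightarrow> f \<circ> \<xi> \<in> rays T"
proof -
  assume f: "f \<in> tree_auts T" and \<xi>: "\<xi> \<in> rays T"
  have "f (\<xi> (Suc (Suc n))) \<noteq> f (\<xi> n)" for n
  proof -
    have "\<xi> (Suc (Suc n)) \<noteq> \<xi> n" using \<xi> unfolding rays_def by blast
    then show ?thesis
      using bij_betw_imp_inj_on[OF tree_auts_bij[OF f]] ray_vert[OF \<xi>] by (meson inj_onD)
  qed
  moreover have "(f (\<xi> n), f (\<xi> (Suc n))) \<in> tedges T" for n
    using tree_auts_edge[OF f] ray_vert[OF \<xi>] \<xi> by (simp add: rays_def)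
  moreover have "f (\<xi> 0) = troot T" using f \<xi> by (simp add: tree_auts_def rays_def)
  ultimately show ?thesis by (simp add: rays_def)
qed

end

locale lf_graded_tree = graded_tree +
  assumes locally_finite: "locally_finite T" and leafless: "leafless T"
begin

lemma lf_rooted_tree: "lf_rooted_tree T"
  by (simp add: lf_rooted_tree_def rooted_tree locally_finite leafless)

lemma finite_level: "finite (level T n)"
proof (induction n)
  case 0
  have "level T 0 = {troot T}" using l_0_iff root_vert by (auto simp: level_eq)
  then show ?case by simp
next
  case (Suc n)
  have "level T (Suc n) \<subseteq> (\<Union>v\<in>level T n. {w. (v, w) \<in> tedges T})"
  proof
    fix w assume w: "w \<in> level T (Suc n)"
    then have "w \<in> tverts T" "w \<noteq> troot T" "l w = Suc n" using l_root by (auto simp: level_eq)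
    then have "par w \<in> level T n" "(par w, w) \<in> tedges T"
      using par_vert[of w] l_par[of w] edge_iff by (auto simp: level_eq)
    then show "w \<in> (\<Union>v\<in>level T n. {w. (v, w) \<in> tedges T})" by blast
  qed
  then show ?case
    using Suc locally_finite by (auto simp: locally_finite_def level_eq elim!: finite_subset)
qed

lemma child_exists: "v \<in> tverts T \<Longrightarrow> \<exists>w\<in>tverts T. w \<noteq> troot T \<and> par w = v"
proof -
  assume v: "v \<in> tverts T"
  then obtain w where w: "w \<in> level T (Suc (l v))" "(v, w) \<in> tedges T"
    using leafless by (force simp: leafless_def level_eq)
  then show ?thesis using edge_iff[of v w] l_par[of v] l_root by (auto simp: level_eq)
qed

lemma ray_through:
  assumes v: "v \<in> tverts T" shows "\<exists>\<xi>\<in>rays T. \<xi> (l v) = v"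
proof -
  obtain ch where ch: "\<And>v. v \<in> tverts T \<Longrightarrow> ch v \<in> tverts T \<and> ch v \<noteq> troot T \<and> par (ch v) = v"
    using child_exists by metis
  \<comment> \<open>Iterated parents of \<open>v\<close> up to its level, iterated chosen children
    from there on.\<close>
  define \<xi> where "\<xi> n = (if n \<le> l v then (par ^^ (l v - n)) v else (ch ^^ (n - l v)) v)" for n
  have up: "k \<le> l v \<Longrightarrow> (par ^^ k) v \<in> tverts T \<and> l ((par ^^ k) v) = l v - k" for k
  proof (induction k)
    case (Suc k)
    then have "(par ^^ k) v \<noteq> troot T" using l_root by auto
    then show ?case using Suc par_vert[of "(par ^^ k) v"] l_par[of "(par ^^ k) v"] by simp
  qed (use v in simp)
  have down: "(ch ^^ k) v \<in> tverts T \<and> l ((ch ^^ k) v) = l v + k" for k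
  proof (induction k)
    case (Suc k)
    then show ?case using ch[of "(ch ^^ k) v"] l_par[of "(ch ^^ Suc k) v"] by simp
  qed (use v in simp)
  have "\<xi> n \<in> tverts T \<and> l (\<xi> n) = n" for n using up[of "l v - n"] down[of "n - l v"] by (simp add: \<xi>_def)
  moreover have "par (\<xi> (Suc n)) = \<xi> n" for n
  proof (cases "Suc n \<le> l v")
    case True
    then have "l v - n = Suc (l v - Suc n)" by simp
    then show ?thesis using True by (simp add: \<xi>_def)
  next
    case False
    then have "Suc n - l v = Suc (n - l v)" by simp
    then show ?thesis using False ch down[of "n - l v"] by (cases "n = l v") (auto simp: \<xi>_def)
  qed
  ultimately have "\<xi> \<in> rays T" by (simp add: rays_iff)
  moreover have "\<xi> (l v) = v" by (simp add: \<xi>_def)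
  ultimately show ?thesis by blast
qed

lemma rays_ne: "rays T \<noteq> {}"
  using ray_through root_vert by blast

lemma level_rays: "level T n = (\<lambda>\<xi>. \<xi> n) ` rays T"
proof
  show "level T n \<subseteq> (\<lambda>\<xi>. \<xi> n) ` rays T"
  proof
    fix v assume "v \<in> level T n"
    then have v: "v \<in> tverts T" "l v = n" by (auto simp: level_eq)
    show "v \<in> (\<lambda>\<xi>. \<xi> n) ` rays T" using ray_through[OF v(1)] v(2) by (metis imageI)
  qed
qed (use ray_vert ray_level in \<open>auto simp: level_eq\<close>)

lemma finite_prefixes: "finite ((\<lambda>\<xi>. \<xi> n) ` rays T)"
  using finite_level level_rays by metis

text \<open>Every vertex lies on a ray, since the tree has no leaves.\<close>

lemma tree_auts_ray_eqI:
  assumes "f \<in> tree_auts T" "g \<in> tree_auts T" "\<And>\<xi>. \<xi> \<in> rays T \<Longrightarrow> f \<circ> \<xi> = g \<circ> \<xi>"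
  shows "f = g"
proof (rule tree_auts_eqI[OF assms(1,2)])
  fix v assume "v \<in> tverts T"
  then obtain \<xi> where "\<xi> \<in> rays T" "\<xi> (l v) = v" using ray_through by blast
  then show "f v = g v" using assms(3)[of \<xi>] by (metis comp_apply)
qed

text \<open>Moves rigid stabilisers to the boundary. A vertex outside the subtree either lies on a
  ray avoiding \<open>v\<close>, which is fixed, or lies above \<open>v\<close>, which needs an
  extra argument.\<close>

lemma rist_rays:
  assumes G: "G \<subseteq> tree_auts T" and v: "v \<in> tverts T"
  shows "rist T G v = {g \<in> G. \<forall>\<xi>\<in>rays T. \<xi> (l v) \<noteq> v \<longrightarrow> g \<circ> \<xi> = \<xi>}"
proof (intro equalityI subsetI)
  fix g assume g: "g \<in> rist T G v"
  have "g (\<xi> n) = \<xi> n" if "\<xi> \<in> rays T" "\<xi> (l v) \<noteq> v" for \<xi> n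
    using g that ray_vert subtree_ray_iff[of \<xi> n v] by (auto simp: rist_def)
  then show "g \<in> {g \<in> G. \<forall>\<xi>\<in>rays T. \<xi> (l v) \<noteq> v \<longrightarrow> g \<circ> \<xi> = \<xi>}"
    using g by (auto simp: rist_def fun_eq_iff)
next
  fix g assume g: "g \<in> {g \<in> G. \<forall>\<xi>\<in>rays T. \<xi> (l v) \<noteq> v \<longrightarrow> g \<circ> \<xi> = \<xi>}"
  then have ga: "g \<in> tree_auts T" using G by blast
  have "g w = w" if w: "w \<in> tverts T" "w \<notin> subtree T v" for w
  proof -
    obtain \<xi> where \<xi>: "\<xi> \<in> rays T" "\<xi> (l w) = w" using ray_through w by blast
    show ?thesis
    proof (cases "\<xi> (l v) = v")
      case False
      then have "g \<circ> \<xi> = \<xi>" using g \<xi> by blast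
      then show ?thesis using \<xi>(2) by (metis comp_apply)
    next
      case True
      then have lw: "l w \<le> l v" using w \<xi> subtree_ray_iff[OF \<xi>(1), of "l w" v] by auto
      \<comment> \<open>If \<open>g\<close> moved \<open>\<xi>\<close> off \<open>v\<close>, then
        \<open>g \<circ> \<xi>\<close> would avoid \<open>v\<close> and hence be fixed by
        \<open>g\<close>; by injectivity \<open>g\<close> would fix \<open>\<xi> (l v)\<close> after
        all.\<close>
      have "(g \<circ> \<xi>) (l v) = v"
      proof (rule ccontr)
        assume n: "(g \<circ> \<xi>) (l v) \<noteq> v"
        then have "g \<circ> (g \<circ> \<xi>) = g \<circ> \<xi>" using g aut_ray[OF ga \<xi>(1)] by blast
        then have "g (g (\<xi> (l v))) = g (\<xi> (l v))" by (metis comp_apply)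
        then have "g (\<xi> (l v)) = \<xi> (l v)"
          using bij_betw_imp_inj_on[OF tree_auts_bij[OF ga]] ray_vert[OF \<xi>(1)] tree_auts_vert[OF ga]
          by (meson inj_onD)
        then show False using n True by simp
      qed
      then have "(g \<circ> \<xi>) (l w) = \<xi> (l w)" using ray_prefix[OF aut_ray[OF ga \<xi>(1)] \<xi>(1) _ lw] True by simp
      then show ?thesis using \<xi>(2) by simp
    qed
  qed
  then show "g \<in> rist T G v" using g by (auto simp: rist_def)
qed

section \<open>The topology of the boundary\<close>

lemma topspace_boundary: "topspace (boundary T) = rays T"
proof -
  have "rays T \<subseteq> Cyl T (troot T)" by (auto simp: Cyl_def rays_def image_iff) metis
  then show ?thesis using root_vert unfolding boundary_def topology_generated_by_topspace
    by (auto simp: Cyl_def)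
qed

text \<open>The vertex of a ray at level n determines all earlier ones. So the cylinders through a
  ray decrease with the level, and a neighbourhood can be tested at a single level.\<close>

lemma openin_boundary:
  "openin (boundary T) U \<longleftrightarrow> U \<subseteq> rays T \<and> (\<forall>\<xi>\<in>U. \<exists>n. \<forall>\<eta>\<in>rays T. \<eta> n = \<xi> n \<longrightarrow> \<eta> \<in> U)"
proof
  assume "openin (boundary T) U"
  then have "generate_topology_on {Cyl T v | v. v \<in> tverts T} U"
    by (simp add: boundary_def openin_topology_generated_by_iff)
  then show "U \<subseteq> rays T \<and> (\<forall>\<xi>\<in>U. \<exists>n. \<forall>\<eta>\<in>rays T. \<eta> n = \<xi> n \<longrightarrow> \<eta> \<in> U)"
  proof induction
    case (Int U V)
    have "\<exists>n. \<forall>\<eta>\<in>rays T. \<eta> n = \<xi> n \<longrightarrow> \<eta> \<in> U \<inter> V" if \<xi>: "\<xi> \<in> U \<inter> V" for \<xi>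
    proof -
      obtain n m where nm: "\<forall>\<eta>\<in>rays T. \<eta> n = \<xi> n \<longrightarrow> \<eta> \<in> U" "\<forall>\<eta>\<in>rays T. \<eta> m = \<xi> m \<longrightarrow> \<eta> \<in> V"
        using Int \<xi> by blast
      have "\<eta> \<in> U \<inter> V" if "\<eta> \<in> rays T" "\<eta> (max n m) = \<xi> (max n m)" for \<eta>
      proof -
        have x: "\<xi> \<in> rays T" using Int \<xi> by blast
        show ?thesis
          using nm that(1) ray_prefix[OF that(1) x that(2) max.cobounded1]
            ray_prefix[OF that(1) x that(2) max.cobounded2] by blast
      qed
      then show ?thesis by blast
    qed
    then show ?case using Int by blast
  next
    case (UN K)
    then show ?case by (meson UnionE UnionI Sup_least)
  next
    case (Basis U)
    then obtain v where v: "U = Cyl T v" "v \<in> tverts T" by blast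
    then show ?case unfolding v(1) Cyl_eq[OF v(2)] by (auto intro!: exI[of _ "l v"])
  qed simp
next
  assume U: "U \<subseteq> rays T \<and> (\<forall>\<xi>\<in>U. \<exists>n. \<forall>\<eta>\<in>rays T. \<eta> n = \<xi> n \<longrightarrow> \<eta> \<in> U)"
  define F where "F = {Cyl T v | v. v \<in> tverts T \<and> Cyl T v \<subseteq> U}"
  have "U \<subseteq> \<Union>F"
  proof
    fix \<xi> assume \<xi>: "\<xi> \<in> U"
    then obtain n where n: "\<forall>\<eta>\<in>rays T. \<eta> n = \<xi> n \<longrightarrow> \<eta> \<in> U" using U by blast
    have r: "\<xi> \<in> rays T" using \<xi> U by blast
    have "Cyl T (\<xi> n) = {\<eta> \<in> rays T. \<eta> n = \<xi> n}" using Cyl_eq ray_vert[OF r] ray_level[OF r] by simp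
    then show "\<xi> \<in> \<Union>F" using n r ray_vert[OF r] unfolding F_def by blast
  qed
  then have "U = \<Union>F" unfolding F_def by blast
  moreover have "openin (boundary T) V" if "V \<in> F" for V
    using that unfolding F_def boundary_def by (auto intro: topology_generated_by_Basis)
  ultimately show "openin (boundary T) U" by auto
qed

lemma openin_prefix: "openin (boundary T) {\<eta> \<in> rays T. \<eta> n = v}"
  by (auto simp: openin_boundary)

text \<open>Koenig's argument, with a vertex called good if finitely many of the open sets cover its
  cylinder. A bad vertex has a bad child because levels are finite, so badness would propagate along
  a ray; but the open set containing that ray makes some vertex on it good.\<close>

lemma compact_boundary: "compact_space (boundary T)"
  unfolding compact_space_def compactin_def topspace_boundary
proof (intro conjI allI impI)
  fix \<U> assume \<U>: "(\<forall>U\<in>\<U>. openin (boundary T) U) \<and> rays T \<subseteq> \<Union>\<U>"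
  define good where "good v \<longleftrightarrow> (\<exists>\<F>. finite \<F> \<and> \<F> \<subseteq> \<U> \<and> Cyl T v \<subseteq> \<Union>\<F>)" for v
  have step: "\<exists>w. (w \<in> level T (Suc n) \<and> \<not> good w) \<and> par w = v" if v: "v \<in> level T n \<and> \<not> good v" for v n
  proof (rule ccontr)
    assume "\<not> ?thesis"
    then have "\<forall>w\<in>{w \<in> level T (Suc n). par w = v}. good w" by blast
    then obtain \<F> where \<F>: "\<And>w. w \<in> {w \<in> level T (Suc n). par w = v} \<Longrightarrow>
        finite (\<F> w) \<and> \<F> w \<subseteq> \<U> \<and> Cyl T w \<subseteq> \<Union>(\<F> w)" unfolding good_def by metis
    let ?K = "{w \<in> level T (Suc n). par w = v}"
    have vv: "v \<in> tverts T" "l v = n" using v by (auto simp: level_eq)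
    have "Cyl T v \<subseteq> \<Union>(\<Union>(\<F> ` ?K))"
    proof
      fix \<xi> assume "\<xi> \<in> Cyl T v"
      then have \<xi>: "\<xi> \<in> rays T" "\<xi> n = v" using Cyl_eq vv by auto
      then have K: "\<xi> (Suc n) \<in> ?K" using ray_vert ray_level ray_par by (auto simp: level_eq)
      moreover have "\<xi> \<in> Cyl T (\<xi> (Suc n))" using \<xi> by (simp add: Cyl_def)
      ultimately show "\<xi> \<in> \<Union>(\<Union>(\<F> ` ?K))" using \<F>[OF K] by blast
    qed
    moreover have "finite (\<Union>(\<F> ` ?K))" "\<Union>(\<F> ` ?K) \<subseteq> \<U>" using \<F> finite_level by auto
    ultimately have "good v" unfolding good_def by blast
    then show False using v by blast
  qed
  have "good (troot T)"
  proof (rule ccontr)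
    assume "\<not> good (troot T)"
    then have "\<exists>x. x \<in> level T 0 \<and> \<not> good x" using root_vert l_root by (auto simp: level_eq)
    then obtain \<xi> where \<xi>: "\<And>n. (\<xi> n \<in> level T n \<and> \<not> good (\<xi> n)) \<and> par (\<xi> (Suc n)) = \<xi> n"
    proof -
      have "\<exists>\<xi>. \<forall>n. (\<xi> n \<in> level T n \<and> \<not> good (\<xi> n)) \<and> par (\<xi> (Suc n)) = \<xi> n"
      proof (rule dependent_nat_choice)
        fix v n assume "v \<in> level T n \<and> \<not> good v"
        then show "\<exists>w. (w \<in> level T (Suc n) \<and> \<not> good w) \<and> par w = v" by (rule step)
      qed fact
      then show ?thesis using that by blast
    qed
    have r: "\<xi> \<in> rays T" unfolding rays_iff
    proof
      fix n
      show "\<xi> n \<in> tverts T \<and> l (\<xi> n) = n \<and> par (\<xi> (Suc n)) = \<xi> n"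
        using \<xi>[of n] by (simp add: level_eq)
    qed
    then obtain U where U: "U \<in> \<U>" "\<xi> \<in> U" using \<U> by blast
    then have "openin (boundary T) U" using \<U> by blast
    then obtain n where "\<forall>\<eta>\<in>rays T. \<eta> n = \<xi> n \<longrightarrow> \<eta> \<in> U"
      using U(2) by (auto simp: openin_boundary)
    then have "Cyl T (\<xi> n) \<subseteq> \<Union>{U}" using Cyl_eq ray_vert[OF r] ray_level[OF r] by auto
    then have "good (\<xi> n)" unfolding good_def using U(1) by (intro exI[of _ "{U}"]) auto
    then show False using \<xi> by blast
  qed
  moreover have "Cyl T (troot T) = rays T" using Cyl_eq[OF root_vert] l_root by (auto simp: rays_def)
  ultimately show "\<exists>\<F>. finite \<F> \<and> \<F> \<subseteq> \<U> \<and> rays T \<subseteq> \<Union>\<F>" unfolding good_def by simp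
qed simp

lemma totally_disconnected_boundary: "totally_disconnected_space (boundary T)"
  unfolding totally_disconnected_space_def
proof (intro allI impI)
  fix S assume S: "connectedin (boundary T) S"
  have "\<xi> = \<eta>" if x: "\<xi> \<in> S" "\<eta> \<in> S" for \<xi> \<eta>
  proof (rule ccontr)
    assume "\<xi> \<noteq> \<eta>"
    then obtain n where n: "\<xi> n \<noteq> \<eta> n" by (auto simp: fun_eq_iff)
    define A B where "A = {\<zeta> \<in> rays T. \<zeta> n = \<xi> n}" and "B = {\<zeta> \<in> rays T. \<zeta> n \<noteq> \<xi> n}"
    have "openin (boundary T) A" "openin (boundary T) B"
      unfolding A_def B_def openin_boundary by (auto intro!: exI[of _ n])
    moreover have "S \<subseteq> A \<union> B" "A \<inter> B \<inter> S = {}" "A \<inter> S \<noteq> {}" "B \<inter> S \<noteq> {}"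
      using S x n connectedin_subset_topspace[OF S] by (auto simp: A_def B_def topspace_boundary)
    ultimately show False using S unfolding connectedin by blast
  qed
  then show "\<exists>x. S \<subseteq> {x}" by blast
qed

end

lemma lf_rooted_tree_graded:
  assumes "lf_rooted_tree T"
  shows "\<exists>par. lf_graded_tree T (graph_dist T (troot T)) par"
  using assms rooted_tree_graded[of T]
  by (auto simp: lf_rooted_tree_def lf_graded_tree_def lf_graded_tree_axioms_def)

lemma continuous_map_boundary:
  assumes "lf_graded_tree S k q" "lf_graded_tree T l par"
  shows "continuous_map (boundary S) (boundary T) h \<longleftrightarrow> h \<in> rays S \<rightarrow> rays T \<and>
    (\<forall>\<xi>\<in>rays S. \<forall>n. \<exists>m. \<forall>\<eta>\<in>rays S. \<eta> m = \<xi> m \<longrightarrow> h \<eta> n = h \<xi> n)"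
proof -
  interpret S: lf_graded_tree S k q by fact
  interpret T: lf_graded_tree T l par by fact
  show ?thesis unfolding continuous_map S.topspace_boundary T.topspace_boundary image_subset_iff_funcset
  proof (intro conj_cong refl iffI allI ballI impI)
    fix \<xi> n assume h: "h \<in> rays S \<rightarrow> rays T" and \<xi>: "\<xi> \<in> rays S"
      and *: "\<forall>U. openin (boundary T) U \<longrightarrow> openin (boundary S) {x \<in> rays S. h x \<in> U}"
    have "openin (boundary S) {x \<in> rays S. h x \<in> {\<eta> \<in> rays T. \<eta> n = h \<xi> n}}"
      using * T.openin_prefix by blast
    moreover have "\<xi> \<in> {x \<in> rays S. h x \<in> {\<eta> \<in> rays T. \<eta> n = h \<xi> n}}" using h \<xi> by auto
    ultimately show "\<exists>m. \<forall>\<eta>\<in>rays S. \<eta> m = \<xi> m \<longrightarrow> h \<eta> n = h \<xi> n"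
      unfolding S.openin_boundary by blast
  next
    fix U assume h: "h \<in> rays S \<rightarrow> rays T" and U: "openin (boundary T) U"
      and *: "\<forall>\<xi>\<in>rays S. \<forall>n. \<exists>m. \<forall>\<eta>\<in>rays S. \<eta> m = \<xi> m \<longrightarrow> h \<eta> n = h \<xi> n"
    show "openin (boundary S) {x \<in> rays S. h x \<in> U}" unfolding S.openin_boundary
    proof (intro conjI ballI)
      fix \<xi> assume "\<xi> \<in> {x \<in> rays S. h x \<in> U}"
      then have \<xi>: "\<xi> \<in> rays S" "h \<xi> \<in> U" by auto
      then obtain n where n: "\<forall>\<eta>\<in>rays T. \<eta> n = h \<xi> n \<longrightarrow> \<eta> \<in> U" using U T.openin_boundary by blast
      obtain m where "\<forall>\<eta>\<in>rays S. \<eta> m = \<xi> m \<longrightarrow> h \<eta> n = h \<xi> n" using * \<xi> by blast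
      then show "\<exists>m. \<forall>\<eta>\<in>rays S. \<eta> m = \<xi> m \<longrightarrow> \<eta> \<in> {x \<in> rays S. h x \<in> U}"
        using n h by (intro exI[of _ m]) auto
    qed blast
  qed
qed

section \<open>Groups acting on spaces of rays\<close>

text \<open>What the argument of Lavreniuk and Nekrashevych needs of the boundary: equality at index
  n gives nested finite partitions (\<open>prefix\<close>, \<open>fin_level\<close>),
  \<open>X_closed\<close> provides limits, and the group permutes the parts of each partition
  transitively. \<open>act_eqI\<close> is faithfulness, \<open>rigid\<close> nontriviality of rigid
  stabilisers.\<close>

locale boundary_action = group \<Gamma> for \<Gamma> :: "('g, 'b) monoid_scheme" (structure) +
  fixes X :: "(nat \<Rightarrow> 'v) set" and act :: "'g \<Rightarrow> (nat \<Rightarrow> 'v) \<Rightarrow> nat \<Rightarrow> 'v" (infixr \<open>\<cdot>\<close> 75)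
  assumes X_ne: "X \<noteq> {}"
    and prefix: "\<lbrakk>\<xi> \<in> X; \<eta> \<in> X; \<xi> n = \<eta> n; m \<le> n\<rbrakk> \<Longrightarrow> \<xi> m = \<eta> m"
    and fin_level: "finite ((\<lambda>\<xi>. \<xi> n) ` X)"
    and X_closed: "(\<And>n. \<exists>\<xi>\<in>X. \<forall>i\<le>n. \<xi> i = f i) \<Longrightarrow> f \<in> X"
    and act_closed [simp]: "\<lbrakk>g \<in> carrier \<Gamma>; \<xi> \<in> X\<rbrakk> \<Longrightarrow> g \<cdot> \<xi> \<in> X"
    and act_one [simp]: "\<xi> \<in> X \<Longrightarrow> \<one> \<cdot> \<xi> = \<xi>"
    and act_mult: "\<lbrakk>g \<in> carrier \<Gamma>; h \<in> carrier \<Gamma>; \<xi> \<in> X\<rbrakk> \<Longrightarrow> (g \<otimes> h) \<cdot> \<xi> = g \<cdot> h \<cdot> \<xi>"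
    and act_eqI: "\<lbrakk>g \<in> carrier \<Gamma>; h \<in> carrier \<Gamma>; \<And>\<xi>. \<xi> \<in> X \<Longrightarrow> g \<cdot> \<xi> = h \<cdot> \<xi>\<rbrakk> \<Longrightarrow> g = h"
    and act_level: "\<lbrakk>g \<in> carrier \<Gamma>; \<xi> \<in> X; \<eta> \<in> X; \<xi> n = \<eta> n\<rbrakk> \<Longrightarrow> (g \<cdot> \<xi>) n = (g \<cdot> \<eta>) n"
    and act_trans: "\<lbrakk>\<xi> \<in> X; \<eta> \<in> X\<rbrakk> \<Longrightarrow> \<exists>g\<in>carrier \<Gamma>. (g \<cdot> \<xi>) n = \<eta> n"
    and rigid: "\<xi> \<in> X \<Longrightarrow> \<exists>g\<in>carrier \<Gamma>. g \<noteq> \<one> \<and> (\<forall>\<eta>\<in>X. \<eta> n \<noteq> \<xi> n \<longrightarrow> g \<cdot> \<eta> = \<eta>)"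
begin

definition cyl :: "(nat \<Rightarrow> 'v) \<Rightarrow> nat \<Rightarrow> (nat \<Rightarrow> 'v) set" where
  "cyl \<xi> n = {\<eta> \<in> X. \<eta> n = \<xi> n}"

definition rst :: "(nat \<Rightarrow> 'v) set \<Rightarrow> 'g set" where
  "rst U = {g \<in> carrier \<Gamma>. \<forall>\<eta>\<in>X. \<eta> \<notin> U \<longrightarrow> g \<cdot> \<eta> = \<eta>}"

definition supp :: "'g set \<Rightarrow> (nat \<Rightarrow> 'v) set" where
  "supp A = {\<xi> \<in> X. \<exists>a\<in>A. a \<cdot> \<xi> \<noteq> \<xi>}"

text \<open>As \<open>X\<close> is compact, its clopen subsets are the unions of cylinders of one
  common level. This form keeps topologies out of the locale.\<close>

definition clop :: "(nat \<Rightarrow> 'v) set \<Rightarrow> bool" where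
  "clop U \<longleftrightarrow> U \<subseteq> X \<and> (\<exists>n. \<forall>\<xi>\<in>X. \<forall>\<eta>\<in>X. \<xi> n = \<eta> n \<longrightarrow> (\<xi> \<in> U \<longleftrightarrow> \<eta> \<in> U))"

definition conjg :: "'g \<Rightarrow> 'g set \<Rightarrow> 'g set" where
  "conjg g A = (\<lambda>a. g \<otimes> a \<otimes> inv g) ` A"

text \<open>Purely group-theoretic, hence preserved by automorphisms (\<open>fin_conj_auto\<close>),
  and yet tied to clopen sets by \<open>fin_conj_rst\<close> and \<open>supp_clop\<close>. For a
  subgroup it says that the normalizer has finite index.\<close>

definition fin_conj :: "'g set \<Rightarrow> bool" where
  "fin_conj A \<longleftrightarrow> A \<subseteq> carrier \<Gamma> \<and> finite ((\<lambda>g. conjg g A) ` carrier \<Gamma>)"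

definition comm :: "'g \<Rightarrow> 'g \<Rightarrow> 'g" where
  "comm x y = x \<otimes> y \<otimes> inv x \<otimes> inv y"

lemma inv_act [simp]: "\<lbrakk>g \<in> carrier \<Gamma>; \<xi> \<in> X\<rbrakk> \<Longrightarrow> inv g \<cdot> g \<cdot> \<xi> = \<xi>"
  using act_mult[of "inv g" g \<xi>] by simp

lemma act_inv [simp]: "\<lbrakk>g \<in> carrier \<Gamma>; \<xi> \<in> X\<rbrakk> \<Longrightarrow> g \<cdot> inv g \<cdot> \<xi> = \<xi>"
  using act_mult[of g "inv g" \<xi>] by simp

lemma act_inj: "\<lbrakk>g \<in> carrier \<Gamma>; \<xi> \<in> X; \<eta> \<in> X\<rbrakk> \<Longrightarrow> g \<cdot> \<xi> = g \<cdot> \<eta> \<longleftrightarrow> \<xi> = \<eta>"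
  by (metis inv_act)

lemma inv_fix: "\<lbrakk>g \<in> carrier \<Gamma>; \<xi> \<in> X\<rbrakk> \<Longrightarrow> inv g \<cdot> \<xi> = \<xi> \<longleftrightarrow> g \<cdot> \<xi> = \<xi>"
  by (metis inv_act act_inv)

lemma comm_closed [simp]: "\<lbrakk>x \<in> carrier \<Gamma>; y \<in> carrier \<Gamma>\<rbrakk> \<Longrightarrow> comm x y \<in> carrier \<Gamma>"
  by (simp add: comm_def)

lemma comm_act:
  "\<lbrakk>x \<in> carrier \<Gamma>; y \<in> carrier \<Gamma>; \<xi> \<in> X\<rbrakk> \<Longrightarrow> comm x y \<cdot> \<xi> = x \<cdot> y \<cdot> inv x \<cdot> inv y \<cdot> \<xi>"
  by (simp add: comm_def act_mult)

lemma act_level_iff: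
  "\<lbrakk>g \<in> carrier \<Gamma>; \<xi> \<in> X; \<eta> \<in> X\<rbrakk> \<Longrightarrow> (g \<cdot> \<xi>) n = (g \<cdot> \<eta>) n \<longleftrightarrow> \<xi> n = \<eta> n"
  using act_level[of g \<xi> \<eta> n] act_level[of "inv g" "g \<cdot> \<xi>" "g \<cdot> \<eta>" n] by auto

lemma differ_mono: "\<lbrakk>\<xi> \<in> X; \<eta> \<in> X; \<xi> m \<noteq> \<eta> m; m \<le> n\<rbrakk> \<Longrightarrow> \<xi> n \<noteq> \<eta> n"
  using prefix by blast

lemma cyl_sub: "cyl \<xi> n \<subseteq> X"
  by (auto simp: cyl_def)

lemma cyl_self [simp]: "\<xi> \<in> X \<Longrightarrow> \<xi> \<in> cyl \<xi> n"
  by (simp add: cyl_def)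

lemma cyl_mono: "\<lbrakk>\<xi> \<in> X; \<eta> \<in> cyl \<xi> n; n \<le> m\<rbrakk> \<Longrightarrow> cyl \<eta> m \<subseteq> cyl \<xi> n"
  by (auto simp: cyl_def) (metis prefix)

lemma rst_closed: "g \<in> rst U \<Longrightarrow> g \<in> carrier \<Gamma>"
  by (simp add: rst_def)

lemma rst_fix: "\<lbrakk>g \<in> rst U; \<xi> \<in> X; \<xi> \<notin> U\<rbrakk> \<Longrightarrow> g \<cdot> \<xi> = \<xi>"
  by (simp add: rst_def)

lemma rst_inv:
  assumes "g \<in> rst U" shows "inv g \<in> rst U"
proof -
  have g: "g \<in> carrier \<Gamma>" using assms by (rule rst_closed)
  have "inv g \<cdot> \<eta> = \<eta>" if "\<eta> \<in> X" "\<eta> \<notin> U" for \<eta>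
    using inv_fix[OF g that(1)] rst_fix[OF assms that] by blast
  then show ?thesis using g by (simp add: rst_def)
qed

lemma rst_stable:
  assumes "g \<in> rst U" "\<xi> \<in> U" "\<xi> \<in> X" shows "g \<cdot> \<xi> \<in> U"
proof (rule ccontr)
  assume n: "g \<cdot> \<xi> \<notin> U"
  have g: "g \<in> carrier \<Gamma>" using assms(1) by (rule rst_closed)
  have "g \<cdot> g \<cdot> \<xi> = g \<cdot> \<xi>" using rst_fix[OF assms(1) _ n] g assms(3) by simp
  then have "g \<cdot> \<xi> = \<xi>"
    using act_inj[OF g act_closed[OF g assms(3)] assms(3)] by blast
  then show False using n assms(2) by simp
qed

lemma rst_subgroup: "subgroup (rst U) \<Gamma>"
proof
  show "rst U \<subseteq> carrier \<Gamma>" "\<one> \<in> rst U" by (auto simp: rst_def)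
  show "x \<otimes> y \<in> rst U" if "x \<in> rst U" "y \<in> rst U" for x y
    using that by (auto simp: rst_def act_mult)
qed (rule rst_inv)

lemma rst_mono: "U \<subseteq> V \<Longrightarrow> rst U \<subseteq> rst V"
  by (auto simp: rst_def)

lemma rst_cyl_nontrivial: "\<xi> \<in> X \<Longrightarrow> \<exists>g\<in>rst (cyl \<xi> n). g \<noteq> \<one>"
  using rigid[of \<xi> n] by (auto simp: rst_def cyl_def)

lemma moved_point:
  assumes "g \<in> rst U" "g \<noteq> \<one>"
  obtains \<eta> where "\<eta> \<in> U" "\<eta> \<in> X" "g \<cdot> \<eta> \<noteq> \<eta>"
  using act_eqI[of g \<one>] assms act_one one_closed rst_closed rst_fix by metis

lemma moved_cyl:
  assumes "\<xi> \<in> X" "g \<in> rst (cyl \<xi> n)" "g \<noteq> \<one>"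
  obtains \<eta> m where "\<eta> \<in> X" "cyl \<eta> m \<subseteq> cyl \<xi> n" "(g \<cdot> \<eta>) m \<noteq> \<eta> m"
proof -
  obtain \<eta> where \<eta>: "\<eta> \<in> cyl \<xi> n" "\<eta> \<in> X" "g \<cdot> \<eta> \<noteq> \<eta>" using moved_point assms(2,3) by blast
  then obtain k where "(g \<cdot> \<eta>) k \<noteq> \<eta> k" by (auto simp: fun_eq_iff)
  then have "(g \<cdot> \<eta>) (max k n) \<noteq> \<eta> (max k n)"
    using differ_mono[of "g \<cdot> \<eta>" \<eta> k "max k n"] \<eta> rst_closed[OF assms(2)] by auto
  then show ?thesis using that[of \<eta> "max k n"] \<eta> cyl_mono[OF assms(1) \<eta>(1), of "max k n"] by auto
qed

section \<open>Commutators of elements supported in cylinders\<close>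

lemma moved_disjoint:
  assumes "g \<in> carrier \<Gamma>" "\<eta> \<in> X" "(g \<cdot> \<eta>) m \<noteq> \<eta> m" "\<zeta> \<in> cyl \<eta> m"
  shows "g \<cdot> \<zeta> \<notin> cyl \<eta> m" "inv g \<cdot> \<zeta> \<notin> cyl \<eta> m"
proof -
  have z: "\<zeta> \<in> X" "\<zeta> m = \<eta> m" using assms(4) by (auto simp: cyl_def)
  have "(g \<cdot> \<zeta>) m = (g \<cdot> \<eta>) m" using z assms by (simp add: act_level_iff)
  then show "g \<cdot> \<zeta> \<notin> cyl \<eta> m" using assms by (simp add: cyl_def)
  show "inv g \<cdot> \<zeta> \<notin> cyl \<eta> m"
  proof
    assume "inv g \<cdot> \<zeta> \<in> cyl \<eta> m"
    then have "(inv g \<cdot> \<zeta>) m = \<eta> m" by (simp add: cyl_def)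
    then have "(g \<cdot> inv g \<cdot> \<zeta>) m = (g \<cdot> \<eta>) m"
      using assms z by (intro act_level) auto
    then show False using assms z by simp
  qed
qed

text \<open>\<open>comm r s\<close> is the conjugate of \<open>s\<close> by \<open>r\<close>, times
  \<open>inv s\<close>. The conjugate is supported in the translate of the cylinder by
  \<open>r\<close>, which is disjoint from the cylinder.\<close>

lemma comm_on_cyl:
  assumes "r \<in> carrier \<Gamma>" "\<eta> \<in> X" "(r \<cdot> \<eta>) m \<noteq> \<eta> m" "s \<in> rst (cyl \<eta> m)" "\<zeta> \<in> cyl \<eta> m"
  shows "comm r s \<cdot> \<zeta> = inv s \<cdot> \<zeta>"
proof -
  have z: "\<zeta> \<in> X" using assms(5) cyl_sub by blast
  have s: "s \<in> carrier \<Gamma>" using assms(4) rst_closed by blast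
  have "inv s \<cdot> \<zeta> \<in> cyl \<eta> m" using assms z rst_inv rst_stable by blast
  then have "inv r \<cdot> inv s \<cdot> \<zeta> \<notin> cyl \<eta> m" using moved_disjoint[OF assms(1,2,3)] by blast
  then have "s \<cdot> inv r \<cdot> inv s \<cdot> \<zeta> = inv r \<cdot> inv s \<cdot> \<zeta>"
    using rst_fix[OF assms(4)] z s assms(1) by simp
  then show ?thesis using assms(1) s z by (simp add: comm_act)
qed

text \<open>Four elements with nested supports: \<open>comm t u\<close> lives in
  \<open>cyl \<xi>2 m2\<close>, and \<open>comm r s\<close> acts there as \<open>inv s\<close>,
  which displaces that cylinder. So \<open>comm r s\<close> carries a point moved by
  \<open>comm t u\<close> to a point fixed by it. The set \<open>Q\<close> is later that of the
  elements normalizing two given groups.\<close>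

lemma noncommuting_commutators:
  assumes Q: "\<And>\<eta> m. \<eta> \<in> X \<Longrightarrow> \<exists>r\<in>rst (cyl \<eta> m) \<inter> Q. r \<noteq> \<one>" and \<xi>: "\<xi> \<in> X"
  shows "\<exists>r\<in>rst (cyl \<xi> n) \<inter> Q. \<exists>s\<in>rst (cyl \<xi> n) \<inter> Q. \<exists>t\<in>rst (cyl \<xi> n) \<inter> Q. \<exists>u\<in>rst (cyl \<xi> n) \<inter> Q.
    comm r s \<otimes> comm t u \<noteq> comm t u \<otimes> comm r s"
proof -
  obtain r where r: "r \<in> rst (cyl \<xi> n)" "r \<in> Q" "r \<noteq> \<one>" using Q[OF \<xi>] by blast
  obtain \<xi>1 m1 where 1: "\<xi>1 \<in> X" "cyl \<xi>1 m1 \<subseteq> cyl \<xi> n" "(r \<cdot> \<xi>1) m1 \<noteq> \<xi>1 m1"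
    using moved_cyl[OF \<xi> r(1,3)] by blast
  obtain s where s: "s \<in> rst (cyl \<xi>1 m1)" "s \<in> Q" "s \<noteq> \<one>" using Q[OF 1(1)] by blast
  obtain \<xi>2 m2 where 2: "\<xi>2 \<in> X" "cyl \<xi>2 m2 \<subseteq> cyl \<xi>1 m1" "(s \<cdot> \<xi>2) m2 \<noteq> \<xi>2 m2"
    using moved_cyl[OF 1(1) s(1,3)] by blast
  obtain t where t: "t \<in> rst (cyl \<xi>2 m2)" "t \<in> Q" "t \<noteq> \<one>" using Q[OF 2(1)] by blast
  obtain \<xi>3 m3 where 3: "\<xi>3 \<in> X" "cyl \<xi>3 m3 \<subseteq> cyl \<xi>2 m2" "(t \<cdot> \<xi>3) m3 \<noteq> \<xi>3 m3"
    using moved_cyl[OF 2(1) t(1,3)] by blast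
  obtain u where u: "u \<in> rst (cyl \<xi>3 m3)" "u \<in> Q" "u \<noteq> \<one>" using Q[OF 3(1)] by blast
  obtain \<zeta> where \<zeta>: "\<zeta> \<in> cyl \<xi>3 m3" "\<zeta> \<in> X" "u \<cdot> \<zeta> \<noteq> \<zeta>" using moved_point u by blast
  have car: "r \<in> carrier \<Gamma>" "s \<in> carrier \<Gamma>" "t \<in> carrier \<Gamma>" "u \<in> carrier \<Gamma>"
    using r s t u rst_closed by auto
  \<comment> \<open>The witness is \<open>u \<cdot> \<zeta>\<close> because \<open>comm t u\<close>
    acts there as \<open>inv u\<close> and moves it back to \<open>\<zeta>\<close>.\<close>
  let ?\<eta> = "u \<cdot> \<zeta>" and ?c = "comm r s" and ?d = "comm t u"
  have \<eta>: "?\<eta> \<in> X" "?\<eta> \<in> cyl \<xi>3 m3" using \<zeta> car u(1) rst_stable by auto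
  have d\<eta>: "?d \<cdot> ?\<eta> = \<zeta>" using comm_on_cyl[OF car(3) 3(1) 3(3) u(1) \<eta>(2)] \<zeta> car by simp
  have \<eta>2: "?\<eta> \<in> cyl \<xi>2 m2" using \<eta> 3 by blast
  have c\<eta>: "?c \<cdot> ?\<eta> = inv s \<cdot> ?\<eta>"
    using comm_on_cyl[OF car(1) 1(1) 1(3) s(1)] \<eta>2 2 by blast
  have nin: "?c \<cdot> ?\<eta> \<notin> cyl \<xi>2 m2" using moved_disjoint[OF car(2) 2(1,3) \<eta>2] c\<eta> by simp
  have uu: "u \<in> rst (cyl \<xi>2 m2)" using u 3 rst_mono by blast
  have "?d \<in> rst (cyl \<xi>2 m2)" unfolding comm_def
    using t(1) uu subgroup.m_closed[OF rst_subgroup] subgroup.m_inv_closed[OF rst_subgroup] by simp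
  then have "?d \<cdot> ?c \<cdot> ?\<eta> = ?c \<cdot> ?\<eta>" using rst_fix nin \<eta> car by simp
  moreover have "?c \<cdot> ?d \<cdot> ?\<eta> \<noteq> ?c \<cdot> ?\<eta>" using d\<eta> \<zeta> \<eta> car by (simp add: act_inj)
  ultimately have "?c \<otimes> ?d \<noteq> ?d \<otimes> ?c" using act_mult \<eta> car by (metis comm_closed)
  moreover have "s \<in> rst (cyl \<xi> n)" using s 1 rst_mono by blast
  moreover have "t \<in> rst (cyl \<xi> n)" using t 1 2 rst_mono by (meson subset_iff)
  moreover have "u \<in> rst (cyl \<xi> n)" using uu 1 2 rst_mono by (meson subset_iff)
  ultimately show ?thesis using r s t u by blast
qed

text \<open>On the cylinder \<open>comm a r\<close> acts as \<open>inv r\<close>; off the cylinder,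
  the commutator of \<open>s\<close> with a map preserving the cylinder is trivial. The result no
  longer depends on \<open>a\<close>, so it can be found in every suitably normalized subgroup
  having an element that displaces the cylinder.\<close>

lemma double_comm_eq:
  assumes "a \<in> carrier \<Gamma>" "\<eta> \<in> X" "(a \<cdot> \<eta>) m \<noteq> \<eta> m" "r \<in> rst (cyl \<eta> m)" "s \<in> rst (cyl \<eta> m)"
  shows "comm (comm a r) s = comm (inv r) s"
proof (rule act_eqI)
  have rc: "r \<in> carrier \<Gamma>" "s \<in> carrier \<Gamma>" using assms rst_closed by auto
  then show "comm (comm a r) s \<in> carrier \<Gamma>" "comm (inv r) s \<in> carrier \<Gamma>" using assms by auto
  let ?W = "cyl \<eta> m" and ?c = "comm a r"
  have c: "?c \<in> carrier \<Gamma>" using rc assms by simp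
  have cW: "?c \<cdot> \<zeta> = inv r \<cdot> \<zeta>" if "\<zeta> \<in> ?W" for \<zeta>
    using comm_on_cyl[OF assms(1,2,3,4) that] .
  have stab: "g \<cdot> \<zeta> \<in> ?W" "inv g \<cdot> \<zeta> \<in> ?W" if "\<zeta> \<in> ?W" "g \<in> rst ?W" for g \<zeta>
    using that rst_stable rst_inv cyl_sub by blast+
  have icW: "inv ?c \<cdot> \<zeta> = r \<cdot> \<zeta>" if "\<zeta> \<in> ?W" for \<zeta>
  proof -
    have z: "\<zeta> \<in> X" using that cyl_sub by blast
    have "?c \<cdot> r \<cdot> \<zeta> = \<zeta>" using cW stab that assms rc z by simp
    then show ?thesis using c rc z by (metis act_closed inv_act)
  qed
  fix \<zeta> assume z: "\<zeta> \<in> X"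
  show "comm (comm a r) s \<cdot> \<zeta> = comm (inv r) s \<cdot> \<zeta>"
  proof (cases "\<zeta> \<in> ?W")
    case True
    have "inv ?c \<cdot> inv s \<cdot> \<zeta> = r \<cdot> inv s \<cdot> \<zeta>" using icW stab True assms by blast
    moreover have "s \<cdot> r \<cdot> inv s \<cdot> \<zeta> \<in> ?W" using stab True assms by blast
    ultimately show ?thesis
      using comm_act[OF c rc(2) z] comm_act[of "inv r" s \<zeta>] cW rc z by simp
  next
    case False
    have s: "inv s \<cdot> \<zeta> = \<zeta>" using False z assms rst_fix rst_inv by blast
    have "inv ?c \<cdot> \<zeta> \<notin> ?W"
    proof
      assume "inv ?c \<cdot> \<zeta> \<in> ?W"
      then have "?c \<cdot> inv ?c \<cdot> \<zeta> \<in> ?W" using cW stab assms by metis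
      then show False using False c z by simp
    qed
    then have "s \<cdot> inv ?c \<cdot> \<zeta> = inv ?c \<cdot> \<zeta>" using rst_fix assms z c by simp
    moreover have "r \<cdot> \<zeta> = \<zeta>" "s \<cdot> \<zeta> = \<zeta>" "inv r \<cdot> \<zeta> = \<zeta>"
      using False z assms rst_fix rst_inv by blast+
    ultimately show ?thesis using c rc assms z s by (simp add: comm_act)
  qed
qed

text \<open>In a finite group, all nontrivial elements would drop out of the rigid stabilisers of
  small enough cylinders around \<open>\<xi>\<close>, but these are never trivial.\<close>

lemma infinite_rst_cyl:
  assumes "\<xi> \<in> X" shows "infinite (rst (cyl \<xi> n))"
proof
  assume fin: "finite (rst (cyl \<xi> n))"
  have "\<exists>k. g \<notin> rst (cyl \<xi> k)" if "g \<in> rst (cyl \<xi> n) - {\<one>}" for g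
  proof -
    have g: "g \<in> carrier \<Gamma>" using that rst_closed by blast
    have "g \<in> rst (cyl \<xi> n)" "g \<noteq> \<one>" using that by auto
    then obtain \<eta> where \<eta>: "\<eta> \<in> X" "g \<cdot> \<eta> \<noteq> \<eta>" by (rule moved_point)
    \<comment> \<open>The moved point has to lie outside some cylinder around \<open>\<xi>\<close>,
      so it must differ from \<open>\<xi>\<close>; if \<open>\<xi>\<close> itself is moved, its
      image is another moved point.\<close>
    have "\<exists>\<eta>\<in>X. g \<cdot> \<eta> \<noteq> \<eta> \<and> \<eta> \<noteq> \<xi>"
    proof (cases "\<eta> = \<xi>")
      case True
      then show ?thesis using \<eta> g act_inj[of g "g \<cdot> \<eta>" \<eta>] by (intro bexI[of _ "g \<cdot> \<eta>"]) auto
    qed (use \<eta> in auto)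
    then obtain \<eta> where \<eta>: "\<eta> \<in> X" "g \<cdot> \<eta> \<noteq> \<eta>" "\<eta> \<noteq> \<xi>" by blast
    then obtain k where "\<eta> k \<noteq> \<xi> k" by (auto simp: fun_eq_iff)
    then have "g \<notin> rst (cyl \<xi> k)" using \<eta> by (auto simp: rst_def cyl_def)
    then show ?thesis ..
  qed
  then obtain k where k: "\<And>g. g \<in> rst (cyl \<xi> n) - {\<one>} \<Longrightarrow> g \<notin> rst (cyl \<xi> (k g))" by metis
  define N where "N = Max (insert n (k ` (rst (cyl \<xi> n) - {\<one>})))"
  obtain g where g: "g \<in> rst (cyl \<xi> N)" "g \<noteq> \<one>" using rst_cyl_nontrivial[OF assms] by blast
  have "n \<le> N" unfolding N_def using fin by simp
  then have "cyl \<xi> N \<subseteq> cyl \<xi> n" using cyl_mono assms by auto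
  then have gn: "g \<in> rst (cyl \<xi> n) - {\<one>}" using g rst_mono by blast
  then have "k g \<le> N" unfolding N_def using fin by simp
  then have "cyl \<xi> N \<subseteq> cyl \<xi> (k g)" using cyl_mono assms by auto
  then show False using k[OF gn] g rst_mono by blast
qed

section \<open>Subsets with finitely many conjugates\<close>

lemma conjg_mult:
  assumes "g \<in> carrier \<Gamma>" "h \<in> carrier \<Gamma>" "A \<subseteq> carrier \<Gamma>"
  shows "conjg (g \<otimes> h) A = conjg g (conjg h A)"
proof -
  have "g \<otimes> h \<otimes> a \<otimes> inv (g \<otimes> h) = g \<otimes> (h \<otimes> a \<otimes> inv h) \<otimes> inv g" if "a \<in> A" for a
    using that assms by (auto simp: inv_mult_group m_assoc subset_iff)
  then show ?thesis by (simp add: conjg_def image_image)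
qed

lemma conjg_one: "A \<subseteq> carrier \<Gamma> \<Longrightarrow> conjg \<one> A = A"
  by (auto simp: conjg_def image_iff subset_iff)

text \<open>Pigeonhole: infinitely many elements produce finitely many pairs of conjugates, and two
  elements with the same pair differ by one that normalizes both sets.\<close>

lemma rst_cyl_normalizing:
  assumes "fin_conj A" "fin_conj B" "\<xi> \<in> X"
  shows "\<exists>r\<in>rst (cyl \<xi> n) \<inter> {r. conjg r A = A \<and> conjg r B = B}. r \<noteq> \<one>"
proof -
  let ?R = "rst (cyl \<xi> n)" and ?f = "\<lambda>g. (conjg g A, conjg g B)"
  have Rc: "?R \<subseteq> carrier \<Gamma>" using rst_closed by blast
  have AB: "A \<subseteq> carrier \<Gamma>" "B \<subseteq> carrier \<Gamma>" using assms by (auto simp: fin_conj_def)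
  have "finite (?f ` ?R)"
    by (rule finite_subset[of _ "((\<lambda>g. conjg g A) ` carrier \<Gamma>) \<times> ((\<lambda>g. conjg g B) ` carrier \<Gamma>)"])
      (use assms Rc in \<open>auto simp: fin_conj_def\<close>)
  then have "\<not> inj_on ?f ?R" using infinite_rst_cyl[OF assms(3)] finite_imageD by blast
  then obtain g h where gh: "g \<in> ?R" "h \<in> ?R" "g \<noteq> h" "conjg g A = conjg h A" "conjg g B = conjg h B"
    by (auto simp: inj_on_def)
  have c: "g \<in> carrier \<Gamma>" "h \<in> carrier \<Gamma>" using gh Rc by auto
  let ?r = "inv g \<otimes> h"
  have "conjg ?r C = C" if "conjg g C = conjg h C" "C \<subseteq> carrier \<Gamma>" for C
    using that c conjg_mult[of "inv g" h C] conjg_mult[of "inv g" g C] by (simp add: conjg_one)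
  then have "conjg ?r A = A" "conjg ?r B = B" using gh AB by auto
  moreover have "?r \<in> ?R"
    using gh subgroup.m_closed[OF rst_subgroup] subgroup.m_inv_closed[OF rst_subgroup] by simp
  moreover have "?r \<noteq> \<one>" using c gh(3) by (metis inv_equality inv_inv inv_closed r_inv inv_comm)
  ultimately show ?thesis by blast
qed

text \<open>The commutator is \<open>a\<close> times the conjugate of \<open>inv a\<close> by
  \<open>r\<close>.\<close>

lemma comm_in_normalized:
  assumes "subgroup A \<Gamma>" "a \<in> A" "r \<in> carrier \<Gamma>" "conjg r A = A"
  shows "comm a r \<in> A"
proof -
  interpret A: subgroup A \<Gamma> by fact
  have "r \<otimes> inv a \<otimes> inv r \<in> conjg r A" using assms(2) by (auto simp: conjg_def)
  then have "a \<otimes> (r \<otimes> inv a \<otimes> inv r) \<in> A" using assms by auto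
  then show ?thesis using assms by (simp add: comm_def m_assoc)
qed

text \<open>On a cylinder moved off itself by both groups, double commutators of normalizing elements
  lie in both groups; these cannot all commute.\<close>

lemma commuting_disjoint_supp:
  assumes A: "subgroup A \<Gamma>" "fin_conj A" and B: "subgroup B \<Gamma>" "fin_conj B"
    and AB: "\<And>a b. \<lbrakk>a \<in> A; b \<in> B\<rbrakk> \<Longrightarrow> a \<otimes> b = b \<otimes> a"
  shows "supp A \<inter> supp B = {}"
proof (rule ccontr)
  assume "supp A \<inter> supp B \<noteq> {}"
  then obtain \<xi> a b where \<xi>: "\<xi> \<in> X" "a \<in> A" "b \<in> B" "a \<cdot> \<xi> \<noteq> \<xi>" "b \<cdot> \<xi> \<noteq> \<xi>"
    by (auto simp: supp_def)
  then obtain i j where "(a \<cdot> \<xi>) i \<noteq> \<xi> i" "(b \<cdot> \<xi>) j \<noteq> \<xi> j" by (auto simp: fun_eq_iff)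
  define n where "n = max i j"
  have c: "a \<in> carrier \<Gamma>" "b \<in> carrier \<Gamma>"
    using \<xi> subgroup.mem_carrier[OF A(1)] subgroup.mem_carrier[OF B(1)] by auto
  have an: "(a \<cdot> \<xi>) n \<noteq> \<xi> n" using differ_mono[of "a \<cdot> \<xi>" \<xi> i n] \<open>(a \<cdot> \<xi>) i \<noteq> \<xi> i\<close> c \<xi> by (auto simp: n_def)
  have bn: "(b \<cdot> \<xi>) n \<noteq> \<xi> n" using differ_mono[of "b \<cdot> \<xi>" \<xi> j n] \<open>(b \<cdot> \<xi>) j \<noteq> \<xi> j\<close> c \<xi> by (auto simp: n_def)
  let ?Q = "{r. conjg r A = A \<and> conjg r B = B}"
  have key: "comm (comm x r) s \<in> C"
    if "subgroup C \<Gamma>" "x \<in> C" "conjg r C = C" "conjg s C = C" "r \<in> carrier \<Gamma>" "s \<in> carrier \<Gamma>" for C x r s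
    using that comm_in_normalized by auto
  have mem: "comm r s \<in> A" "comm r s \<in> B" if "r \<in> rst (cyl \<xi> n) \<inter> ?Q" "s \<in> rst (cyl \<xi> n) \<inter> ?Q" for r s
  proof -
    have rs: "r \<in> carrier \<Gamma>" "s \<in> carrier \<Gamma>" using that rst_closed by auto
    have inr: "inv r \<in> rst (cyl \<xi> n)" using that rst_inv by blast
    have i: "conjg (inv r) C = C" if "conjg r C = C" "C \<subseteq> carrier \<Gamma>" for C
      using that rs conjg_mult[of "inv r" r C] by (simp add: conjg_one)
    have "A \<subseteq> carrier \<Gamma>" "B \<subseteq> carrier \<Gamma>" using A B subgroup.subset by auto
    then have iq: "conjg (inv r) A = A" "conjg (inv r) B = B" using i that by auto
    \<comment> \<open>With \<open>inv r\<close> in place of \<open>r\<close>, the double commutator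
      becomes \<open>comm r s\<close> itself, once starting from \<open>a\<close> and once from
      \<open>b\<close>.\<close>
    have "comm (comm a (inv r)) s = comm r s" "comm (comm b (inv r)) s = comm r s"
      using double_comm_eq[OF c(1) \<xi>(1) an inr] double_comm_eq[OF c(2) \<xi>(1) bn inr] that rs by auto
    then show "comm r s \<in> A" "comm r s \<in> B"
      using key[OF A(1) \<xi>(2) iq(1), of s] key[OF B(1) \<xi>(3) iq(2), of s] that rs by auto
  qed
  obtain r s t u where "r \<in> rst (cyl \<xi> n) \<inter> ?Q" "s \<in> rst (cyl \<xi> n) \<inter> ?Q" "t \<in> rst (cyl \<xi> n) \<inter> ?Q"
    "u \<in> rst (cyl \<xi> n) \<inter> ?Q" "comm r s \<otimes> comm t u \<noteq> comm t u \<otimes> comm r s"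
    using noncommuting_commutators[of ?Q \<xi> n] rst_cyl_normalizing[OF A(2) B(2)] \<xi>(1) by blast
  then show False using mem AB by blast
qed

end

section \<open>The homeomorphism induced by an automorphism\<close>

context boundary_action begin

definition nbh_open :: "(nat \<Rightarrow> 'v) set \<Rightarrow> bool" where
  "nbh_open U \<longleftrightarrow> U \<subseteq> X \<and> (\<forall>\<xi>\<in>U. \<exists>n. cyl \<xi> n \<subseteq> U)"

text \<open>The cylinder is shrunk once for each set: if it meets an open \<open>U\<close>, it
  contains a smaller cylinder inside \<open>U\<close>, and earlier decisions survive
  shrinking.\<close>

lemma decided_cyl:
  assumes "finite F" "\<And>U. U \<in> F \<Longrightarrow> nbh_open U"
  shows "\<exists>\<eta>\<in>X. \<exists>m. \<forall>U\<in>F. cyl \<eta> m \<subseteq> U \<or> cyl \<eta> m \<inter> U = {}"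
  using assms
proof (induction F)
  case empty
  then show ?case using X_ne by blast
next
  case (insert U F)
  then obtain \<eta> m where \<eta>: "\<eta> \<in> X" "\<forall>U\<in>F. cyl \<eta> m \<subseteq> U \<or> cyl \<eta> m \<inter> U = {}" by blast
  show ?case
  proof (cases "cyl \<eta> m \<inter> U = {}")
    case True
    then show ?thesis using \<eta> by blast
  next
    case False
    then obtain \<zeta> where \<zeta>: "\<zeta> \<in> cyl \<eta> m" "\<zeta> \<in> U" by blast
    then have z: "\<zeta> \<in> X" using cyl_sub by blast
    obtain k where k: "cyl \<zeta> k \<subseteq> U" using insert.prems[of U] \<zeta> by (auto simp: nbh_open_def)
    have "cyl \<zeta> (max k m) \<subseteq> cyl \<zeta> k" "cyl \<zeta> (max k m) \<subseteq> cyl \<eta> m"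
      using cyl_mono[OF z cyl_self[OF z]] cyl_mono[OF \<eta>(1) \<zeta>(1)] by auto
    then have "\<forall>V\<in>insert U F. cyl \<zeta> (max k m) \<subseteq> V \<or> cyl \<zeta> (max k m) \<inter> V = {}"
      using k \<eta>(2) by blast
    then show ?thesis using z by blast
  qed
qed

lemma image_mem_iff:
  "\<lbrakk>g \<in> carrier \<Gamma>; \<xi> \<in> X; U \<subseteq> X\<rbrakk> \<Longrightarrow> g \<cdot> \<xi> \<in> (\<cdot>) g ` U \<longleftrightarrow> \<xi> \<in> U"
  using act_inj by (auto simp: image_iff subset_iff)

lemma image_alt: "\<lbrakk>g \<in> carrier \<Gamma>; U \<subseteq> X\<rbrakk> \<Longrightarrow> (\<cdot>) g ` U = {\<xi> \<in> X. inv g \<cdot> \<xi> \<in> U}"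
  by (auto simp: image_iff subset_iff) (metis act_inv)

lemma image_cyl:
  assumes "g \<in> carrier \<Gamma>" "\<xi> \<in> X" shows "(\<cdot>) g ` cyl \<xi> n = cyl (g \<cdot> \<xi>) n"
proof -
  have "(inv g \<cdot> \<eta>) n = \<xi> n \<longleftrightarrow> \<eta> n = (g \<cdot> \<xi>) n" if "\<eta> \<in> X" for \<eta>
    using act_level_iff[of "inv g" \<eta> "g \<cdot> \<xi>" n] that assms by simp
  then show ?thesis using image_alt[OF assms(1) cyl_sub] assms by (auto simp: cyl_def)
qed

text \<open>A cylinder decided by all translates of \<open>U\<close> can be moved onto any other cylinder of its
  level.\<close>

lemma finite_orbit_clop:
  assumes "nbh_open U" "finite ((\<lambda>g. (\<cdot>) g ` U) ` carrier \<Gamma>)"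
  shows "clop U"
proof -
  have U: "U \<subseteq> X" using assms(1) by (simp add: nbh_open_def)
  have op: "nbh_open ((\<cdot>) g ` U)" if g: "g \<in> carrier \<Gamma>" for g
    unfolding nbh_open_def
  proof (intro conjI ballI)
    show "(\<cdot>) g ` U \<subseteq> X" using U g by auto
    fix \<xi> assume "\<xi> \<in> (\<cdot>) g ` U"
    then obtain \<eta> where \<eta>: "\<eta> \<in> U" "\<xi> = g \<cdot> \<eta>" by auto
    then obtain n where "cyl \<eta> n \<subseteq> U" using assms(1) by (auto simp: nbh_open_def)
    then have "cyl \<xi> n \<subseteq> (\<cdot>) g ` U" using image_cyl[OF g, of \<eta> n] \<eta> U by blast
    then show "\<exists>n. cyl \<xi> n \<subseteq> (\<cdot>) g ` U" ..
  qed
  obtain \<eta> m where \<eta>: "\<eta> \<in> X"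
    "\<forall>V\<in>(\<lambda>g. (\<cdot>) g ` U) ` carrier \<Gamma>. cyl \<eta> m \<subseteq> V \<or> cyl \<eta> m \<inter> V = {}"
  proof -
    have "\<exists>\<eta>\<in>X. \<exists>m. \<forall>V\<in>(\<lambda>g. (\<cdot>) g ` U) ` carrier \<Gamma>. cyl \<eta> m \<subseteq> V \<or> cyl \<eta> m \<inter> V = {}"
      using op by (intro decided_cyl[OF assms(2)]) blast
    then show ?thesis by (elim bexE exE) (rule that)
  qed
  have "\<xi> \<in> U \<longleftrightarrow> \<zeta> \<in> U" if x: "\<xi> \<in> X" "\<zeta> \<in> X" "\<xi> m = \<zeta> m" for \<xi> \<zeta>
  proof -
    obtain g where g: "g \<in> carrier \<Gamma>" "(g \<cdot> \<xi>) m = \<eta> m"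
      using act_trans[OF x(1) \<eta>(1)] by blast
    then have "(g \<cdot> \<zeta>) m = \<eta> m" using act_level_iff x by metis
    then have "g \<cdot> \<xi> \<in> cyl \<eta> m" "g \<cdot> \<zeta> \<in> cyl \<eta> m" using g x by (auto simp: cyl_def)
    then have "g \<cdot> \<xi> \<in> (\<cdot>) g ` U \<longleftrightarrow> g \<cdot> \<zeta> \<in> (\<cdot>) g ` U" using \<eta>(2) g(1) by blast
    then show ?thesis using image_mem_iff g x U by blast
  qed
  then show ?thesis using U unfolding clop_def by blast
qed

section \<open>Supports and clopen sets\<close>

lemma supp_sub: "supp A \<subseteq> X"
  by (auto simp: supp_def)

lemma supp_mono: "A \<subseteq> B \<Longrightarrow> supp A \<subseteq> supp B"
  by (auto simp: supp_def)

lemma supp_conjg: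
  assumes "g \<in> carrier \<Gamma>" "A \<subseteq> carrier \<Gamma>"
  shows "supp (conjg g A) = (\<cdot>) g ` supp A"
proof -
  have "(g \<otimes> a \<otimes> inv g) \<cdot> \<xi> = \<xi> \<longleftrightarrow> a \<cdot> inv g \<cdot> \<xi> = inv g \<cdot> \<xi>" if "a \<in> A" "\<xi> \<in> X" for a \<xi>
  proof -
    have a: "a \<in> carrier \<Gamma>" using that assms by auto
    have "(g \<otimes> a \<otimes> inv g) \<cdot> \<xi> = \<xi> \<longleftrightarrow> g \<cdot> a \<cdot> inv g \<cdot> \<xi> = g \<cdot> inv g \<cdot> \<xi>"
      using assms a that by (simp add: act_mult)
    also have "\<dots> \<longleftrightarrow> a \<cdot> inv g \<cdot> \<xi> = inv g \<cdot> \<xi>" using assms a that by (subst act_inj) auto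
    finally show ?thesis .
  qed
  then show ?thesis unfolding image_alt[OF assms(1) supp_sub] using assms(1)
    by (auto simp: supp_def conjg_def)
qed

text \<open>Translates of the support are supports of conjugates, so there are finitely many of them
  and \<open>finite_orbit_clop\<close> applies.\<close>

lemma supp_clop:
  assumes "fin_conj A" shows "clop (supp A)"
proof (rule finite_orbit_clop)
  have A: "A \<subseteq> carrier \<Gamma>" using assms by (simp add: fin_conj_def)
  have "(\<lambda>g. (\<cdot>) g ` supp A) ` carrier \<Gamma> = supp ` (\<lambda>g. conjg g A) ` carrier \<Gamma>"
    using supp_conjg[OF _ A] by (simp add: image_image cong: image_cong)
  then show "finite ((\<lambda>g. (\<cdot>) g ` supp A) ` carrier \<Gamma>)" using assms by (simp add: fin_conj_def)
  show "nbh_open (supp A)" unfolding nbh_open_def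
  proof (intro conjI ballI)
    fix \<xi> assume "\<xi> \<in> supp A"
    then obtain a where a: "\<xi> \<in> X" "a \<in> A" "a \<cdot> \<xi> \<noteq> \<xi>" by (auto simp: supp_def)
    then obtain n where n: "(a \<cdot> \<xi>) n \<noteq> \<xi> n" by (auto simp: fun_eq_iff)
    have "cyl \<xi> n \<subseteq> supp A"
    proof
      fix \<zeta> assume z: "\<zeta> \<in> cyl \<xi> n"
      then have "a \<cdot> \<zeta> \<notin> cyl \<xi> n" using moved_disjoint[OF _ _ n] a A by blast
      then show "\<zeta> \<in> supp A" using z a cyl_sub by (auto simp: supp_def)
    qed
    then show "\<exists>n. cyl \<xi> n \<subseteq> supp A" ..
  qed (rule supp_sub)
qed

lemma rst_image:
  assumes g: "g \<in> carrier \<Gamma>" and U: "U \<subseteq> X"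
  shows "conjg g (rst U) = rst ((\<cdot>) g ` U)"
proof -
  have sub: "conjg g (rst U) \<subseteq> rst ((\<cdot>) g ` U)" if "g \<in> carrier \<Gamma>" "U \<subseteq> X" for g U
  proof
    fix x assume "x \<in> conjg g (rst U)"
    then obtain a where a: "a \<in> rst U" "x = g \<otimes> a \<otimes> inv g" by (auto simp: conjg_def)
    have ac: "a \<in> carrier \<Gamma>" using a rst_closed by blast
    have "x \<cdot> \<eta> = \<eta>" if \<eta>: "\<eta> \<in> X" "\<eta> \<notin> (\<cdot>) g ` U" for \<eta>
    proof -
      have "inv g \<cdot> \<eta> \<notin> U" using \<eta> image_alt \<open>g \<in> carrier \<Gamma>\<close> \<open>U \<subseteq> X\<close> by blast
      then have "a \<cdot> inv g \<cdot> \<eta> = inv g \<cdot> \<eta>" using rst_fix a \<eta> \<open>g \<in> carrier \<Gamma>\<close> by simp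
      then show ?thesis using \<open>g \<in> carrier \<Gamma>\<close> ac \<eta> a by (simp add: act_mult)
    qed
    then show "x \<in> rst ((\<cdot>) g ` U)" using a ac that by (auto simp: rst_def)
  qed
  have gU: "(\<cdot>) g ` U \<subseteq> X" using g U by auto
  \<comment> \<open>The reverse inclusion comes from \<open>sub\<close> for \<open>inv g\<close>,
    conjugated back by \<open>g\<close>.\<close>
  have "(\<cdot>) (inv g) ` (\<cdot>) g ` U = U" using U g by (auto simp: image_image subset_iff image_iff)
  then have "conjg (inv g) (rst ((\<cdot>) g ` U)) \<subseteq> rst U" using sub[of "inv g", OF _ gU] g by simp
  then have "conjg g (conjg (inv g) (rst ((\<cdot>) g ` U))) \<subseteq> conjg g (rst U)"
    by (auto simp: conjg_def)
  moreover have "conjg g (conjg (inv g) (rst ((\<cdot>) g ` U))) = rst ((\<cdot>) g ` U)"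
    using conjg_mult[of g "inv g" "rst ((\<cdot>) g ` U)"] g rst_closed conjg_one
    by (metis inv_closed r_inv subsetI)
  ultimately show ?thesis using sub[OF assms] by blast
qed

text \<open>If membership in \<open>U\<close> is decided at level n, so is membership in every
  translate, and a finite level has finitely many subsets.\<close>

lemma fin_conj_rst:
  assumes "clop U" shows "fin_conj (rst U)"
proof -
  obtain n where U: "U \<subseteq> X" "\<forall>\<xi>\<in>X. \<forall>\<eta>\<in>X. \<xi> n = \<eta> n \<longrightarrow> (\<xi> \<in> U \<longleftrightarrow> \<eta> \<in> U)"
    using assms by (auto simp: clop_def)
  let ?F = "\<lambda>S. {\<xi> \<in> X. \<xi> n \<in> S}"
  have "(\<cdot>) g ` U \<in> ?F ` Pow ((\<lambda>\<xi>. \<xi> n) ` X)" if g: "g \<in> carrier \<Gamma>" for g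
  proof
    let ?S = "(\<lambda>\<xi>. \<xi> n) ` (\<cdot>) g ` U"
    have "\<xi> \<in> (\<cdot>) g ` U" if "\<xi> \<in> X" "\<eta> \<in> U" "\<xi> n = (g \<cdot> \<eta>) n" for \<xi> \<eta>
    proof -
      have "(inv g \<cdot> \<xi>) n = \<eta> n" using act_level[of "inv g" \<xi> "g \<cdot> \<eta>" n] that g U(1) by auto
      then have "inv g \<cdot> \<xi> \<in> U" using U that g by (metis act_closed inv_closed subsetD)
      then show ?thesis using image_alt[OF g U(1)] that by simp
    qed
    then show "(\<cdot>) g ` U = ?F ?S" using U(1) g by auto
    show "?S \<in> Pow ((\<lambda>\<xi>. \<xi> n) ` X)" using U(1) g by auto
  qed
  then have "(\<lambda>g. (\<cdot>) g ` U) ` carrier \<Gamma> \<subseteq> ?F ` Pow ((\<lambda>\<xi>. \<xi> n) ` X)" by blast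
  then have "finite ((\<lambda>g. (\<cdot>) g ` U) ` carrier \<Gamma>)"
    using fin_level finite_subset by (metis (no_types, lifting) finite_Pow_iff finite_imageI)
  moreover have "(\<lambda>g. conjg g (rst U)) ` carrier \<Gamma> = rst ` (\<lambda>g. (\<cdot>) g ` U) ` carrier \<Gamma>"
    using rst_image U(1) by (simp add: image_image cong: image_cong)
  ultimately show ?thesis using rst_closed by (auto simp: fin_conj_def)
qed

lemma clop_cyl: "\<xi> \<in> X \<Longrightarrow> clop (cyl \<xi> n)"
  unfolding clop_def cyl_def by (auto intro!: exI[of _ n])

lemma clop_local:
  assumes "clop U" "\<xi> \<in> U" shows "\<exists>n. \<forall>m\<ge>n. cyl \<xi> m \<subseteq> U"
proof -
  obtain n where U: "U \<subseteq> X" "\<forall>\<xi>\<in>X. \<forall>\<eta>\<in>X. \<xi> n = \<eta> n \<longrightarrow> (\<xi> \<in> U \<longleftrightarrow> \<eta> \<in> U)"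
    using assms by (auto simp: clop_def)
  have "cyl \<xi> n \<subseteq> U" using U assms(2) by (auto simp: cyl_def)
  then show ?thesis using cyl_mono[OF _ cyl_self] assms(2) U(1) by (meson subset_iff)
qed

lemma clop_compl: "clop U \<Longrightarrow> clop (X - U)"
  by (auto simp: clop_def)

lemma clop_Un:
  assumes "clop U" "clop V" shows "clop (U \<union> V)"
proof -
  obtain n where U: "U \<subseteq> X" "\<forall>\<xi>\<in>X. \<forall>\<eta>\<in>X. \<xi> n = \<eta> n \<longrightarrow> (\<xi> \<in> U \<longleftrightarrow> \<eta> \<in> U)"
    using assms by (auto simp: clop_def)
  obtain m where V: "V \<subseteq> X" "\<forall>\<xi>\<in>X. \<forall>\<eta>\<in>X. \<xi> m = \<eta> m \<longrightarrow> (\<xi> \<in> V \<longleftrightarrow> \<eta> \<in> V)"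
    using assms by (auto simp: clop_def)
  have "\<xi> \<in> U \<union> V \<longleftrightarrow> \<eta> \<in> U \<union> V" if "\<xi> \<in> X" "\<eta> \<in> X" "\<xi> (max n m) = \<eta> (max n m)" for \<xi> \<eta>
    using U(2)[rule_format, OF that(1,2) prefix[OF that max.cobounded1]]
      V(2)[rule_format, OF that(1,2) prefix[OF that max.cobounded2]] by blast
  then show ?thesis using U(1) V(1) unfolding clop_def by blast
qed

lemma clop_Union: "finite F \<Longrightarrow> (\<And>U. U \<in> F \<Longrightarrow> clop U) \<Longrightarrow> clop (\<Union>F)"
proof (induction F rule: finite_induct)
  case empty
  then show ?case by (simp add: clop_def)
qed (auto intro: clop_Un)

text \<open>The support is clopen, by \<open>fin_conj_rst\<close> and \<open>supp_clop\<close>. If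
  it missed a point of \<open>U\<close>, it would miss a whole cylinder inside \<open>U\<close>; but
  the rigid stabiliser of that cylinder is nontrivial and contained in \<open>rst U\<close>.\<close>

lemma supp_rst:
  assumes "clop U" shows "supp (rst U) = U"
proof
  show "supp (rst U) \<subseteq> U" by (auto simp: supp_def rst_def)
  show "U \<subseteq> supp (rst U)"
  proof (rule ccontr)
    assume "\<not> U \<subseteq> supp (rst U)"
    then obtain \<xi> where \<xi>: "\<xi> \<in> U" "\<xi> \<notin> supp (rst U)" by blast
    have x: "\<xi> \<in> X" using \<xi> assms by (auto simp: clop_def)
    have "\<xi> \<in> X - supp (rst U)" using x \<xi> by blast
    then obtain k l where k: "\<forall>m\<ge>k. cyl \<xi> m \<subseteq> U" "\<forall>m\<ge>l. cyl \<xi> m \<subseteq> X - supp (rst U)"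
      using clop_local \<xi>(1) assms clop_compl supp_clop fin_conj_rst by metis
    obtain g where g: "g \<in> rst (cyl \<xi> (max k l))" "g \<noteq> \<one>" using rst_cyl_nontrivial[OF x] by blast
    obtain \<eta> where \<eta>: "\<eta> \<in> cyl \<xi> (max k l)" "\<eta> \<in> X" "g \<cdot> \<eta> \<noteq> \<eta>" using moved_point[OF g] by blast
    have "g \<in> rst U" using g(1) k(1) rst_mono by (meson max.cobounded1 subsetD)
    then have "\<eta> \<in> supp (rst U)" using \<eta> by (auto simp: supp_def)
    then show False using k(2) \<eta> by (meson DiffD2 max.cobounded2 subsetD)
  qed
qed

lemma commute_if_disjoint:
  assumes "a \<in> carrier \<Gamma>" "b \<in> carrier \<Gamma>" "\<And>\<xi>. \<xi> \<in> X \<Longrightarrow> a \<cdot> \<xi> = \<xi> \<or> b \<cdot> \<xi> = \<xi>"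
  shows "a \<otimes> b = b \<otimes> a"
proof (rule act_eqI)
  fix \<xi> assume \<xi>: "\<xi> \<in> X"
  have "a \<cdot> b \<cdot> \<xi> = b \<cdot> a \<cdot> \<xi>"
    using assms(3)[OF \<xi>] assms(3)[of "a \<cdot> \<xi>"] assms(3)[of "b \<cdot> \<xi>"] assms(1,2) \<xi>
    by (metis act_closed act_inj)
  then show "(a \<otimes> b) \<cdot> \<xi> = (b \<otimes> a) \<cdot> \<xi>" using assms(1,2) \<xi> by (simp add: act_mult)
qed (use assms in auto)

section \<open>The action of automorphisms on clopen sets\<close>

lemma auto_closed [simp]: "\<lbrakk>\<alpha> \<in> auto \<Gamma>; g \<in> carrier \<Gamma>\<rbrakk> \<Longrightarrow> \<alpha> g \<in> carrier \<Gamma>"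
  by (auto simp: auto_def hom_def)

lemma auto_mult: "\<lbrakk>\<alpha> \<in> auto \<Gamma>; g \<in> carrier \<Gamma>; h \<in> carrier \<Gamma>\<rbrakk> \<Longrightarrow> \<alpha> (g \<otimes> h) = \<alpha> g \<otimes> \<alpha> h"
  unfolding auto_def hom_def by blast

lemma auto_group_hom: "\<alpha> \<in> auto \<Gamma> \<Longrightarrow> group_hom \<Gamma> \<Gamma> \<alpha>"
  by (simp add: auto_def group_hom_axioms_def group_hom_def)

lemma auto_inv: "\<lbrakk>\<alpha> \<in> auto \<Gamma>; g \<in> carrier \<Gamma>\<rbrakk> \<Longrightarrow> \<alpha> (inv g) = inv (\<alpha> g)"
  using group_hom.hom_inv[OF auto_group_hom] by simp

lemma auto_one: "\<alpha> \<in> auto \<Gamma> \<Longrightarrow> \<alpha> \<one> = \<one>"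
  using group_hom.hom_one[OF auto_group_hom] by simp

lemma auto_inverse:
  assumes "\<alpha> \<in> auto \<Gamma>"
  obtains \<beta> where "\<beta> \<in> auto \<Gamma>" "\<And>g. g \<in> carrier \<Gamma> \<Longrightarrow> \<beta> (\<alpha> g) = g"
    "\<And>g. g \<in> carrier \<Gamma> \<Longrightarrow> \<alpha> (\<beta> g) = g"
proof
  let ?\<beta> = "restrict (inv_into (carrier \<Gamma>) \<alpha>) (carrier \<Gamma>)"
  have \<alpha>: "\<alpha> \<in> hom \<Gamma> \<Gamma>" "\<alpha> \<in> Bij (carrier \<Gamma>)" "bij_betw \<alpha> (carrier \<Gamma>) (carrier \<Gamma>)"
    using assms by (auto simp: auto_def Bij_def)
  show "?\<beta> \<in> auto \<Gamma>" using restrict_inv_into_hom[OF \<alpha>(1,2)] restrict_inv_into_Bij[OF \<alpha>(2)]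
    by (simp add: auto_def)
  show "?\<beta> (\<alpha> g) = g" "\<alpha> (?\<beta> g) = g" if "g \<in> carrier \<Gamma>" for g
    using that \<alpha>(3) assms by (auto simp: bij_betw_def f_inv_into_f)
qed

lemma conjg_auto_image:
  assumes "\<alpha> \<in> auto \<Gamma>" "g \<in> carrier \<Gamma>" "A \<subseteq> carrier \<Gamma>"
  shows "\<alpha> ` conjg g A = conjg (\<alpha> g) (\<alpha> ` A)"
proof -
  have "\<alpha> (g \<otimes> a \<otimes> inv g) = \<alpha> g \<otimes> \<alpha> a \<otimes> inv (\<alpha> g)" if "a \<in> A" for a
    using that assms by (auto simp: auto_mult auto_inv subset_iff)
  then show ?thesis by (simp add: conjg_def image_image)
qed

lemma fin_conj_auto:
  assumes "\<alpha> \<in> auto \<Gamma>" "fin_conj A" shows "fin_conj (\<alpha> ` A)"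
proof -
  have A: "A \<subseteq> carrier \<Gamma>" using assms(2) by (simp add: fin_conj_def)
  have "\<alpha> ` carrier \<Gamma> = carrier \<Gamma>" using assms(1) by (auto simp: auto_def Bij_def bij_betw_def)
  then have "(\<lambda>g. conjg g (\<alpha> ` A)) ` carrier \<Gamma> = (\<lambda>g. conjg g (\<alpha> ` A)) ` \<alpha> ` carrier \<Gamma>" by simp
  also have "\<dots> = (`) \<alpha> ` (\<lambda>g. conjg g A) ` carrier \<Gamma>"
    using conjg_auto_image[OF assms(1) _ A] by (simp add: image_image cong: image_cong)
  finally show ?thesis using assms A by (auto simp: fin_conj_def)
qed

lemma subgroup_auto_image: "\<lbrakk>\<alpha> \<in> auto \<Gamma>; subgroup A \<Gamma>\<rbrakk> \<Longrightarrow> subgroup (\<alpha> ` A) \<Gamma>"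
  using group_hom.subgroup_img_is_subgroup[OF auto_group_hom] by blast

text \<open>If a homeomorphism \<open>h\<close> intertwines with \<open>\<alpha>\<close>, then
  \<open>\<alpha>\<close> maps the rigid stabiliser of \<open>U\<close> onto that of the image of
  \<open>U\<close> under \<open>h\<close>, and for clopen \<open>U\<close> the support is this
  image. So \<open>\<sigma> \<alpha>\<close> is the effect on clopen sets of a homeomorphism still
  to be found.\<close>

definition \<sigma> :: "('g \<Rightarrow> 'g) \<Rightarrow> (nat \<Rightarrow> 'v) set \<Rightarrow> (nat \<Rightarrow> 'v) set" where
  "\<sigma> \<alpha> U = supp (\<alpha> ` rst U)"

lemma \<sigma>_clop: "\<lbrakk>\<alpha> \<in> auto \<Gamma>; clop U\<rbrakk> \<Longrightarrow> clop (\<sigma> \<alpha> U)"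
  by (simp add: \<sigma>_def supp_clop fin_conj_auto fin_conj_rst)

lemma \<sigma>_mono: "U \<subseteq> V \<Longrightarrow> \<sigma> \<alpha> U \<subseteq> \<sigma> \<alpha> V"
  unfolding \<sigma>_def by (intro supp_mono image_mono rst_mono)

lemma \<sigma>_sub: "\<sigma> \<alpha> U \<subseteq> X"
  by (simp add: \<sigma>_def supp_sub)

text \<open>Disjointness: rigid stabilisers of disjoint sets commute, and so do their images.
  Covering: if a clopen set \<open>Z\<close> were left over, \<open>rst Z\<close> would commute with
  both images; pulled back by the inverse \<open>\<beta>\<close>, its elements would have support
  disjoint from \<open>U\<close> and from the complement of \<open>U\<close>, hence be
  trivial.\<close>

lemma \<sigma>_compl:
  assumes \<alpha>: "\<alpha> \<in> auto \<Gamma>" and U: "clop U" shows "\<sigma> \<alpha> (X - U) = X - \<sigma> \<alpha> U"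
proof -
  have com: "a \<otimes> b = b \<otimes> a" if "a \<in> rst U" "b \<in> rst (X - U)" for a b U
    using that by (intro commute_if_disjoint) (auto simp: rst_def)
  have "\<sigma> \<alpha> U \<inter> \<sigma> \<alpha> (X - U) = {}" unfolding \<sigma>_def
  proof (rule commuting_disjoint_supp)
    show "a \<otimes> b = b \<otimes> a" if ab: "a \<in> \<alpha> ` rst U" "b \<in> \<alpha> ` rst (X - U)" for a b
    proof -
      obtain a' b' where "a' \<in> rst U" "b' \<in> rst (X - U)" "a = \<alpha> a'" "b = \<alpha> b'" using ab by blast
      then show ?thesis using com rst_closed auto_mult[OF \<alpha>] by metis
    qed
  qed (use \<alpha> U in \<open>auto intro!: subgroup_auto_image rst_subgroup fin_conj_auto fin_conj_rst clop_compl\<close>)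
  moreover have "X \<subseteq> \<sigma> \<alpha> U \<union> \<sigma> \<alpha> (X - U)"
  proof (rule ccontr)
    let ?S = "\<sigma> \<alpha> U \<union> \<sigma> \<alpha> (X - U)"
    define Z where "Z = X - ?S"
    assume "\<not> X \<subseteq> ?S"
    then obtain \<xi> where \<xi>: "\<xi> \<in> X" "\<xi> \<in> Z" unfolding Z_def by blast
    have cZ: "clop Z" unfolding Z_def using \<alpha> U by (simp add: clop_compl clop_Un \<sigma>_clop)
    then obtain n where "cyl \<xi> n \<subseteq> Z" using clop_local \<xi> by blast
    then obtain g where g: "g \<in> rst Z" "g \<noteq> \<one>" using rst_cyl_nontrivial[OF \<xi>(1)] rst_mono by blast
    obtain \<beta> where \<beta>: "\<beta> \<in> auto \<Gamma>" "\<And>g. g \<in> carrier \<Gamma> \<Longrightarrow> \<beta> (\<alpha> g) = g"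
      "\<And>g. g \<in> carrier \<Gamma> \<Longrightarrow> \<alpha> (\<beta> g) = g" using auto_inverse[OF \<alpha>] by blast
    have dis: "supp (\<beta> ` rst Z) \<inter> V = {}" if V: "V = U \<or> V = X - U" for V
    proof -
      have cV: "clop V" using V U clop_compl by blast
      have VS: "\<sigma> \<alpha> V \<subseteq> ?S" using V by blast
      have "supp (\<beta> ` rst Z) \<inter> supp (rst V) = {}"
      proof (rule commuting_disjoint_supp)
        fix a b assume "a \<in> \<beta> ` rst Z" and b: "b \<in> rst V"
        then obtain z where z: "z \<in> rst Z" "a = \<beta> z" by blast
        have "z \<cdot> \<xi> = \<xi> \<or> \<alpha> b \<cdot> \<xi> = \<xi>" if x: "\<xi> \<in> X" for \<xi>
        proof (cases "\<xi> \<in> Z")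
          case True
          then have "\<xi> \<notin> \<sigma> \<alpha> V" using VS unfolding Z_def by blast
          then show ?thesis using x b unfolding \<sigma>_def supp_def by blast
        qed (use z x rst_fix in blast)
        then have "z \<otimes> \<alpha> b = \<alpha> b \<otimes> z"
          using z b \<alpha> rst_closed by (intro commute_if_disjoint) auto
        then have "\<beta> (z \<otimes> \<alpha> b) = \<beta> (\<alpha> b \<otimes> z)" by simp
        then show "a \<otimes> b = b \<otimes> a"
          using z b \<alpha> \<beta> rst_closed[OF z(1)] rst_closed[OF b] by (simp add: auto_mult)
      qed (use \<beta>(1) cZ cV in \<open>auto intro!: subgroup_auto_image rst_subgroup fin_conj_auto fin_conj_rst\<close>)
      then show ?thesis by (simp add: supp_rst[OF cV])
    qed
    have "supp (\<beta> ` rst Z) = {}" using dis[of U] dis[of "X - U"] supp_sub[of "\<beta> ` rst Z"] by blast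
    then have fix\<beta>: "\<beta> g \<cdot> \<eta> = \<eta>" if "\<eta> \<in> X" for \<eta> using that g unfolding supp_def by blast
    have gc: "g \<in> carrier \<Gamma>" using g rst_closed by blast
    have "\<beta> g = \<one>" using fix\<beta> gc \<beta>(1) by (intro act_eqI) auto
    then have "\<alpha> (\<beta> g) = \<one>" using auto_one[OF \<alpha>] by simp
    then show False using \<beta>(3)[OF gc] g by simp
  qed
  ultimately show ?thesis using \<sigma>_sub by blast
qed

text \<open>One inclusion is direct, since \<open>\<alpha>\<close> sends \<open>rst V\<close> into
  \<open>rst (\<sigma> \<alpha> V)\<close>. Applied to the complement of \<open>U\<close>, it yields
  the other through \<open>\<sigma>_compl\<close>.\<close>

lemma \<sigma>_inverse:
  assumes \<alpha>: "\<alpha> \<in> auto \<Gamma>" and \<beta>: "\<beta> \<in> auto \<Gamma>" and inv: "\<And>g. g \<in> carrier \<Gamma> \<Longrightarrow> \<beta> (\<alpha> g) = g"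
    and U: "clop U"
  shows "\<sigma> \<beta> (\<sigma> \<alpha> U) = U"
proof -
  have sub: "V \<subseteq> \<sigma> \<beta> (\<sigma> \<alpha> V)" if "clop V" for V
  proof -
    have "\<alpha> ` rst V \<subseteq> rst (\<sigma> \<alpha> V)"
    proof
      fix x assume x: "x \<in> \<alpha> ` rst V"
      then have "x \<in> carrier \<Gamma>" using \<alpha> rst_closed by auto
      moreover have "x \<cdot> \<eta> = \<eta>" if "\<eta> \<in> X" "\<eta> \<notin> \<sigma> \<alpha> V" for \<eta>
        using that x unfolding \<sigma>_def supp_def by blast
      ultimately show "x \<in> rst (\<sigma> \<alpha> V)" by (simp add: rst_def)
    qed
    then have "\<beta> ` \<alpha> ` rst V \<subseteq> \<beta> ` rst (\<sigma> \<alpha> V)" by blast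
    moreover have "\<beta> ` \<alpha> ` rst V = rst V" using inv rst_closed by (auto simp: image_image image_iff)
    ultimately have "supp (rst V) \<subseteq> \<sigma> \<beta> (\<sigma> \<alpha> V)" unfolding \<sigma>_def[of \<beta>] using supp_mono by metis
    then show ?thesis by (simp add: supp_rst that)
  qed
  have "\<sigma> \<beta> (\<sigma> \<alpha> (X - U)) = X - \<sigma> \<beta> (\<sigma> \<alpha> U)" using \<alpha> \<beta> U by (simp add: \<sigma>_compl \<sigma>_clop)
  moreover have "U \<subseteq> X" using U by (simp add: clop_def)
  ultimately show ?thesis using sub[OF U] sub[OF clop_compl[OF U]] \<sigma>_sub[of \<beta> "\<sigma> \<alpha> U"] by blast
qed

lemma \<sigma>_equivariant:
  assumes \<alpha>: "\<alpha> \<in> auto \<Gamma>" and g: "g \<in> carrier \<Gamma>" and U: "U \<subseteq> X"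
  shows "\<sigma> \<alpha> ((\<cdot>) g ` U) = (\<cdot>) (\<alpha> g) ` \<sigma> \<alpha> U"
proof -
  have R: "rst U \<subseteq> carrier \<Gamma>" using rst_closed by blast
  have "\<sigma> \<alpha> ((\<cdot>) g ` U) = supp (conjg (\<alpha> g) (\<alpha> ` rst U))"
    unfolding \<sigma>_def rst_image[OF g U, symmetric] conjg_auto_image[OF \<alpha> g R] ..
  also have "\<dots> = (\<cdot>) (\<alpha> g) ` \<sigma> \<alpha> U"
    unfolding \<sigma>_def using \<alpha> g R by (intro supp_conjg) auto
  finally show ?thesis .
qed

section \<open>From clopen sets to points\<close>

definition cts :: "((nat \<Rightarrow> 'v) \<Rightarrow> nat \<Rightarrow> 'v) \<Rightarrow> bool" where
  "cts h \<longleftrightarrow> (\<forall>\<xi>\<in>X. \<forall>n. \<exists>m. \<forall>\<eta>\<in>X. \<eta> m = \<xi> m \<longrightarrow> h \<eta> n = h \<xi> n)"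

definition homeo :: "((nat \<Rightarrow> 'v) \<Rightarrow> nat \<Rightarrow> 'v) \<Rightarrow> bool" where
  "homeo h \<longleftrightarrow> h \<in> extensional X \<and> bij_betw h X X \<and> cts h \<and> cts (inv_into X h)"

definition intertwines :: "('g \<Rightarrow> 'g) \<Rightarrow> ((nat \<Rightarrow> 'v) \<Rightarrow> nat \<Rightarrow> 'v) \<Rightarrow> bool" where
  "intertwines \<alpha> h \<longleftrightarrow> (\<forall>g\<in>carrier \<Gamma>. \<forall>\<xi>\<in>X. h (g \<cdot> \<xi>) = \<alpha> g \<cdot> h \<xi>)"

lemma \<sigma>_disjoint:
  assumes "\<beta> \<in> auto \<Gamma>" "\<xi> \<in> X" "\<eta> \<in> X" "\<xi> n \<noteq> \<eta> n"
  shows "\<sigma> \<beta> (cyl \<xi> n) \<inter> \<sigma> \<beta> (cyl \<eta> n) = {}"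
proof -
  have "cyl \<eta> n \<subseteq> X - cyl \<xi> n" using assms by (auto simp: cyl_def)
  then have "\<sigma> \<beta> (cyl \<eta> n) \<subseteq> X - \<sigma> \<beta> (cyl \<xi> n)"
    using \<sigma>_mono[of "cyl \<eta> n" "X - cyl \<xi> n" \<beta>] \<sigma>_compl[OF assms(1) clop_cyl[OF assms(2)], of n] by simp
  then show ?thesis by blast
qed

text \<open>The uncovered part \<open>W\<close> is clopen, and \<open>\<sigma> \<alpha> W\<close>
  avoids every cylinder of level m, so it is empty; applying \<open>\<sigma> \<beta>\<close> shows
  that \<open>W\<close> is empty.\<close>

lemma \<sigma>_cover:
  assumes \<alpha>: "\<alpha> \<in> auto \<Gamma>" and \<beta>: "\<beta> \<in> auto \<Gamma>"
    and inv: "\<And>g. g \<in> carrier \<Gamma> \<Longrightarrow> \<beta> (\<alpha> g) = g" "\<And>g. g \<in> carrier \<Gamma> \<Longrightarrow> \<alpha> (\<beta> g) = g"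
    and \<xi>: "\<xi> \<in> X"
  shows "\<exists>\<eta>\<in>X. \<xi> \<in> \<sigma> \<beta> (cyl \<eta> m)"
proof (rule ccontr)
  define F where "F = (\<lambda>\<eta>. \<sigma> \<beta> (cyl \<eta> m)) ` X"
  define W where "W = X - \<Union>F"
  assume "\<not> ?thesis"
  then have "\<xi> \<in> W" using \<xi> by (auto simp: W_def F_def)
  have "F \<subseteq> (\<lambda>v. \<sigma> \<beta> {\<eta> \<in> X. \<eta> m = v}) ` (\<lambda>\<xi>. \<xi> m) ` X" by (auto simp: F_def cyl_def)
  then have "finite F" using fin_level finite_subset by blast
  then have cW: "clop W" unfolding W_def
    using \<beta> by (intro clop_compl clop_Union) (auto simp: F_def \<sigma>_clop clop_cyl)
  have "\<sigma> \<alpha> W \<inter> cyl \<eta> m = {}" if \<eta>: "\<eta> \<in> X" for \<eta>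
  proof -
    have "W \<subseteq> X - \<sigma> \<beta> (cyl \<eta> m)" using \<eta> by (auto simp: W_def F_def)
    then have "\<sigma> \<alpha> W \<subseteq> \<sigma> \<alpha> (X - \<sigma> \<beta> (cyl \<eta> m))" by (rule \<sigma>_mono)
    also have "\<dots> = X - cyl \<eta> m"
      using \<alpha> \<beta> \<eta> inv by (simp add: \<sigma>_compl \<sigma>_clop clop_cyl \<sigma>_inverse)
    finally show ?thesis by blast
  qed
  then have "\<sigma> \<alpha> W = {}" using \<sigma>_sub[of \<alpha> W] cyl_self by blast
  then have "W = \<sigma> \<beta> {}" using \<sigma>_inverse[OF \<alpha> \<beta> inv(1) cW] by simp
  also have "rst {} = {\<one>}"
    using subgroup.one_closed[OF rst_subgroup] act_eqI[of _ \<one>] by (auto simp: rst_def)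
  then have "\<sigma> \<beta> {} = {}" using auto_one[OF \<beta>] by (auto simp: \<sigma>_def supp_def)
  finally show False using \<open>\<xi> \<in> W\<close> by simp
qed

text \<open>Stone duality by hand: at each level one cylinder has \<open>\<xi>\<close> in its image
  under \<open>\<sigma> \<beta>\<close>. Disjointness makes the choices at different levels
  compatible, and \<open>X_closed\<close> turns them into a point.\<close>

lemma intertwiner_aux:
  assumes \<alpha>: "\<alpha> \<in> auto \<Gamma>" and \<beta>: "\<beta> \<in> auto \<Gamma>"
    and inv: "\<And>g. g \<in> carrier \<Gamma> \<Longrightarrow> \<beta> (\<alpha> g) = g" "\<And>g. g \<in> carrier \<Gamma> \<Longrightarrow> \<alpha> (\<beta> g) = g"
    and \<xi>: "\<xi> \<in> X"
  shows "\<exists>!\<eta>. \<eta> \<in> X \<and> (\<forall>m. \<xi> \<in> \<sigma> \<beta> (cyl \<eta> m))"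
proof -
  obtain e where e: "\<And>m. e m \<in> X \<and> \<xi> \<in> \<sigma> \<beta> (cyl (e m) m)" using \<sigma>_cover[OF assms] by metis
  define f where "f m = e m m" for m
  have coh: "f i = e m i" if "i \<le> m" for i m
  proof (rule ccontr)
    assume ne: "f i \<noteq> e m i"
    have "cyl (e m) m \<subseteq> cyl (e m) i" using cyl_mono[of "e m"] e that by auto
    then have "\<xi> \<in> \<sigma> \<beta> (cyl (e m) i)" using e \<sigma>_mono by blast
    then show False using \<sigma>_disjoint[OF \<beta>, of "e i" "e m" i] e[of i] e[of m] ne by (auto simp: f_def)
  qed
  have fX: "f \<in> X" using e coh by (intro X_closed) metis
  have "cyl f m = cyl (e m) m" for m by (simp add: cyl_def f_def)
  then have "\<forall>m. \<xi> \<in> \<sigma> \<beta> (cyl f m)" using e by simp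
  moreover have "\<eta> = f" if "\<eta> \<in> X" "\<forall>m. \<xi> \<in> \<sigma> \<beta> (cyl \<eta> m)" for \<eta>
    using \<sigma>_disjoint[OF \<beta> that(1) fX] that(2) calculation by (auto simp: fun_eq_iff)
  ultimately show ?thesis using fX by blast
qed

text \<open>The hypothesis says that the map to be constructed takes \<open>\<xi>\<close> to
  \<open>\<eta>\<close>, seen from its inverse; the conclusion is the same incidence seen from
  \<open>\<alpha>\<close>. If it failed, some cylinder of \<open>\<eta>\<close> would lie in
  \<open>\<sigma> \<alpha> (X - cyl \<xi> n)\<close>, and applying \<open>\<sigma> \<beta>\<close>
  would put \<open>\<xi>\<close> outside \<open>cyl \<xi> n\<close>.\<close>

lemma \<sigma>_swap:
  assumes \<alpha>: "\<alpha> \<in> auto \<Gamma>" and \<beta>: "\<beta> \<in> auto \<Gamma>"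
    and inv: "\<And>g. g \<in> carrier \<Gamma> \<Longrightarrow> \<beta> (\<alpha> g) = g"
    and "\<xi> \<in> X" "\<eta> \<in> X" "\<forall>m. \<xi> \<in> \<sigma> \<beta> (cyl \<eta> m)"
  shows "\<eta> \<in> \<sigma> \<alpha> (cyl \<xi> n)"
proof (rule ccontr)
  assume "\<eta> \<notin> \<sigma> \<alpha> (cyl \<xi> n)"
  then have "\<eta> \<in> \<sigma> \<alpha> (X - cyl \<xi> n)" using assms by (simp add: \<sigma>_compl clop_cyl)
  then obtain m where "cyl \<eta> m \<subseteq> \<sigma> \<alpha> (X - cyl \<xi> n)"
    using clop_local \<sigma>_clop[OF \<alpha> clop_compl[OF clop_cyl[OF assms(4)]]] by blast
  then have "\<sigma> \<beta> (cyl \<eta> m) \<subseteq> \<sigma> \<beta> (\<sigma> \<alpha> (X - cyl \<xi> n))" by (rule \<sigma>_mono)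
  also have "\<dots> = X - cyl \<xi> n" using assms by (intro \<sigma>_inverse clop_compl clop_cyl) auto
  finally show False using assms by auto
qed

theorem intertwiner_exists:
  assumes \<alpha>: "\<alpha> \<in> auto \<Gamma>" shows "\<exists>h. homeo h \<and> intertwines \<alpha> h"
proof -
  obtain \<beta> where \<beta>: "\<beta> \<in> auto \<Gamma>" "\<And>g. g \<in> carrier \<Gamma> \<Longrightarrow> \<beta> (\<alpha> g) = g"
      "\<And>g. g \<in> carrier \<Gamma> \<Longrightarrow> \<alpha> (\<beta> g) = g" using auto_inverse[OF \<alpha>] by blast
  \<comment> \<open>The map for \<open>\<alpha>\<close> is \<open>H \<beta>\<close>, because its
    preimages of cylinders are their images under the inverse map, that is, under
    \<open>\<sigma> \<beta>\<close>. Accordingly \<open>H \<alpha>\<close> is its inverse.\<close>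
  define H where "H \<gamma> \<xi> = (THE \<eta>. \<eta> \<in> X \<and> (\<forall>m. \<xi> \<in> \<sigma> \<gamma> (cyl \<eta> m)))" for \<gamma> \<xi>
  have h: "H \<beta> \<xi> \<in> X" "\<xi> \<in> \<sigma> \<beta> (cyl (H \<beta> \<xi>) m)" if "\<xi> \<in> X" for \<xi> m
    using theI'[OF intertwiner_aux[OF \<alpha> \<beta> that]] by (auto simp: H_def)
  have k: "H \<alpha> \<xi> \<in> X" "\<xi> \<in> \<sigma> \<alpha> (cyl (H \<alpha> \<xi>) m)" if "\<xi> \<in> X" for \<xi> m
    using theI'[OF intertwiner_aux[OF \<beta>(1) \<alpha> \<beta>(3,2) that]] by (auto simp: H_def)
  have hI: "H \<beta> \<xi> = \<eta>" if "\<xi> \<in> X" "\<eta> \<in> X" "\<And>m. \<xi> \<in> \<sigma> \<beta> (cyl \<eta> m)" for \<xi> \<eta>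
    unfolding H_def using that by (intro the1_equality intertwiner_aux[OF \<alpha> \<beta>]) auto
  have kI: "H \<alpha> \<xi> = \<eta>" if "\<xi> \<in> X" "\<eta> \<in> X" "\<And>m. \<xi> \<in> \<sigma> \<alpha> (cyl \<eta> m)" for \<xi> \<eta>
    unfolding H_def using that by (intro the1_equality intertwiner_aux[OF \<beta>(1) \<alpha> \<beta>(3,2)]) auto
  have kh: "H \<alpha> (H \<beta> \<xi>) = \<xi>" if "\<xi> \<in> X" for \<xi>
    using that h \<sigma>_swap[OF \<alpha> \<beta>(1,2)] by (intro kI) auto
  have hk: "H \<beta> (H \<alpha> \<xi>) = \<xi>" if "\<xi> \<in> X" for \<xi>
    using that k \<sigma>_swap[OF \<beta>(1) \<alpha> \<beta>(3)] by (intro hI) auto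
  have ct: "cts (H \<gamma>)"
    if \<gamma>: "\<gamma> \<in> auto \<Gamma>" and p: "\<And>\<xi> m. \<xi> \<in> X \<Longrightarrow> H \<gamma> \<xi> \<in> X \<and> \<xi> \<in> \<sigma> \<gamma> (cyl (H \<gamma> \<xi>) m)" for \<gamma>
    unfolding cts_def
  proof (intro ballI allI)
    fix \<xi> n assume \<xi>: "\<xi> \<in> X"
    have "clop (\<sigma> \<gamma> (cyl (H \<gamma> \<xi>) n))" using \<gamma> p[OF \<xi>] by (intro \<sigma>_clop clop_cyl) auto
    then obtain m where m: "cyl \<xi> m \<subseteq> \<sigma> \<gamma> (cyl (H \<gamma> \<xi>) n)" using clop_local p[OF \<xi>] by blast
    have "H \<gamma> \<eta> n = H \<gamma> \<xi> n" if "\<eta> \<in> X" "\<eta> m = \<xi> m" for \<eta>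
    proof (rule ccontr)
      assume "H \<gamma> \<eta> n \<noteq> H \<gamma> \<xi> n"
      moreover have "\<eta> \<in> \<sigma> \<gamma> (cyl (H \<gamma> \<xi>) n)" using that m by (auto simp: cyl_def)
      ultimately show False
        using \<sigma>_disjoint[OF \<gamma>, of "H \<gamma> \<eta>" "H \<gamma> \<xi>" n] p[OF \<xi>] p[OF that(1)] by blast
    qed
    then show "\<exists>m. \<forall>\<eta>\<in>X. \<eta> m = \<xi> m \<longrightarrow> H \<gamma> \<eta> n = H \<gamma> \<xi> n" by blast
  qed
  define h' where "h' = restrict (H \<beta>) X"
  have bij: "bij_betw h' X X"
    unfolding h'_def using h k hk kh by (intro bij_betw_byWitness[where f' = "H \<alpha>"]) auto
  have inv: "inv_into X h' \<xi> = H \<alpha> \<xi>" if "\<xi> \<in> X" for \<xi>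
    using bij that k hk by (intro inv_into_f_eq) (auto simp: bij_betw_def h'_def)
  have "cts h'" "cts (inv_into X h')"
    using ct[OF \<beta>(1)] ct[OF \<alpha>] h k inv by (auto simp: cts_def h'_def)
  then have "homeo h'" using bij by (simp add: homeo_def h'_def)
  moreover have "intertwines \<alpha> h'" unfolding intertwines_def
  proof (intro ballI)
    fix g \<xi> assume g: "g \<in> carrier \<Gamma>" and \<xi>: "\<xi> \<in> X"
    have "H \<beta> (g \<cdot> \<xi>) = \<alpha> g \<cdot> H \<beta> \<xi>"
    proof (rule hI)
      fix m
      \<comment> \<open>In the equivariance of \<open>\<sigma> \<beta>\<close> the automorphism
        \<open>\<beta>\<close> cancels \<open>\<alpha>\<close>, which leaves translation by
        \<open>g\<close>.\<close>
      have "\<sigma> \<beta> (cyl (\<alpha> g \<cdot> H \<beta> \<xi>) m) = (\<cdot>) g ` \<sigma> \<beta> (cyl (H \<beta> \<xi>) m)"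
        using \<sigma>_equivariant[OF \<beta>(1), of "\<alpha> g" "cyl (H \<beta> \<xi>) m"] image_cyl[of "\<alpha> g" "H \<beta> \<xi>" m]
          \<alpha> \<beta> g h(1)[OF \<xi>] cyl_sub by simp
      then show "g \<cdot> \<xi> \<in> \<sigma> \<beta> (cyl (\<alpha> g \<cdot> H \<beta> \<xi>) m)" using h(2)[OF \<xi>] by blast
    qed (use g \<xi> \<alpha> h in auto)
    then show "h' (g \<cdot> \<xi>) = \<alpha> g \<cdot> h' \<xi>" using g \<xi> by (simp add: h'_def)
  qed
  ultimately show ?thesis by blast
qed

text \<open>If \<open>h \<xi>\<close> and \<open>k \<xi>\<close> differ at level n, take a
  nontrivial \<open>g\<close> supported in a cylinder around \<open>\<xi>\<close> so small that
  \<open>h\<close> and \<open>k\<close> are constant at level n there. Then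
  \<open>\<alpha> g\<close> is supported in each of two disjoint cylinders, so it is
  trivial.\<close>

theorem intertwiner_unique:
  assumes \<alpha>: "\<alpha> \<in> auto \<Gamma>" and "homeo h" "intertwines \<alpha> h" "homeo k" "intertwines \<alpha> k"
  shows "h = k"
proof (rule extensionalityI[where A = X])
  show "h \<in> extensional X" "k \<in> extensional X" using assms by (auto simp: homeo_def)
  fix \<xi> assume \<xi>: "\<xi> \<in> X"
  have bij: "h ` X = X" "k ` X = X" using assms by (auto simp: homeo_def bij_betw_def)
  show "h \<xi> = k \<xi>"
  proof (rule ccontr)
    assume "h \<xi> \<noteq> k \<xi>"
    then obtain n where n: "h \<xi> n \<noteq> k \<xi> n" by (auto simp: fun_eq_iff)
    obtain i j where i: "\<forall>\<eta>\<in>X. \<eta> i = \<xi> i \<longrightarrow> h \<eta> n = h \<xi> n" "\<forall>\<eta>\<in>X. \<eta> j = \<xi> j \<longrightarrow> k \<eta> n = k \<xi> n"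
      using assms \<xi> by (auto simp: homeo_def cts_def) metis
    obtain g where g: "g \<in> rst (cyl \<xi> (max i j))" "g \<noteq> \<one>" using rst_cyl_nontrivial[OF \<xi>] by blast
    have gc: "g \<in> carrier \<Gamma>" using g rst_closed by blast
    have f: "\<alpha> g \<cdot> f \<eta> = f \<eta>"
      if "intertwines \<alpha> f" "\<eta> \<in> X" "f \<eta> n \<noteq> f \<xi> n" "\<forall>\<eta>\<in>X. \<eta> l = \<xi> l \<longrightarrow> f \<eta> n = f \<xi> n" "l \<le> max i j" for f \<eta> l
    proof -
      have "\<eta> l \<noteq> \<xi> l" using that by blast
      then have "\<eta> \<notin> cyl \<xi> (max i j)" using prefix[OF that(2) \<xi> _ that(5)] by (auto simp: cyl_def)
      then have "g \<cdot> \<eta> = \<eta>" using rst_fix g that by blast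
      then show ?thesis using that gc by (metis intertwines_def)
    qed
    have "\<alpha> g = \<one>"
    proof (rule act_eqI)
      fix \<zeta> assume z: "\<zeta> \<in> X"
      obtain x y where xy: "x \<in> X" "\<zeta> = h x" "y \<in> X" "\<zeta> = k y" using z bij by blast
      have "\<alpha> g \<cdot> \<zeta> = \<zeta>"
      proof (cases "\<zeta> n = h \<xi> n")
        case True
        then show ?thesis using f[OF assms(5) xy(3) _ i(2)] xy n by auto
      next
        case False
        then show ?thesis using f[OF assms(3) xy(1) _ i(1)] xy by auto
      qed
      then show "\<alpha> g \<cdot> \<zeta> = \<one> \<cdot> \<zeta>" using z by simp
    qed (use gc \<alpha> in auto)
    then have "\<alpha> g = \<alpha> \<one>" using auto_one[OF \<alpha>] by simp
    moreover have "inj_on \<alpha> (carrier \<Gamma>)" using \<alpha> by (auto simp: auto_def Bij_def bij_betw_def)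
    ultimately show False using g(2) gc by (auto dest: inj_onD)
  qed
qed

end

section \<open>Equicontinuity of the automorphism group\<close>

lemma finite_representatives:
  assumes "finite (f ` A)"
  shows "\<exists>R\<subseteq>A. finite R \<and> (\<forall>a\<in>A. \<exists>r\<in>R. f a = f r)"
proof -
  obtain R where "R \<subseteq> A" "finite R" "f ` A = f ` R"
    using finite_subset_image[OF assms, of f A] by auto
  then show ?thesis by (metis imageE imageI)
qed

context boundary_action begin

section \<open>The canonical action\<close>

definition canon :: "('g \<Rightarrow> 'g) \<Rightarrow> (nat \<Rightarrow> 'v) \<Rightarrow> nat \<Rightarrow> 'v" where
  "canon \<alpha> = (THE h. homeo h \<and> intertwines \<alpha> h)"

lemma canonI:
  assumes "\<alpha> \<in> auto \<Gamma>" "homeo h" "intertwines \<alpha> h" shows "canon \<alpha> = h"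
  unfolding canon_def using intertwiner_unique[OF assms(1)] assms(2,3) by blast

lemma canon_homeo: "\<alpha> \<in> auto \<Gamma> \<Longrightarrow> homeo (canon \<alpha>)"
  and canon_intertwines: "\<alpha> \<in> auto \<Gamma> \<Longrightarrow> intertwines \<alpha> (canon \<alpha>)"
  using intertwiner_exists canonI by metis+

lemma homeo_bij: "homeo h \<Longrightarrow> bij_betw h X X"
  by (simp add: homeo_def)

lemma homeo_closed: "\<lbrakk>homeo h; \<xi> \<in> X\<rbrakk> \<Longrightarrow> h \<xi> \<in> X"
  using homeo_bij bij_betwE by blast

lemma homeo_ext: "homeo h \<Longrightarrow> h \<in> extensional X"
  by (simp add: homeo_def)

lemma canon_closed [simp]: "\<lbrakk>\<alpha> \<in> auto \<Gamma>; \<xi> \<in> X\<rbrakk> \<Longrightarrow> canon \<alpha> \<xi> \<in> X"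
  using canon_homeo homeo_closed by blast

lemma canon_act:
  "\<lbrakk>\<alpha> \<in> auto \<Gamma>; g \<in> carrier \<Gamma>; \<xi> \<in> X\<rbrakk> \<Longrightarrow> canon \<alpha> (g \<cdot> \<xi>) = \<alpha> g \<cdot> canon \<alpha> \<xi>"
  using canon_intertwines by (simp add: intertwines_def)

lemma cts_comp:
  assumes "cts h" "cts k" "\<And>\<xi>. \<xi> \<in> X \<Longrightarrow> k \<xi> \<in> X" "\<And>\<xi>. \<xi> \<in> X \<Longrightarrow> f \<xi> = h (k \<xi>)"
  shows "cts f"
  unfolding cts_def
proof (intro ballI allI)
  fix \<xi> n assume \<xi>: "\<xi> \<in> X"
  obtain m where m: "\<And>\<eta>. \<eta> \<in> X \<Longrightarrow> \<eta> m = k \<xi> m \<Longrightarrow> h \<eta> n = h (k \<xi>) n"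
    using assms(1) assms(3)[OF \<xi>] unfolding cts_def by blast
  obtain i where i: "\<And>\<eta>. \<eta> \<in> X \<Longrightarrow> \<eta> i = \<xi> i \<Longrightarrow> k \<eta> m = k \<xi> m"
    using assms(2) \<xi> unfolding cts_def by blast
  have "f \<eta> n = f \<xi> n" if "\<eta> \<in> X" "\<eta> i = \<xi> i" for \<eta>
    using m[OF assms(3)[OF that(1)] i[OF that]] assms(4) that(1) \<xi> by simp
  then show "\<exists>m. \<forall>\<eta>\<in>X. \<eta> m = \<xi> m \<longrightarrow> f \<eta> n = f \<xi> n" by blast
qed

lemma homeo_compose:
  assumes "homeo h" "homeo k" shows "homeo (compose X h k)"
proof -
  have b: "bij_betw (compose X h k) X X"     by (rule bij_betw_compose[OF homeo_bij[OF assms(2)] homeo_bij[OF assms(1)]])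
  have ih: "inv_into X f \<xi> \<in> X" if "homeo f" "\<xi> \<in> X" for f \<xi>
    using homeo_bij[OF that(1)] that(2) by (auto simp: bij_betw_def inv_into_into)
  have "inv_into X (compose X h k) \<xi> = inv_into X k (inv_into X h \<xi>)" if "\<xi> \<in> X" for \<xi>
  proof (rule inv_into_f_eq[OF bij_betw_imp_inj_on[OF b]])
    show "inv_into X k (inv_into X h \<xi>) \<in> X" using ih assms that by simp
    then show "compose X h k (inv_into X k (inv_into X h \<xi>)) = \<xi>"
      using that ih assms bij_betw_inv_into_right[OF homeo_bij[OF assms(1)]]
        bij_betw_inv_into_right[OF homeo_bij[OF assms(2)]] by (simp add: compose_def)
  qed
  moreover have "cts (inv_into X k)" "cts (inv_into X h)" using assms by (simp_all add: homeo_def)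
  ultimately have "cts (inv_into X (compose X h k))"
    using cts_comp[of "inv_into X k" "inv_into X h"] ih[OF assms(1)] by blast
  moreover have "cts (compose X h k)"
  proof (rule cts_comp[of h k])
    show "cts h" "cts k" using assms by (simp_all add: homeo_def)
  qed (use homeo_closed[OF assms(2)] in \<open>simp_all add: compose_def\<close>)
  ultimately show ?thesis using b by (simp add: homeo_def compose_def)
qed

lemma homeo_act:
  assumes g: "g \<in> carrier \<Gamma>" shows "homeo (restrict ((\<cdot>) g) X)"
proof -
  let ?h = "restrict ((\<cdot>) g) X"
  have b: "bij_betw ?h X X"
    using g by (intro bij_betw_byWitness[where f' = "(\<cdot>) (inv g)"]) auto
  have "inv_into X ?h \<xi> = inv g \<cdot> \<xi>" if "\<xi> \<in> X" for \<xi>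
    using that g by (intro inv_into_f_eq[OF bij_betw_imp_inj_on[OF b]]) auto
  then have "cts (inv_into X ?h)"
    using g unfolding cts_def by (metis act_level inv_closed)
  moreover have "cts ?h" using g unfolding cts_def by (metis act_level restrict_apply')
  ultimately show ?thesis using b by (simp add: homeo_def)
qed

lemma auto_compose:
  "\<lbrakk>\<alpha> \<in> auto \<Gamma>; \<beta> \<in> auto \<Gamma>\<rbrakk> \<Longrightarrow> compose (carrier \<Gamma>) \<alpha> \<beta> \<in> auto \<Gamma>"
  using subgroup.m_closed[OF subgroup_auto, of \<alpha> \<beta>] by (simp add: BijGroup_def auto_def)

lemma canon_compose:
  assumes "\<alpha> \<in> auto \<Gamma>" "\<beta> \<in> auto \<Gamma>"
  shows "canon (compose (carrier \<Gamma>) \<alpha> \<beta>) = compose X (canon \<alpha>) (canon \<beta>)"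
proof (rule canonI)
  show "intertwines (compose (carrier \<Gamma>) \<alpha> \<beta>) (compose X (canon \<alpha>) (canon \<beta>))"
    using assms by (simp add: intertwines_def compose_def canon_act)
qed (use assms in \<open>auto intro: auto_compose homeo_compose canon_homeo\<close>)

lemma canon_inj:
  assumes "\<alpha> \<in> auto \<Gamma>" "\<beta> \<in> auto \<Gamma>" "canon \<alpha> = canon \<beta>" shows "\<alpha> = \<beta>"
proof (rule extensionalityI[where A = "carrier \<Gamma>"])
  show "\<alpha> \<in> extensional (carrier \<Gamma>)" "\<beta> \<in> extensional (carrier \<Gamma>)"
    using assms by (auto simp: auto_def Bij_def)
  fix g assume g: "g \<in> carrier \<Gamma>"
  show "\<alpha> g = \<beta> g"
  proof (rule act_eqI)
    fix \<xi> assume "\<xi> \<in> X"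
    then obtain \<eta> where \<eta>: "\<eta> \<in> X" "\<xi> = canon \<alpha> \<eta>"
      using homeo_bij[OF canon_homeo[OF assms(1)]] by (auto simp: bij_betw_def)
    then show "\<alpha> g \<cdot> \<xi> = \<beta> g \<cdot> \<xi>"
      using canon_act[OF assms(1) g \<eta>(1)] canon_act[OF assms(2) g \<eta>(1)] assms(3) by simp
  qed (use g assms in auto)
qed

text \<open>Since the action is faithful, injectivity and multiplicativity of \<open>f\<close>
  follow from the intertwining relation. This yields automorphisms from conjugation, both by group
  elements and by normalizing tree automorphisms.\<close>

lemma auto_of_homeo:
  assumes h: "homeo h"
    and f: "\<And>g. g \<in> carrier \<Gamma> \<Longrightarrow> f g \<in> carrier \<Gamma>" "f \<in> extensional (carrier \<Gamma>)"
      "carrier \<Gamma> \<subseteq> f ` carrier \<Gamma>"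
    and hf: "intertwines f h"
  shows "f \<in> auto \<Gamma>"
proof -
  have hf': "h (g \<cdot> \<xi>) = f g \<cdot> h \<xi>" if "g \<in> carrier \<Gamma>" "\<xi> \<in> X" for g \<xi>
    using hf that by (simp add: intertwines_def)
  have surj: "\<exists>\<eta>\<in>X. \<xi> = h \<eta>" if "\<xi> \<in> X" for \<xi>
    using homeo_bij[OF h] that by (auto simp: bij_betw_def)
  have hin: "h \<xi> = h \<eta> \<longleftrightarrow> \<xi> = \<eta>" if "\<xi> \<in> X" "\<eta> \<in> X" for \<xi> \<eta>
    using homeo_bij[OF h] that by (auto simp: bij_betw_def inj_on_eq_iff)
  have "inj_on f (carrier \<Gamma>)"
  proof (rule inj_onI)
    fix g k assume g: "g \<in> carrier \<Gamma>" "k \<in> carrier \<Gamma>" "f g = f k"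
    show "g = k"
    proof (rule act_eqI[OF g(1,2)])
      fix \<xi> assume x: "\<xi> \<in> X"
      have "h (g \<cdot> \<xi>) = h (k \<cdot> \<xi>)" using hf'[OF g(1) x] hf'[OF g(2) x] g(3) by simp
      then show "g \<cdot> \<xi> = k \<cdot> \<xi>" using hin g x by simp
    qed
  qed
  then have "f \<in> Bij (carrier \<Gamma>)" using f by (auto simp: Bij_def bij_betw_def)
  moreover have "f (g \<otimes> k) = f g \<otimes> f k" if g: "g \<in> carrier \<Gamma>" "k \<in> carrier \<Gamma>" for g k
  proof (rule act_eqI)
    fix \<xi> assume "\<xi> \<in> X"
    then obtain \<eta> where \<eta>: "\<eta> \<in> X" "\<xi> = h \<eta>" using surj by blast
    have "f (g \<otimes> k) \<cdot> h \<eta> = h (g \<cdot> k \<cdot> \<eta>)" using hf'[of "g \<otimes> k" \<eta>] g \<eta> by (simp add: act_mult)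
    also have "\<dots> = f g \<cdot> f k \<cdot> h \<eta>" using hf' g \<eta> by simp
    also have "\<dots> = (f g \<otimes> f k) \<cdot> h \<eta>" using g \<eta> f homeo_closed[OF h] by (simp add: act_mult)
    finally show "f (g \<otimes> k) \<cdot> \<xi> = (f g \<otimes> f k) \<cdot> \<xi>" using \<eta> by simp
  qed (use f g in auto)
  ultimately show ?thesis using f(1) unfolding auto_def hom_def by blast
qed

section \<open>Inner automorphisms\<close>

lemma inner_auto_apply: "h \<in> carrier \<Gamma> \<Longrightarrow> inner_auto \<Gamma> g h = g \<otimes> h \<otimes> inv g"
  by (simp add: inner_auto_def)

lemma inner_intertwines:
  assumes g: "g \<in> carrier \<Gamma>" shows "intertwines (inner_auto \<Gamma> g) (restrict ((\<cdot>) g) X)"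
  using g by (simp add: intertwines_def inner_auto_apply act_mult)

lemma inner_auto_auto:
  assumes g: "g \<in> carrier \<Gamma>" shows "inner_auto \<Gamma> g \<in> auto \<Gamma>"
proof (rule auto_of_homeo[OF homeo_act[OF g] _ _ _ inner_intertwines[OF g]])
  show "carrier \<Gamma> \<subseteq> inner_auto \<Gamma> g ` carrier \<Gamma>"
  proof
    fix h assume h: "h \<in> carrier \<Gamma>"
    have "g \<otimes> (inv g \<otimes> h \<otimes> g) \<otimes> inv g = h"
      using g h by (simp add: m_assoc) (simp add: m_assoc[symmetric])
    then show "h \<in> inner_auto \<Gamma> g ` carrier \<Gamma>"
      using g h by (intro image_eqI[of _ _ "inv g \<otimes> h \<otimes> g"]) (auto simp: inner_auto_apply)
  qed
qed (use g in \<open>auto simp: inner_auto_def\<close>)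

lemma canon_inner: "g \<in> carrier \<Gamma> \<Longrightarrow> canon (inner_auto \<Gamma> g) = restrict ((\<cdot>) g) X"
  by (intro canonI inner_auto_auto homeo_act inner_intertwines)

text \<open>The permutation of level \<open>n\<close> induced by \<open>\<alpha> g\<close> is determined by those of the \<open>\<alpha> s\<close> for
  generators \<open>s\<close>, so only finitely many actions on level \<open>n\<close> arise as \<open>\<alpha>\<close> varies.\<close>

lemma finitely_many_level_actions:
  assumes "finitely_generated \<Gamma>"
  shows "\<exists>R\<subseteq>carrier \<Gamma>. finite R \<and>
    (\<forall>g\<in>carrier \<Gamma>. \<exists>r\<in>R. \<forall>\<alpha>\<in>auto \<Gamma>. \<forall>\<xi>\<in>X. (\<alpha> g \<cdot> \<xi>) n = (\<alpha> r \<cdot> \<xi>) n)"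
proof -
  obtain S where S: "finite S" "S \<subseteq> carrier \<Gamma>" "generate \<Gamma> S = carrier \<Gamma>"
    using assms by (auto simp: finitely_generated_def)
  define L where "L = (\<lambda>\<xi>. \<xi> n) ` X"
  have finL: "finite L" using fin_level by (simp add: L_def)
  define rep where "rep v = (SOME \<xi>. \<xi> \<in> X \<and> \<xi> n = v)" for v
  have rep: "rep (\<xi> n) \<in> X" "rep (\<xi> n) n = \<xi> n" if "\<xi> \<in> X" for \<xi>
    unfolding rep_def using someI[of "\<lambda>\<zeta>. \<zeta> \<in> X \<and> \<zeta> n = \<xi> n" \<xi>] that by auto
  define e where "e g = (\<lambda>v\<in>L. (g \<cdot> rep v) n)" for g
  have e_L: "e g \<in> L \<rightarrow>\<^sub>E L" if "g \<in> carrier \<Gamma>" for g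
    using that rep by (auto simp: e_def L_def)
  have e_eq: "e g = e h \<longleftrightarrow> (\<forall>\<xi>\<in>X. (g \<cdot> \<xi>) n = (h \<cdot> \<xi>) n)"
    if "g \<in> carrier \<Gamma>" "h \<in> carrier \<Gamma>" for g h
  proof -
    have "(k \<cdot> rep (\<xi> n)) n = (k \<cdot> \<xi>) n" if "\<xi> \<in> X" "k \<in> carrier \<Gamma>" for k \<xi>
      using act_level that rep by blast
    then have "e k = (\<lambda>v\<in>L. (k \<cdot> rep v) n) \<and> (\<forall>\<xi>\<in>X. e k (\<xi> n) = (k \<cdot> \<xi>) n)"
      if "k \<in> carrier \<Gamma>" for k using that by (auto simp: e_def L_def)
    then have *: "\<forall>\<xi>\<in>X. e k (\<xi> n) = (k \<cdot> \<xi>) n" if "k \<in> carrier \<Gamma>" for k using that by blast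
    show ?thesis
    proof
      show "e g = e h" if a: "\<forall>\<xi>\<in>X. (g \<cdot> \<xi>) n = (h \<cdot> \<xi>) n"
      proof (rule extensionalityI[where A = L])
        fix v assume "v \<in> L"
        then obtain \<xi> where "\<xi> \<in> X" "v = \<xi> n" by (auto simp: L_def)
        then show "e g v = e h v" using * \<open>g \<in> carrier \<Gamma>\<close> \<open>h \<in> carrier \<Gamma>\<close> a by simp
      qed (auto simp: e_def)
    qed (use * that in metis)
  qed
  \<comment> \<open>Polymorphic in the two index types, because automorphisms and group elements
    exchange roles between the two uses below.\<close>
  have fin: "finite ((\<lambda>a. \<lambda>b\<in>B. e (F a b)) ` A)"
    if "finite B" "\<And>a b. a \<in> A \<Longrightarrow> b \<in> B \<Longrightarrow> F a b \<in> carrier \<Gamma>"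
    for F :: "'c \<Rightarrow> 'd \<Rightarrow> 'g" and A B
  proof (rule finite_subset)
    show "(\<lambda>a. \<lambda>b\<in>B. e (F a b)) ` A \<subseteq> B \<rightarrow>\<^sub>E (L \<rightarrow>\<^sub>E L)"
    proof (rule image_subsetI)
      fix a assume "a \<in> A"
      then show "(\<lambda>b\<in>B. e (F a b)) \<in> B \<rightarrow>\<^sub>E (L \<rightarrow>\<^sub>E L)"
        by (intro restrict_PiE_iff[THEN iffD2] ballI e_L[OF that(2)])
    qed
    show "finite (B \<rightarrow>\<^sub>E (L \<rightarrow>\<^sub>E L))" using finL that(1) by (intro finite_PiE) auto
  qed
  \<comment> \<open>\<open>A\<close> represents all automorphisms by their effect on the generators
    at level n; \<open>R\<close> below then represents all group elements by the level-n actions of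
    their images under the members of \<open>A\<close>.\<close>
  have "finite ((\<lambda>\<alpha>. \<lambda>s\<in>S. e (\<alpha> s)) ` auto \<Gamma>)" using S by (intro fin) auto
  from finite_representatives[OF this] obtain A where A: "A \<subseteq> auto \<Gamma>" "finite A"
      "\<And>\<alpha>. \<alpha> \<in> auto \<Gamma> \<Longrightarrow> \<exists>\<beta>\<in>A. (\<lambda>s\<in>S. e (\<alpha> s)) = (\<lambda>s\<in>S. e (\<beta> s))"
    by blast
  have "finite ((\<lambda>g. \<lambda>\<beta>\<in>A. e (\<beta> g)) ` carrier \<Gamma>)" using A by (intro fin) auto
  from finite_representatives[OF this] obtain R where R: "R \<subseteq> carrier \<Gamma>" "finite R"
      "\<And>g. g \<in> carrier \<Gamma> \<Longrightarrow> \<exists>r\<in>R. (\<lambda>\<beta>\<in>A. e (\<beta> g)) = (\<lambda>\<beta>\<in>A. e (\<beta> r))"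
    by blast
  have gen: "\<forall>\<xi>\<in>X. (\<alpha> g \<cdot> \<xi>) n = (\<beta> g \<cdot> \<xi>) n"
    if ab: "\<alpha> \<in> auto \<Gamma>" "\<beta> \<in> auto \<Gamma>" and s: "\<And>s. s \<in> S \<Longrightarrow> \<forall>\<xi>\<in>X. (\<alpha> s \<cdot> \<xi>) n = (\<beta> s \<cdot> \<xi>) n"
      and g: "g \<in> generate \<Gamma> S" for \<alpha> \<beta> g
    using g
  proof induction
    case one
    then show ?case using ab by (simp add: auto_one)
  next
    case (incl h)
    then show ?case by (rule s)
  next
    case (inv h)
    have h: "h \<in> carrier \<Gamma>" "\<alpha> h \<in> carrier \<Gamma>" "\<beta> h \<in> carrier \<Gamma>" using inv S ab by auto
    show ?case
    proof
      fix \<xi> assume x: "\<xi> \<in> X"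
      let ?\<eta> = "inv (\<beta> h) \<cdot> \<xi>"
      have "(\<alpha> h \<cdot> ?\<eta>) n = \<xi> n" using s[OF inv] x h by simp
      then have "(inv (\<alpha> h) \<cdot> \<alpha> h \<cdot> ?\<eta>) n = (inv (\<alpha> h) \<cdot> \<xi>) n"
        using x h by (intro act_level) auto
      then show "(\<alpha> (inv h) \<cdot> \<xi>) n = (\<beta> (inv h) \<cdot> \<xi>) n" using x h ab by (simp add: auto_inv)
    qed
  next
    case (eng h k)
    have c: "h \<in> carrier \<Gamma>" "k \<in> carrier \<Gamma>" using eng S by auto
    show ?case
    proof
      fix \<xi> assume x: "\<xi> \<in> X"
      have "(\<alpha> h \<cdot> \<alpha> k \<cdot> \<xi>) n = (\<alpha> h \<cdot> \<beta> k \<cdot> \<xi>) n"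
        using eng.IH(2) x c ab by (intro act_level) auto
      also have "\<dots> = (\<beta> h \<cdot> \<beta> k \<cdot> \<xi>) n" using eng.IH(1) x c ab by simp
      finally show "(\<alpha> (h \<otimes> k) \<cdot> \<xi>) n = (\<beta> (h \<otimes> k) \<cdot> \<xi>) n"
        using x c ab by (simp add: auto_mult act_mult)
    qed
  qed
  have "\<forall>\<alpha>\<in>auto \<Gamma>. \<forall>\<xi>\<in>X. (\<alpha> g \<cdot> \<xi>) n = (\<alpha> r \<cdot> \<xi>) n"
    if gr: "g \<in> carrier \<Gamma>" "r \<in> R" "(\<lambda>\<beta>\<in>A. e (\<beta> g)) = (\<lambda>\<beta>\<in>A. e (\<beta> r))" for g r
  proof
    fix \<alpha> assume \<alpha>: "\<alpha> \<in> auto \<Gamma>"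
    then obtain \<beta> where \<beta>: "\<beta> \<in> A" "(\<lambda>s\<in>S. e (\<alpha> s)) = (\<lambda>s\<in>S. e (\<beta> s))" using A(3) by blast
    have b: "\<beta> \<in> auto \<Gamma>" using \<beta> A by blast
    have r: "r \<in> carrier \<Gamma>" using gr R by blast
    have s: "\<forall>\<xi>\<in>X. (\<alpha> s \<cdot> \<xi>) n = (\<beta> s \<cdot> \<xi>) n" if s: "s \<in> S" for s
    proof -
      have "e (\<alpha> s) = e (\<beta> s)" using fun_cong[OF \<beta>(2), of s] s by simp
      moreover have "s \<in> carrier \<Gamma>" using s S by blast
      ultimately show ?thesis using e_eq \<alpha> b by simp
    qed
    have "e (\<beta> g) = e (\<beta> r)" using fun_cong[OF gr(3), of \<beta>] \<beta>(1) by simp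
    then have "\<forall>\<xi>\<in>X. (\<beta> g \<cdot> \<xi>) n = (\<beta> r \<cdot> \<xi>) n" using e_eq b gr r by simp
    then show "\<forall>\<xi>\<in>X. (\<alpha> g \<cdot> \<xi>) n = (\<alpha> r \<cdot> \<xi>) n"
      using gen[OF \<alpha> b s] gr(1) r S(3) by simp
  qed
  then have "\<exists>r\<in>R. \<forall>\<alpha>\<in>auto \<Gamma>. \<forall>\<xi>\<in>X. (\<alpha> g \<cdot> \<xi>) n = (\<alpha> r \<cdot> \<xi>) n" if "g \<in> carrier \<Gamma>" for g
    using R(3)[OF that] that by (elim bexE) (rule bexI)
  then show ?thesis using R(1,2) by (intro exI[of _ R]) simp
qed

text \<open>Agreement at level n under every automorphism is an equivalence relation
  \<open>E\<close> with closed classes. A dense orbit meets only finitely many classes, so these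
  cover \<open>X\<close> and each is open; group elements then carry the neighbourhood found at
  \<open>\<xi>0\<close> to all other points.\<close>

theorem canon_equicontinuous:
  assumes "finitely_generated \<Gamma>"
  shows "\<exists>N. \<forall>\<xi>\<in>X. \<forall>\<eta>\<in>X. \<xi> N = \<eta> N \<longrightarrow> (\<forall>\<alpha>\<in>auto \<Gamma>. canon \<alpha> \<xi> n = canon \<alpha> \<eta> n)"
proof -
  obtain R where R: "R \<subseteq> carrier \<Gamma>" "finite R"
    "\<And>g. g \<in> carrier \<Gamma> \<Longrightarrow> \<exists>r\<in>R. \<forall>\<alpha>\<in>auto \<Gamma>. \<forall>\<xi>\<in>X. (\<alpha> g \<cdot> \<xi>) n = (\<alpha> r \<cdot> \<xi>) n"
    using finitely_many_level_actions[OF assms, of n] by blast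
  define E where "E \<xi> \<eta> \<longleftrightarrow> (\<forall>\<alpha>\<in>auto \<Gamma>. canon \<alpha> \<xi> n = canon \<alpha> \<eta> n)" for \<xi> \<eta>
  obtain \<xi>0 where \<xi>0: "\<xi>0 \<in> X" using X_ne by blast
  text \<open>A common level separating \<open>\<eta>\<close> from all translates \<open>r \<cdot> \<xi>0\<close> that are not equivalent to it.\<close>
  have sep: "\<exists>N. \<forall>r\<in>R. E (r \<cdot> \<xi>0) \<eta> \<or> (\<exists>\<alpha>\<in>auto \<Gamma>. \<forall>\<zeta>\<in>X. \<zeta> N = \<eta> N \<longrightarrow> canon \<alpha> \<zeta> n \<noteq> canon \<alpha> (r \<cdot> \<xi>0) n)"
    if \<eta>: "\<eta> \<in> X" for \<eta>
  proof -
    have "\<exists>m. E (r \<cdot> \<xi>0) \<eta> \<or> (\<exists>\<alpha>\<in>auto \<Gamma>. \<forall>\<zeta>\<in>X. \<zeta> m = \<eta> m \<longrightarrow> canon \<alpha> \<zeta> n \<noteq> canon \<alpha> (r \<cdot> \<xi>0) n)" for r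
    proof (cases "E (r \<cdot> \<xi>0) \<eta>")
      case False
      then obtain \<alpha> where \<alpha>: "\<alpha> \<in> auto \<Gamma>" "canon \<alpha> (r \<cdot> \<xi>0) n \<noteq> canon \<alpha> \<eta> n" by (auto simp: E_def)
      obtain m where "\<forall>\<zeta>\<in>X. \<zeta> m = \<eta> m \<longrightarrow> canon \<alpha> \<zeta> n = canon \<alpha> \<eta> n"
        using canon_homeo[OF \<alpha>(1)] \<eta> unfolding homeo_def cts_def by blast
      then show ?thesis using \<alpha> by metis
    qed simp
    then obtain m where m: "\<And>r. E (r \<cdot> \<xi>0) \<eta> \<or>
        (\<exists>\<alpha>\<in>auto \<Gamma>. \<forall>\<zeta>\<in>X. \<zeta> (m r) = \<eta> (m r) \<longrightarrow> canon \<alpha> \<zeta> n \<noteq> canon \<alpha> (r \<cdot> \<xi>0) n)" by metis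
    have "m r \<le> Max (m ` R)" if "r \<in> R" for r using R(2) that by simp
    then show ?thesis using m prefix[OF _ \<eta>, of _ "Max (m ` R)"] by (intro exI[of _ "Max (m ` R)"]) meson
  qed
  have rep: "\<exists>r\<in>R. E (r \<cdot> \<xi>0) \<eta>" if \<eta>: "\<eta> \<in> X" for \<eta>
  proof -
    obtain N where N: "\<And>r. r \<in> R \<Longrightarrow> E (r \<cdot> \<xi>0) \<eta> \<or>
        (\<exists>\<alpha>\<in>auto \<Gamma>. \<forall>\<zeta>\<in>X. \<zeta> N = \<eta> N \<longrightarrow> canon \<alpha> \<zeta> n \<noteq> canon \<alpha> (r \<cdot> \<xi>0) n)"
      using sep[OF \<eta>] by blast
    obtain g where g: "g \<in> carrier \<Gamma>" "(g \<cdot> \<xi>0) N = \<eta> N" using act_trans[OF \<xi>0 \<eta>] by blast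
    obtain r where r: "r \<in> R" "\<And>\<alpha>. \<alpha> \<in> auto \<Gamma> \<Longrightarrow> \<forall>\<xi>\<in>X. (\<alpha> g \<cdot> \<xi>) n = (\<alpha> r \<cdot> \<xi>) n"
      using R(3)[OF g(1)] by blast
    have "canon \<alpha> (g \<cdot> \<xi>0) n = canon \<alpha> (r \<cdot> \<xi>0) n" if "\<alpha> \<in> auto \<Gamma>" for \<alpha>
      using r that g R(1) \<xi>0 by (simp add: canon_act subset_iff)
    \<comment> \<open>Otherwise some automorphism would separate \<open>r \<cdot> \<xi>0\<close>
      from all points near \<open>\<eta>\<close>, in particular from
      \<open>g \<cdot> \<xi>0\<close>, contrary to the choice of \<open>r\<close>.\<close>
    then show ?thesis using N[OF r(1)] r(1) g \<xi>0 act_closed by blast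
  qed
  obtain N where N: "\<And>r. r \<in> R \<Longrightarrow> E (r \<cdot> \<xi>0) \<xi>0 \<or>
        (\<exists>\<alpha>\<in>auto \<Gamma>. \<forall>\<zeta>\<in>X. \<zeta> N = \<xi>0 N \<longrightarrow> canon \<alpha> \<zeta> n \<noteq> canon \<alpha> (r \<cdot> \<xi>0) n)"
    using sep[OF \<xi>0] by blast
  have loc: "E \<zeta> \<xi>0" if z: "\<zeta> \<in> X" "\<zeta> N = \<xi>0 N" for \<zeta>
  proof -
    obtain r where r: "r \<in> R" "E (r \<cdot> \<xi>0) \<zeta>" using rep[OF z(1)] by blast
    then have "E (r \<cdot> \<xi>0) \<xi>0" using N[OF r(1)] z by (metis E_def)
    then show ?thesis using r(2) by (simp add: E_def)
  qed
  have "E \<xi> \<eta>" if x: "\<xi> \<in> X" "\<eta> \<in> X" "\<xi> N = \<eta> N" for \<xi> \<eta>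
  proof -
    obtain g where g: "g \<in> carrier \<Gamma>" "(g \<cdot> \<xi>) N = \<xi>0 N" using act_trans[OF x(1) \<xi>0] by blast
    then have "E (g \<cdot> \<xi>) \<xi>0" "E (g \<cdot> \<eta>) \<xi>0"
      using loc x act_level[OF g(1) x] by auto
    then have "E (g \<cdot> \<xi>) (g \<cdot> \<eta>)" by (simp add: E_def)
    \<comment> \<open>Each \<open>\<alpha> g\<close> permutes the parts of level n, so it cancels on
      both sides.\<close>
    then show ?thesis using g x by (simp add: E_def canon_act act_level_iff)
  qed
  then show ?thesis unfolding E_def by blast
qed

end

section \<open>Trees of overlap functions\<close>

lemma enat_eqI_ge:
  fixes a b :: enat
  assumes "\<And>n. enat n \<le> a \<longleftrightarrow> enat n \<le> b" shows "a = b"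
proof (rule ccontr)
  assume "a \<noteq> b"
  then consider "a < b" | "b < a" by fastforce
  then show False
  proof cases
    case 1
    then obtain k where "a = enat k" by (cases a) auto
    then show False using 1 assms[of "Suc k"] by (simp add: Suc_ile_eq)
  next
    case 2
    then obtain k where "b = enat k" by (cases b) auto
    then show False using 2 assms[of "Suc k"] by (simp add: Suc_ile_eq)
  qed
qed

text \<open>Abstracts from \<open>c_hat\<close>. By \<open>refines\<close>, a class of level n lies
  in a level-n cylinder; by \<open>coarse\<close>, it is a union of cylinders of a deeper level. So
  the class partitions and the level partitions of \<open>T\<close> are cofinal in each
  other.\<close>

locale refined_overlap = lf_graded_tree T l par for T :: "'v rgraph" and l par +
  fixes c :: "(nat \<Rightarrow> 'v) \<Rightarrow> (nat \<Rightarrow> 'v) \<Rightarrow> enat"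
  assumes overlap: "overlap_function (rays T) c"
    and refines: "\<lbrakk>\<xi> \<in> rays T; \<eta> \<in> rays T; enat n \<le> c \<xi> \<eta>\<rbrakk> \<Longrightarrow> \<xi> n = \<eta> n"
    and coarse: "\<exists>N. \<forall>\<xi>\<in>rays T. \<forall>\<eta>\<in>rays T. \<xi> N = \<eta> N \<longrightarrow> enat n \<le> c \<xi> \<eta>"
begin

abbreviation "X \<equiv> rays T"
abbreviation "S \<equiv> overlap_tree X c"
abbreviation "vt \<equiv> overlap_vertex X c"
abbreviation "\<pi> \<equiv> overlap_pi X c"
abbreviation "lift \<equiv> overlap_tree_act X c"

lemma c_refl [simp]: "\<xi> \<in> X \<Longrightarrow> c \<xi> \<xi> = \<infinity>"
  using overlap by (simp add: overlap_function_def)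

lemma c_sym: "\<lbrakk>\<xi> \<in> X; \<eta> \<in> X\<rbrakk> \<Longrightarrow> c \<xi> \<eta> = c \<eta> \<xi>"
  using overlap by (simp add: overlap_function_def)

lemma c_trans: "\<lbrakk>\<xi> \<in> X; \<eta> \<in> X; \<zeta> \<in> X; enat n \<le> c \<xi> \<eta>; enat n \<le> c \<eta> \<zeta>\<rbrakk> \<Longrightarrow> enat n \<le> c \<xi> \<zeta>"
  using overlap unfolding overlap_function_def by (metis min_le_iff_disj order_trans min_def)

lemma c_Suc: "enat (Suc n) \<le> c \<xi> \<eta> \<Longrightarrow> enat n \<le> c \<xi> \<eta>"
  by (meson Suc_ile_eq order_less_imp_le)

lemma c_eq: "\<lbrakk>\<xi> \<in> X; \<eta> \<in> X; \<And>n. enat n \<le> c \<xi> \<eta>\<rbrakk> \<Longrightarrow> \<xi> = \<eta>"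
  using refines by (auto simp: fun_eq_iff)

lemma equiv_rel: "equiv X (overlap_rel X c n)"
proof (rule equivI)
  show "overlap_rel X c n \<subseteq> X \<times> X" by (auto simp: overlap_rel_def)
  show "refl_on X (overlap_rel X c n)" by (auto simp: refl_on_def overlap_rel_def)
  show "sym (overlap_rel X c n)" using c_sym by (auto simp: sym_def overlap_rel_def)
  show "trans (overlap_rel X c n)" using c_trans by (auto simp: trans_def overlap_rel_def)
qed

lemma class_mem: "\<xi> \<in> X \<Longrightarrow> \<eta> \<in> overlap_rel X c n `` {\<xi>} \<longleftrightarrow> \<eta> \<in> X \<and> enat n \<le> c \<xi> \<eta>"
  by (simp add: overlap_rel_def)

lemma class_eq_iff:
  "\<lbrakk>\<xi> \<in> X; \<eta> \<in> X\<rbrakk> \<Longrightarrow> overlap_rel X c n `` {\<xi>} = overlap_rel X c n `` {\<eta>} \<longleftrightarrow> enat n \<le> c \<xi> \<eta>"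
  using eq_equiv_class_iff[OF equiv_rel, of \<xi> \<eta> n] by (simp add: overlap_rel_def)

lemma vt_eq_iff: "\<lbrakk>\<xi> \<in> X; \<eta> \<in> X\<rbrakk> \<Longrightarrow> vt n \<xi> = vt m \<eta> \<longleftrightarrow> n = m \<and> enat n \<le> c \<xi> \<eta>"
  using class_eq_iff[of \<xi> \<eta> n] by (cases "n = m") (simp_all add: overlap_vertex_def)

lemma fst_vt [simp]: "fst (vt n \<xi>) = n"
  by (simp add: overlap_vertex_def)

lemma S_verts: "tverts S = {vt n \<xi> | n \<xi>. \<xi> \<in> X}"
  unfolding overlap_tree_def Let_def overlap_vertex_def quotient_def by simp blast

lemma vt_vert [simp]: "\<xi> \<in> X \<Longrightarrow> vt n \<xi> \<in> tverts S"
  by (auto simp: S_verts)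

lemma S_root:
  assumes "\<xi> \<in> X" shows "troot S = vt 0 \<xi>"
proof -
  have "enat 0 \<le> c \<xi> \<eta>" for \<eta> by (simp add: enat_0)
  then have "overlap_rel X c 0 `` {\<xi>} = X" using class_mem[OF assms, of _ 0] by blast
  then show ?thesis by (simp add: overlap_tree_def overlap_vertex_def Let_def)
qed

lemma class_sub_iff:
  assumes "\<xi> \<in> X" "\<eta> \<in> X" "n \<le> m"
  shows "overlap_rel X c m `` {\<eta>} \<subseteq> overlap_rel X c n `` {\<xi>} \<longleftrightarrow> enat n \<le> c \<xi> \<eta>"
proof
  assume "overlap_rel X c m `` {\<eta>} \<subseteq> overlap_rel X c n `` {\<xi>}"
  then have "\<eta> \<in> overlap_rel X c n `` {\<xi>}" using assms class_mem[of \<eta> \<eta> m] by (simp add: subset_iff)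
  then show "enat n \<le> c \<xi> \<eta>" using assms class_mem by blast
next
  assume *: "enat n \<le> c \<xi> \<eta>"
  show "overlap_rel X c m `` {\<eta>} \<subseteq> overlap_rel X c n `` {\<xi>}"
  proof
    fix \<zeta> assume "\<zeta> \<in> overlap_rel X c m `` {\<eta>}"
    then have z: "\<zeta> \<in> X" "enat m \<le> c \<eta> \<zeta>" by (simp_all add: overlap_rel_def)
    then have "enat n \<le> c \<eta> \<zeta>" using order_trans[of "enat n" "enat m"] assms(3) by simp
    then show "\<zeta> \<in> overlap_rel X c n `` {\<xi>}" using c_trans[OF assms(1,2) z(1) *] z assms class_mem by blast
  qed
qed

lemma S_edge_raw: "((n, C), (m, D)) \<in> tedges S \<longleftrightarrow>
    C \<in> X // overlap_rel X c n \<and> D \<in> X // overlap_rel X c m \<and>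
    (m = Suc n \<and> D \<subseteq> C \<or> n = Suc m \<and> C \<subseteq> D)"
  by (auto simp: overlap_tree_def Let_def)

lemma S_edge_iff:
  assumes "\<xi> \<in> X" "\<eta> \<in> X"
  shows "(vt n \<xi>, vt m \<eta>) \<in> tedges S \<longleftrightarrow>
    (m = Suc n \<and> enat n \<le> c \<xi> \<eta>) \<or> (n = Suc m \<and> enat m \<le> c \<xi> \<eta>)"
proof -
  have V: "overlap_rel X c k `` {\<zeta>} \<in> X // overlap_rel X c k" if "\<zeta> \<in> X" for k \<zeta>
    using that by (rule quotientI)
  have "(vt n \<xi>, vt m \<eta>) \<in> tedges S \<longleftrightarrow>
    (m = Suc n \<and> overlap_rel X c m `` {\<eta>} \<subseteq> overlap_rel X c n `` {\<xi>}) \<or>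
    (n = Suc m \<and> overlap_rel X c n `` {\<xi>} \<subseteq> overlap_rel X c m `` {\<eta>})"
    unfolding overlap_vertex_def S_edge_raw using V[OF assms(1), of n] V[OF assms(2), of m] by blast
  also have "\<dots> \<longleftrightarrow> (m = Suc n \<and> enat n \<le> c \<xi> \<eta>) \<or> (n = Suc m \<and> enat m \<le> c \<xi> \<eta>)"
    using class_sub_iff[OF assms, of n m] class_sub_iff[OF assms(2,1), of m n] c_sym[OF assms] by auto
  finally show ?thesis .
qed

lemma S_edges_verts: "(x, y) \<in> tedges S \<Longrightarrow> x \<in> tverts S \<and> y \<in> tverts S"
  by (cases x, cases y) (simp add: S_edge_raw, simp add: overlap_tree_def Let_def)

text \<open>A class determines the coarser class around it through any of its members, so one is
  picked arbitrarily. At the root, truncated subtraction gives back the root.\<close>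

definition S_par :: "nat \<times> (nat \<Rightarrow> 'v) set \<Rightarrow> nat \<times> (nat \<Rightarrow> 'v) set" where
  "S_par x = vt (fst x - 1) (SOME \<xi>. \<xi> \<in> snd x)"

lemma class_choice:
  assumes "\<xi> \<in> X" shows "(SOME \<eta>. \<eta> \<in> snd (vt n \<xi>)) \<in> X" "enat n \<le> c \<xi> (SOME \<eta>. \<eta> \<in> snd (vt n \<xi>))"
proof -
  define e where "e = (SOME \<eta>. \<eta> \<in> snd (vt n \<xi>))"
  have mem: "\<eta> \<in> snd (vt n \<xi>) \<longleftrightarrow> \<eta> \<in> X \<and> enat n \<le> c \<xi> \<eta>" for \<eta>
    using assms by (simp add: overlap_vertex_def overlap_rel_def)
  have "e \<in> snd (vt n \<xi>)"
    unfolding e_def by (rule someI[of "\<lambda>\<eta>. \<eta> \<in> snd (vt n \<xi>)" \<xi>]) (simp add: mem assms)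
  then show "(SOME \<eta>. \<eta> \<in> snd (vt n \<xi>)) \<in> X" "enat n \<le> c \<xi> (SOME \<eta>. \<eta> \<in> snd (vt n \<xi>))"
    unfolding e_def[symmetric] by (simp_all add: mem)
qed

lemma S_par_vt: "\<xi> \<in> X \<Longrightarrow> S_par (vt (Suc n) \<xi>) = vt n \<xi>"
  using class_choice[of \<xi> "Suc n"] c_Suc[of n \<xi> "SOME \<eta>. \<eta> \<in> snd (vt (Suc n) \<xi>)"]
    c_sym[of \<xi> "SOME \<eta>. \<eta> \<in> snd (vt (Suc n) \<xi>)"] vt_eq_iff[of "SOME \<eta>. \<eta> \<in> snd (vt (Suc n) \<xi>)" \<xi> n n]
  by (simp add: S_par_def)

text \<open>Rays agreeing at the level \<open>N\<close> of \<open>coarse\<close> have the same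
  class, so the classes are at most as many as the vertices of \<open>T\<close> at level
  \<open>N\<close>.\<close>

lemma finite_vt: "finite (vt n ` X)"
proof -
  obtain N where N: "\<forall>\<xi>\<in>X. \<forall>\<eta>\<in>X. \<xi> N = \<eta> N \<longrightarrow> enat n \<le> c \<xi> \<eta>" using coarse by blast
  have "vt n \<xi> \<in> (\<lambda>v. vt n (SOME \<eta>. \<eta> \<in> X \<and> \<eta> N = v)) ` (\<lambda>\<xi>. \<xi> N) ` X" if x: "\<xi> \<in> X" for \<xi>
  proof -
    define \<eta> where "\<eta> = (SOME \<eta>. \<eta> \<in> X \<and> \<eta> N = \<xi> N)"
    have "\<eta> \<in> X \<and> \<eta> N = \<xi> N"       unfolding \<eta>_def using someI[of "\<lambda>\<eta>. \<eta> \<in> X \<and> \<eta> N = \<xi> N" \<xi>] x by simp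
    then have "vt n \<xi> = vt n \<eta>" using N x by (simp add: vt_eq_iff)
    then show ?thesis using x unfolding \<eta>_def by blast
  qed
  then show ?thesis using finite_prefixes[of N] by (meson finite_imageI finite_subset image_subsetI)
qed

lemma S_graded: "graded_tree S fst S_par"
proof
  obtain \<xi>0 where x0: "\<xi>0 \<in> X" using rays_ne by blast
  have root_iff: "vt n \<xi> = troot S \<longleftrightarrow> n = 0" if "\<xi> \<in> X" for n \<xi>
    using S_root[OF that] vt_eq_iff[OF that that] by auto
  have nonroot: "\<exists>n. \<exists>\<xi>\<in>X. x = vt (Suc n) \<xi>" if v: "x \<in> tverts S" "x \<noteq> troot S" for x
  proof -
    obtain n \<xi> where x: "x = vt n \<xi>" "\<xi> \<in> X" using v(1) by (auto simp: S_verts)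
    then obtain k where "n = Suc k" using v(2) root_iff[OF x(2), of n] by (cases n) auto
    then show ?thesis using x by blast
  qed
  fix u v
  show "troot S \<in> tverts S" "fst (troot S) = 0" using S_root[OF x0] x0 by auto
  show "S_par v \<in> tverts S" "fst v = Suc (fst (S_par v))" if "v \<in> tverts S" "v \<noteq> troot S"
    using nonroot[OF that] S_par_vt by auto
  \<comment> \<open>Both ends of an edge are classes of one common point, namely any point of the
    smaller class.\<close>
  have edge: "(x, y) \<in> tedges S \<longleftrightarrow> (\<exists>n. \<exists>\<xi>\<in>X. x = vt n \<xi> \<and> y = vt (Suc n) \<xi> \<or> y = vt n \<xi> \<and> x = vt (Suc n) \<xi>)" for x y
  proof
    assume e: "(x, y) \<in> tedges S"
    then obtain n m \<xi> \<eta> where xy: "x = vt n \<xi>" "y = vt m \<eta>" "\<xi> \<in> X" "\<eta> \<in> X"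
      using S_edges_verts[OF e] by (auto simp: S_verts)
    then have "(m = Suc n \<and> enat n \<le> c \<xi> \<eta>) \<or> (n = Suc m \<and> enat m \<le> c \<xi> \<eta>)"
      using e S_edge_iff by blast
    then show "\<exists>n. \<exists>\<xi>\<in>X. x = vt n \<xi> \<and> y = vt (Suc n) \<xi> \<or> y = vt n \<xi> \<and> x = vt (Suc n) \<xi>"
    proof
      assume a: "m = Suc n \<and> enat n \<le> c \<xi> \<eta>"
      then have "x = vt n \<eta> \<and> y = vt (Suc n) \<eta>" using xy vt_eq_iff by simp
      then show ?thesis using xy(4) by blast
    next
      assume a: "n = Suc m \<and> enat m \<le> c \<xi> \<eta>"
      then have "y = vt m \<xi> \<and> x = vt (Suc m) \<xi>" using xy vt_eq_iff c_sym by simp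
      then show ?thesis using xy(3) by blast
    qed
  next
    assume "\<exists>n. \<exists>\<xi>\<in>X. x = vt n \<xi> \<and> y = vt (Suc n) \<xi> \<or> y = vt n \<xi> \<and> x = vt (Suc n) \<xi>"
    then obtain n \<xi> where x: "\<xi> \<in> X" "x = vt n \<xi> \<and> y = vt (Suc n) \<xi> \<or> y = vt n \<xi> \<and> x = vt (Suc n) \<xi>"
      by blast
    then show "(x, y) \<in> tedges S" using S_edge_iff[OF x(1) x(1)] by auto
  qed
  show "(u, v) \<in> tedges S \<longleftrightarrow>
    (u \<in> tverts S \<and> u \<noteq> troot S \<and> v = S_par u) \<or> (v \<in> tverts S \<and> v \<noteq> troot S \<and> u = S_par v)"
  proof
    assume "(u, v) \<in> tedges S"
    then obtain n \<xi> where x: "\<xi> \<in> X" "u = vt n \<xi> \<and> v = vt (Suc n) \<xi> \<or> v = vt n \<xi> \<and> u = vt (Suc n) \<xi>"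
      unfolding edge by blast
    then show "(u \<in> tverts S \<and> u \<noteq> troot S \<and> v = S_par u) \<or> (v \<in> tverts S \<and> v \<noteq> troot S \<and> u = S_par v)"
      using S_par_vt[OF x(1), of n] root_iff[OF x(1), of "Suc n"] vt_vert[OF x(1), of "Suc n"] by auto
  next
    assume "(u \<in> tverts S \<and> u \<noteq> troot S \<and> v = S_par u) \<or> (v \<in> tverts S \<and> v \<noteq> troot S \<and> u = S_par v)"
    then show "(u, v) \<in> tedges S"
    proof
      assume a: "u \<in> tverts S \<and> u \<noteq> troot S \<and> v = S_par u"
      then obtain n \<xi> where x: "\<xi> \<in> X" "u = vt (Suc n) \<xi>" using nonroot by blast
      then have "v = vt n \<xi>" using a S_par_vt by simp
      then show ?thesis using x unfolding edge by blast
    next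
      assume a: "v \<in> tverts S \<and> v \<noteq> troot S \<and> u = S_par v"
      then obtain n \<xi> where x: "\<xi> \<in> X" "v = vt (Suc n) \<xi>" using nonroot by blast
      then have "u = vt n \<xi>" using a S_par_vt by simp
      then show ?thesis using x unfolding edge by blast
    qed
  qed
qed

sublocale S: lf_graded_tree S fst S_par
proof (intro lf_graded_tree.intro lf_graded_tree_axioms.intro S_graded)
  have lev: "level S n = vt n ` X" for n by (auto simp: graded_tree.level_eq[OF S_graded] S_verts)
  show "locally_finite S" unfolding locally_finite_def
  proof
    fix x assume "x \<in> tverts S"
    then obtain n \<xi> where x: "x = vt n \<xi>" "\<xi> \<in> X" by (auto simp: S_verts)
    have "{y. (x, y) \<in> tedges S} \<subseteq> vt (Suc n) ` X \<union> vt (n - 1) ` X"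
    proof
      fix y assume "y \<in> {y. (x, y) \<in> tedges S}"
      then have e: "(x, y) \<in> tedges S" by simp
      then obtain m \<eta> where y: "y = vt m \<eta>" "\<eta> \<in> X" using S_edges_verts[OF e] by (auto simp: S_verts)
      then have "m = Suc n \<or> n = Suc m" using e S_edge_iff x by blast
      then show "y \<in> vt (Suc n) ` X \<union> vt (n - 1) ` X" using y by auto
    qed
    then show "finite {y. (x, y) \<in> tedges S}" using finite_vt by (meson finite_UnI finite_subset)
  qed
  have "(vt n \<xi>, vt (Suc n) \<xi>) \<in> tedges S" if "\<xi> \<in> X" for n \<xi>
    using S_edge_iff[OF that that] that by simp
  then show "leafless S" unfolding leafless_def lev by blast
qed

section \<open>The boundary of the tree of classes\<close>

lemma S_level: "level S n = vt n ` X"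
  by (auto simp: S.level_eq S_verts)

lemma \<pi>_apply: "\<pi> \<xi> n = vt n \<xi>"
  by (simp add: overlap_pi_def)

lemma \<pi>_ray: "\<xi> \<in> X \<Longrightarrow> \<pi> \<xi> \<in> rays S"
  by (simp add: S.rays_iff \<pi>_apply S_par_vt)

lemma \<pi>_inj: "\<lbrakk>\<xi> \<in> X; \<eta> \<in> X; \<pi> \<xi> = \<pi> \<eta>\<rbrakk> \<Longrightarrow> \<xi> = \<eta>"
  by (rule c_eq) (auto simp: fun_eq_iff \<pi>_apply vt_eq_iff)

text \<open>A ray of classes is a nested sequence with representatives \<open>e n\<close>. By
  \<open>refines\<close> these stabilise at each level, the limit is a ray by
  \<open>rays_closed\<close>, and \<open>coarse\<close> puts the limit into every class of the
  sequence.\<close>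

lemma \<pi>_surj:
  assumes \<rho>: "\<rho> \<in> rays S" obtains \<xi> where "\<xi> \<in> X" "\<rho> = \<pi> \<xi>"
proof -
  have "\<exists>\<xi>\<in>X. \<rho> n = vt n \<xi>" for n
    using S.ray_vert[OF \<rho>, of n] S.ray_level[OF \<rho>, of n] by (auto simp: S_verts)
  then obtain e where e: "\<And>n. e n \<in> X" "\<And>n. \<rho> n = vt n (e n)" by metis
  have coh: "enat n \<le> c (e m) (e n)" if "n \<le> m" for n m
  proof -
    have "\<rho> m = \<pi> (e m) m" using e by (simp add: \<pi>_apply)
    then have "\<rho> n = \<pi> (e m) n" using S.ray_prefix[OF \<rho> \<pi>_ray[OF e(1)] _ that] by blast
    then have "vt n (e m) = vt n (e n)" using e by (simp add: \<pi>_apply)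
    then show ?thesis using vt_eq_iff e by blast
  qed
  define f where "f m = e m m" for m
  have fe: "f n = e m n" if "n \<le> m" for n m using refines[OF e(1) e(1) coh[OF that]] by (simp add: f_def)
  have fX: "f \<in> X" by (rule rays_closed) (metis e(1) fe)
  have "\<rho> n = \<pi> f n" for n
  proof -
    obtain N where N: "\<forall>\<xi>\<in>X. \<forall>\<eta>\<in>X. \<xi> N = \<eta> N \<longrightarrow> enat n \<le> c \<xi> \<eta>" using coarse by blast
    let ?m = "max n N"
    have "f N = e ?m N" by (rule fe) simp
    then have "enat n \<le> c f (e ?m)" using N fX e by blast
    then have "enat n \<le> c f (e n)" using c_trans[OF fX e(1) e(1)] coh[of n ?m] by simp
    then show ?thesis using vt_eq_iff[OF e(1) fX] c_sym[OF fX e(1)] e(2) by (simp add: \<pi>_apply)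
  qed
  then show ?thesis using that fX by blast
qed

lemma \<pi>_image: "\<pi> ` X = rays S"
  using \<pi>_ray \<pi>_surj by blast

lemma \<pi>_bij: "bij_betw \<pi> X (rays S)"
  using \<pi>_image \<pi>_inj by (auto simp: bij_betw_def inj_on_def)

text \<open>\<open>coarse\<close> amounts to continuity of \<open>\<pi>\<close>,
  \<open>refines\<close> to continuity of its inverse.\<close>

lemma \<pi>_homeomorphic: "homeomorphic_map (boundary T) (boundary S) \<pi>"
  unfolding homeomorphic_map_maps homeomorphic_maps_def
proof (intro exI[of _ "inv_into X \<pi>"] conjI)
  show "continuous_map (boundary T) (boundary S) \<pi>"
    unfolding continuous_map_boundary[OF lf_graded_tree_axioms S.lf_graded_tree_axioms]
  proof (intro conjI ballI allI)
    fix \<xi> n assume "\<xi> \<in> X"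
    then show "\<exists>m. \<forall>\<eta>\<in>X. \<eta> m = \<xi> m \<longrightarrow> \<pi> \<eta> n = \<pi> \<xi> n"
      using coarse[of n] by (auto simp: \<pi>_apply vt_eq_iff)
  qed (use \<pi>_ray in auto)
  have inv: "inv_into X \<pi> (\<pi> \<xi>) = \<xi>" if "\<xi> \<in> X" for \<xi>
    using that bij_betw_inv_into_left[OF \<pi>_bij] by blast
  show "continuous_map (boundary S) (boundary T) (inv_into X \<pi>)"
    unfolding continuous_map_boundary[OF S.lf_graded_tree_axioms lf_graded_tree_axioms]
  proof (intro conjI ballI allI)
    show "inv_into X \<pi> \<in> rays S \<rightarrow> X" using \<pi>_image by (auto simp: inv_into_into)
    fix \<rho> n assume "\<rho> \<in> rays S"
    then show "\<exists>m. \<forall>\<eta>\<in>rays S. \<eta> m = \<rho> m \<longrightarrow> inv_into X \<pi> \<eta> n = inv_into X \<pi> \<rho> n"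
      unfolding \<pi>_image[symmetric]
      by (intro exI[of _ n]) (auto simp: inv \<pi>_apply vt_eq_iff intro: refines)
  qed
  show "\<forall>\<xi>\<in>topspace (boundary T). inv_into X \<pi> (\<pi> \<xi>) = \<xi>" using inv by (simp add: topspace_boundary)
  show "\<forall>\<rho>\<in>topspace (boundary S). \<pi> (inv_into X \<pi> \<rho>) = \<rho>"
    using bij_betw_inv_into_right[OF \<pi>_bij] by (simp add: S.topspace_boundary)
qed

text \<open>Classes are clopen because, by \<open>coarse\<close>, a class and its complement are
  both unions of cylinders of one level.\<close>

lemma admissible: "admissible (boundary T) c"
  unfolding admissible_def topspace_boundary
proof (intro conjI allI ballI impI compact_boundary totally_disconnected_boundary overlap)
  fix n
  have "X // overlap_rel X c n = snd ` vt n ` X"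
    by (auto simp: quotient_def overlap_vertex_def image_image)
  then show "finite (X // overlap_rel X c n)" using finite_vt by simp
  fix C assume "C \<in> X // overlap_rel X c n"
  then obtain \<xi> where \<xi>: "\<xi> \<in> X" "C = overlap_rel X c n `` {\<xi>}" by (rule quotientE)
  have C: "\<eta> \<in> C \<longleftrightarrow> \<eta> \<in> X \<and> enat n \<le> c \<xi> \<eta>" for \<eta> using class_mem \<xi> by blast
  obtain N where N: "\<And>\<xi> \<eta>. \<lbrakk>\<xi> \<in> X; \<eta> \<in> X; \<xi> N = \<eta> N\<rbrakk> \<Longrightarrow> enat n \<le> c \<xi> \<eta>" using coarse[of n] by blast
  have same: "\<eta> \<in> C \<longleftrightarrow> \<zeta> \<in> C" if z: "\<eta> \<in> X" "\<zeta> \<in> X" "\<eta> N = \<zeta> N" for \<eta> \<zeta>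
    unfolding C using N[OF z] z c_trans[OF \<xi>(1) z(1,2)] c_trans[OF \<xi>(1) z(2,1)] c_sym[OF z(1,2)] by auto
  have op: "openin (boundary T) D"
    if D: "D \<subseteq> X" "\<And>\<eta> \<zeta>. \<eta> \<in> X \<Longrightarrow> \<zeta> \<in> D \<Longrightarrow> \<eta> N = \<zeta> N \<Longrightarrow> \<eta> \<in> D" for D
    unfolding openin_boundary
  proof (intro conjI ballI exI[of _ N] impI)
    show "\<eta> \<in> D" if "\<zeta> \<in> D" "\<eta> \<in> X" "\<eta> N = \<zeta> N" for \<eta> \<zeta> using D(2)[OF that(2,1,3)] .
  qed (fact D(1))
  have CX: "C \<subseteq> X" using C by blast
  show "openin (boundary T) C"
  proof (rule op[OF CX])
    fix \<eta> \<zeta> assume "\<eta> \<in> X" "\<zeta> \<in> C" "\<eta> N = \<zeta> N"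
    then show "\<eta> \<in> C" using same[of \<eta> \<zeta>] CX by blast
  qed
  have "openin (boundary T) (X - C)"
  proof (rule op)
    fix \<eta> \<zeta> assume "\<eta> \<in> X" "\<zeta> \<in> X - C" "\<eta> N = \<zeta> N"
    then show "\<eta> \<in> X - C" using same[of \<eta> \<zeta>] by blast
  qed simp
  then show "closedin (boundary T) C" using C by (auto simp: closedin_def topspace_boundary)
next
  fix \<xi> \<eta> assume "\<xi> \<in> X" "\<eta> \<in> X" "c \<xi> \<eta> = \<infinity>"
  then show "\<xi> = \<eta>" by (intro c_eq) auto
qed

text \<open>By \<open>refines\<close> all members of a class of level n pass through the same vertex
  of level n, so the choice of the member does not matter.\<close>

definition proj :: "nat \<times> (nat \<Rightarrow> 'v) set \<Rightarrow> 'v" where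
  "proj x = (SOME \<xi>. \<xi> \<in> snd x) (fst x)"

lemma proj_vt: "\<xi> \<in> X \<Longrightarrow> proj (vt n \<xi>) = \<xi> n"
  using refines[OF _ class_choice] by (simp add: proj_def)

lemma proj_level_preserving: "level_preserving S T proj"
  unfolding level_preserving_def S_level level_rays by (auto simp: proj_vt)

lemma proj_surjective: "surjective_simplicial S T proj"
  unfolding surjective_simplicial_def simplicial_def
proof (intro conjI ballI)
  show "proj ` tverts S \<subseteq> tverts T" by (auto simp: S_verts proj_vt ray_vert)
  have ray_edge: "(\<xi> n, \<xi> (Suc n)) \<in> tedges T" "(\<xi> (Suc n), \<xi> n) \<in> tedges T" if "\<xi> \<in> X" for \<xi> n
    using that edges_sym unfolding rays_def sym_def by blast+
  show "case e of (x, y) \<Rightarrow> proj x = proj y \<or> (proj x, proj y) \<in> tedges T" if "e \<in> tedges S" for e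
  proof -
    obtain x y where e: "e = (x, y)" "(x, y) \<in> tedges S" using \<open>e \<in> tedges S\<close> by (cases e) auto
    obtain n \<xi> m \<eta> where xy: "x = vt n \<xi>" "\<xi> \<in> X" "y = vt m \<eta>" "\<eta> \<in> X"
      using S_edges_verts[OF e(2)] by (auto simp: S_verts)
    have "(m = Suc n \<and> \<xi> n = \<eta> n) \<or> (n = Suc m \<and> \<xi> m = \<eta> m)"
      using e(2) S_edge_iff refines xy by blast
    then have "(\<xi> n, \<eta> m) \<in> tedges T" using ray_edge xy by metis
    then show ?thesis using e xy by (simp add: proj_vt)
  qed
  show "tverts T \<subseteq> proj ` tverts S"
  proof
    fix v assume "v \<in> tverts T"
    then obtain \<xi> where "\<xi> \<in> X" "\<xi> (l v) = v" using ray_through by blast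
    then show "v \<in> proj ` tverts S" by (intro image_eqI[of _ _ "vt (l v) \<xi>"]) (simp_all add: proj_vt)
  qed
  show "tedges T \<subseteq> map_prod proj proj ` tedges S"
  proof clarify
    fix u v assume e: "(u, v) \<in> tedges T"
    \<comment> \<open>Every edge of \<open>T\<close> lies on a ray, so it is the image of the edge
      between the classes of that ray.\<close>
    obtain n \<xi> where n: "\<xi> \<in> X" "(u = \<xi> n \<and> v = \<xi> (Suc n)) \<or> (v = \<xi> n \<and> u = \<xi> (Suc n))"
    proof -
      have "\<exists>\<xi>\<in>X. \<exists>n. par w = \<xi> n \<and> w = \<xi> (Suc n)" if w: "w \<in> tverts T" "w \<noteq> troot T" for w
      proof -
        obtain \<xi> where "\<xi> \<in> X" "\<xi> (l w) = w" using ray_through w by blast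
        then show ?thesis using l_par[OF w] ray_par by metis
      qed
      then show ?thesis using e that unfolding edge_iff by metis
    qed
    have "(vt n \<xi>, vt (Suc n) \<xi>) \<in> tedges S" "(vt (Suc n) \<xi>, vt n \<xi>) \<in> tedges S"
      using n(1) S_edge_iff by auto
    then show "(u, v) \<in> map_prod proj proj ` tedges S"
      using n proj_vt by (metis map_prod_imageI)
  qed
qed

section \<open>Tree automorphisms as invariant bijections of the boundary\<close>

definition invariant :: "((nat \<Rightarrow> 'v) \<Rightarrow> nat \<Rightarrow> 'v) \<Rightarrow> bool" where
  "invariant h \<longleftrightarrow> bij_betw h X X \<and> (\<forall>\<xi>\<in>X. \<forall>\<eta>\<in>X. c (h \<xi>) (h \<eta>) = c \<xi> \<eta>)"

lemma invariant_closed: "\<lbrakk>invariant h; \<xi> \<in> X\<rbrakk> \<Longrightarrow> h \<xi> \<in> X"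
  unfolding invariant_def using bij_betwE by blast

lemma lift_vt:
  assumes "invariant h" "\<xi> \<in> X" shows "lift h (vt n \<xi>) = vt n (h \<xi>)"
proof -
  have "(\<Union>\<eta>\<in>overlap_rel X c n `` {\<xi>}. overlap_rel X c n `` {h \<eta>}) = overlap_rel X c n `` {h \<xi>}"
  proof (rule UN_constant_eq)
    show "\<xi> \<in> overlap_rel X c n `` {\<xi>}" using assms by (simp add: overlap_rel_def)
    show "\<forall>\<eta>\<in>overlap_rel X c n `` {\<xi>}. overlap_rel X c n `` {h \<eta>} = overlap_rel X c n `` {h \<xi>}"
    proof
      fix \<eta> assume "\<eta> \<in> overlap_rel X c n `` {\<xi>}"
      then have \<eta>: "\<eta> \<in> X" "enat n \<le> c \<eta> \<xi>" using assms(2) class_mem c_sym by auto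
      then have "enat n \<le> c (h \<eta>) (h \<xi>)" using assms by (simp add: invariant_def)
      then show "overlap_rel X c n `` {h \<eta>} = overlap_rel X c n `` {h \<xi>}"
        using class_eq_iff invariant_closed[OF assms(1)] assms(2) \<eta>(1) by blast
    qed
  qed
  then show ?thesis using vt_vert[OF assms(2), of n]
    by (simp add: overlap_tree_act_def overlap_vertex_def)
qed

lemma lift_\<pi>: "\<lbrakk>invariant h; \<xi> \<in> X\<rbrakk> \<Longrightarrow> lift h \<circ> \<pi> \<xi> = \<pi> (h \<xi>)"
  by (simp add: fun_eq_iff \<pi>_apply lift_vt)

lemma lift_aut:
  assumes h: "invariant h" shows "lift h \<in> tree_auts S"
  unfolding tree_auts_def
proof (intro CollectI conjI ballI)
  have inj: "inj_on (lift h) (tverts S)"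
  proof (rule inj_onI)
    fix x y assume "x \<in> tverts S" "y \<in> tverts S" and eq: "lift h x = lift h y"
    then obtain n \<xi> m \<eta> where xy: "x = vt n \<xi>" "\<xi> \<in> X" "y = vt m \<eta>" "\<eta> \<in> X" by (auto simp: S_verts)
    then have "vt n (h \<xi>) = vt m (h \<eta>)" using eq lift_vt h by simp
    then have "n = m" "enat n \<le> c (h \<xi>) (h \<eta>)" using xy vt_eq_iff invariant_closed[OF h] by auto
    then show "x = y" using xy h vt_eq_iff[of \<xi> \<eta> n m] by (simp add: invariant_def)
  qed
  have "lift h ` tverts S = tverts S"
  proof
    show "lift h ` tverts S \<subseteq> tverts S"
    proof (rule image_subsetI)
      fix x assume "x \<in> tverts S"
      then obtain n \<xi> where x: "x = vt n \<xi>" "\<xi> \<in> X" by (auto simp: S_verts)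
      then show "lift h x \<in> tverts S" using lift_vt[OF h] invariant_closed[OF h] vt_vert by simp
    qed
    show "tverts S \<subseteq> lift h ` tverts S"
    proof
      fix x assume "x \<in> tverts S"
      then obtain n \<xi> where x: "x = vt n \<xi>" "\<xi> \<in> X" by (auto simp: S_verts)
      have "\<xi> \<in> h ` X" using h x(2) by (simp add: invariant_def bij_betw_def)
      then obtain \<eta> where "\<eta> \<in> X" "h \<eta> = \<xi>" by blast
      then show "x \<in> lift h ` tverts S" using x lift_vt[OF h] by (intro image_eqI[of _ _ "vt n \<eta>"]) auto
    qed
  qed
  then show "lift h \<in> Bij (tverts S)"
    using inj by (simp add: Bij_def bij_betw_def overlap_tree_act_def)
  obtain \<xi> where "\<xi> \<in> X" using rays_ne by blast
  then show "lift h (troot S) = troot S"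
    using S_root[of \<xi>] S_root[of "h \<xi>"] lift_vt[OF h] invariant_closed[OF h] by simp
  fix u v assume "u \<in> tverts S" "v \<in> tverts S"
  then obtain n \<xi> m \<eta> where uv: "u = vt n \<xi>" "\<xi> \<in> X" "v = vt m \<eta>" "\<eta> \<in> X" by (auto simp: S_verts)
  then show "(lift h u, lift h v) \<in> tedges S \<longleftrightarrow> (u, v) \<in> tedges S"
    using lift_vt[OF h] S_edge_iff invariant_closed[OF h] h by (simp add: invariant_def)
qed

lemma aut_eqI:
  assumes "f \<in> tree_auts S" "g \<in> tree_auts S" "\<And>\<xi>. \<xi> \<in> X \<Longrightarrow> f \<circ> \<pi> \<xi> = g \<circ> \<pi> \<xi>"
  shows "f = g"
proof (rule S.tree_auts_ray_eqI[OF assms(1,2)])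
  fix \<rho> assume "\<rho> \<in> rays S"
  then obtain \<xi> where "\<xi> \<in> X" "\<rho> = \<pi> \<xi>" by (rule \<pi>_surj)
  then show "f \<circ> \<rho> = g \<circ> \<rho>" using assms(3) by simp
qed

text \<open>The automorphism acts on rays of classes, hence on \<open>X\<close> through
  \<open>\<pi>\<close>. The value \<open>c \<xi> \<eta>\<close> is determined by the levels at which
  the classes of the two points coincide, and an injective map of vertices preserves these
  levels.\<close>

lemma aut_is_lift:
  assumes \<nu>: "\<nu> \<in> tree_auts S"
  shows "\<exists>h. invariant h \<and> h \<in> extensional X \<and> lift h = \<nu>"
proof -
  define h where "h = restrict (\<lambda>\<xi>. inv_into X \<pi> (\<nu> \<circ> \<pi> \<xi>)) X"
  have ray: "\<nu> \<circ> \<pi> \<xi> \<in> \<pi> ` X" if "\<xi> \<in> X" for \<xi>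
    using \<pi>_image S.aut_ray[OF \<nu> \<pi>_ray[OF that]] by simp
  have hX: "h \<xi> \<in> X" and \<pi>h: "\<pi> (h \<xi>) = \<nu> \<circ> \<pi> \<xi>" if "\<xi> \<in> X" for \<xi>
    using that inv_into_into[OF ray[OF that]] f_inv_into_f[OF ray[OF that]] by (simp_all add: h_def)
  have ch: "c (h \<xi>) (h \<eta>) = c \<xi> \<eta>" if x: "\<xi> \<in> X" "\<eta> \<in> X" for \<xi> \<eta>
  proof (rule enat_eqI_ge)
    fix n
    have v: "vt n (h \<zeta>) = \<nu> (vt n \<zeta>)" if "\<zeta> \<in> X" for \<zeta>
      using fun_cong[OF \<pi>h[OF that], of n] by (simp add: \<pi>_apply)
    have "enat n \<le> c (h \<xi>) (h \<eta>) \<longleftrightarrow> \<nu> (vt n \<xi>) = \<nu> (vt n \<eta>)"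
      using v x vt_eq_iff[OF hX hX, of \<xi> \<eta> n n] by simp
    also have "\<dots> \<longleftrightarrow> vt n \<xi> = vt n \<eta>"
      using x bij_betw_imp_inj_on[OF S.tree_auts_bij[OF \<nu>]] by (simp add: inj_on_eq_iff)
    also have "\<dots> \<longleftrightarrow> enat n \<le> c \<xi> \<eta>" using x vt_eq_iff by simp
    finally show "enat n \<le> c (h \<xi>) (h \<eta>) \<longleftrightarrow> enat n \<le> c \<xi> \<eta>" .
  qed
  have "inj_on h X"
  proof (rule inj_onI)
    fix \<xi> \<eta> assume x: "\<xi> \<in> X" "\<eta> \<in> X" "h \<xi> = h \<eta>"
    then have "c \<xi> \<eta> = \<infinity>" using ch[OF x(1,2)] hX by simp
    then show "\<xi> = \<eta>" using x by (intro c_eq) auto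
  qed
  moreover have "X \<subseteq> h ` X"
  proof
    fix \<xi> assume x: "\<xi> \<in> X"
    \<comment> \<open>A preimage of \<open>\<xi>\<close> is read off from the inverse
      automorphism.\<close>
    let ?\<mu> = "inv\<^bsub>BijGroup (tverts S)\<^esub> \<nu>"
    have \<mu>: "?\<mu> \<in> tree_auts S" using subgroup.m_inv_closed[OF S.tree_auts_subgroup \<nu>] .
    obtain \<eta> where e: "\<eta> \<in> X" "?\<mu> \<circ> \<pi> \<xi> = \<pi> \<eta>" using \<pi>_surj[OF S.aut_ray[OF \<mu> \<pi>_ray[OF x]]] by blast
    have "\<nu> (?\<mu> v) = v" if "v \<in> tverts S" for v
      using that S.tree_auts_bij[OF \<nu>] inv_BijGroup[OF S.tree_auts_Bij[OF \<nu>]]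
      by (simp add: bij_betw_inv_into_right)
    then have "\<nu> \<circ> \<pi> \<eta> = \<pi> \<xi>" using x by (simp add: e(2)[symmetric] fun_eq_iff \<pi>_apply)
    then have "h \<eta> = \<xi>" using \<pi>_inj hX \<pi>h e x by metis
    then show "\<xi> \<in> h ` X" using e by blast
  qed
  ultimately have "invariant h" using hX ch by (auto simp: invariant_def bij_betw_def)
  moreover have "lift h = \<nu>"
    using \<open>invariant h\<close> \<nu> \<pi>h by (intro aut_eqI lift_aut) (simp_all add: lift_\<pi>)
  ultimately show ?thesis by (intro exI[of _ h]) (simp add: h_def)
qed

text \<open>Here \<open>\<psi>\<close> stands for either action, \<open>ray_act\<close> for
  \<open>G\<close> or \<open>canonical_act\<close> for its automorphisms. Faithfulness is inherited
  because a point is determined by its ray of classes.\<close>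

lemma lift_faithful_action:
  assumes "group \<Gamma>"
    and inv: "\<And>g. g \<in> carrier \<Gamma> \<Longrightarrow> invariant (\<psi> g)"
    and mult: "\<And>g h \<xi>. \<lbrakk>g \<in> carrier \<Gamma>; h \<in> carrier \<Gamma>; \<xi> \<in> X\<rbrakk> \<Longrightarrow> \<psi> (g \<otimes>\<^bsub>\<Gamma>\<^esub> h) \<xi> = \<psi> g (\<psi> h \<xi>)"
    and inj: "\<And>g h. \<lbrakk>g \<in> carrier \<Gamma>; h \<in> carrier \<Gamma>; \<And>\<xi>. \<xi> \<in> X \<Longrightarrow> \<psi> g \<xi> = \<psi> h \<xi>\<rbrakk> \<Longrightarrow> g = h"
  shows "faithful_tree_action \<Gamma> S (\<lambda>g. lift (\<psi> g))"
proof -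
  interpret group \<Gamma> by fact
  let ?\<phi> = "\<lambda>g. lift (\<psi> g)"
  have aut: "?\<phi> g \<in> tree_auts S" if "g \<in> carrier \<Gamma>" for g using lift_aut inv that by blast
  have "?\<phi> \<in> hom \<Gamma> (BijGroup (tverts S))"
  proof (rule homI)
    fix g assume g: "g \<in> carrier \<Gamma>"
    then show "?\<phi> g \<in> carrier (BijGroup (tverts S))"
      using S.tree_auts_Bij[OF aut] by (simp add: BijGroup_def)
    fix h assume h: "h \<in> carrier \<Gamma>"
    have m: "?\<phi> g \<otimes>\<^bsub>BijGroup (tverts S)\<^esub> ?\<phi> h \<in> tree_auts S"
      using subgroup.m_closed[OF S.tree_auts_subgroup] aut g h by blast
    show "?\<phi> (g \<otimes>\<^bsub>\<Gamma>\<^esub> h) = ?\<phi> g \<otimes>\<^bsub>BijGroup (tverts S)\<^esub> ?\<phi> h"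
    proof (rule S.tree_auts_eqI[OF aut m])
      fix v assume "v \<in> tverts S"
      then obtain n \<xi> where v: "v = vt n \<xi>" "\<xi> \<in> X" by (auto simp: S_verts)
      have "(?\<phi> g \<otimes>\<^bsub>BijGroup (tverts S)\<^esub> ?\<phi> h) v = ?\<phi> g (?\<phi> h v)"
        using g h v by (intro BijGroup_mult_apply S.tree_auts_Bij aut) simp_all
      then show "?\<phi> (g \<otimes>\<^bsub>\<Gamma>\<^esub> h) v = (?\<phi> g \<otimes>\<^bsub>BijGroup (tverts S)\<^esub> ?\<phi> h) v"
        using g h v inv mult by (simp add: lift_vt invariant_closed)
    qed (use g h in simp)
  qed
  then have "group_action \<Gamma> (tverts S) ?\<phi>"
    by (simp add: group_action_def group_hom_def group_hom_axioms_def group_BijGroup is_group)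
  moreover have "inj_on ?\<phi> (carrier \<Gamma>)"
  proof (rule inj_onI)
    fix g h assume gh: "g \<in> carrier \<Gamma>" "h \<in> carrier \<Gamma>" "?\<phi> g = ?\<phi> h"
    have "\<psi> g \<xi> = \<psi> h \<xi>" if "\<xi> \<in> X" for \<xi>
    proof (rule \<pi>_inj)
      show "\<pi> (\<psi> g \<xi>) = \<pi> (\<psi> h \<xi>)"
        using lift_\<pi>[OF inv[OF gh(1)] that] lift_\<pi>[OF inv[OF gh(2)] that] gh(3) by simp
    qed (use gh inv invariant_closed that in auto)
    then show "g = h" using inj gh by blast
  qed
  ultimately show ?thesis using aut
    by (auto simp: faithful_tree_action_def faithful_action_def faithful_action_axioms_def)
qed

text \<open>A lifted map fixes the ray \<open>\<pi> \<eta>\<close> exactly if the map fixes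
  \<open>\<eta>\<close>, so \<open>rist_rays\<close> for the tree of classes becomes a condition on
  points.\<close>

lemma lift_rist:
  assumes inv: "\<And>g. g \<in> A \<Longrightarrow> invariant (\<psi> g)" and \<xi>: "\<xi> \<in> X"
  shows "rist S ((\<lambda>g. lift (\<psi> g)) ` A) (vt n \<xi>) =
    (\<lambda>g. lift (\<psi> g)) ` {g \<in> A. \<forall>\<eta>\<in>X. \<not> enat n \<le> c \<xi> \<eta> \<longrightarrow> \<psi> g \<eta> = \<eta>}"
proof -
  have "(\<forall>\<rho>\<in>rays S. \<rho> n \<noteq> vt n \<xi> \<longrightarrow> lift (\<psi> g) \<circ> \<rho> = \<rho>) \<longleftrightarrow>
    (\<forall>\<eta>\<in>X. \<not> enat n \<le> c \<xi> \<eta> \<longrightarrow> \<psi> g \<eta> = \<eta>)" if g: "g \<in> A" for g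
  proof -
    have "\<pi> (\<psi> g \<eta>) = \<pi> \<eta> \<longleftrightarrow> \<psi> g \<eta> = \<eta>" if "\<eta> \<in> X" for \<eta>
      using \<pi>_inj invariant_closed[OF inv[OF g]] that by auto
    then show ?thesis unfolding \<pi>_image[symmetric]
      using \<xi> inv[OF g] c_sym by (simp add: lift_\<pi> \<pi>_apply vt_eq_iff)
  qed
  moreover have "(\<lambda>g. lift (\<psi> g)) ` A \<subseteq> tree_auts S" using lift_aut inv by blast
  ultimately show ?thesis using S.rist_rays[of "(\<lambda>g. lift (\<psi> g)) ` A" "vt n \<xi>"] \<xi> by auto
qed

text \<open>The hypotheses speak of levels of \<open>T\<close> and are applied at the deeper level
  \<open>N\<close> from \<open>coarse\<close>: agreement there puts points into the same class of
  level n, and an element supported in a level-\<open>N\<close> cylinder is supported in the class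
  around it.\<close>

lemma lift_weakly_branch:
  assumes act: "faithful_tree_action \<Gamma> S (\<lambda>g. lift (\<psi> g))"
    and inv: "\<And>g. g \<in> carrier \<Gamma> \<Longrightarrow> invariant (\<psi> g)"
    and trans: "\<And>\<xi> \<eta> n. \<lbrakk>\<xi> \<in> X; \<eta> \<in> X\<rbrakk> \<Longrightarrow> \<exists>g\<in>carrier \<Gamma>. \<psi> g \<xi> n = \<eta> n"
    and rigid: "\<And>\<xi> n. \<xi> \<in> X \<Longrightarrow>
      \<exists>g\<in>carrier \<Gamma>. (\<exists>\<eta>\<in>X. \<psi> g \<eta> \<noteq> \<eta>) \<and> (\<forall>\<eta>\<in>X. \<eta> n \<noteq> \<xi> n \<longrightarrow> \<psi> g \<eta> = \<eta>)"
  shows "weakly_branch S ((\<lambda>g. lift (\<psi> g)) ` carrier \<Gamma>)"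
  unfolding weakly_branch_def
proof (intro conjI ballI)
  let ?\<phi> = "\<lambda>g. lift (\<psi> g)"
  interpret group_hom \<Gamma> "BijGroup (tverts S)" ?\<phi>
    using act by (simp add: faithful_tree_action_def faithful_action_def group_action_def)
  have sub: "?\<phi> ` carrier \<Gamma> \<subseteq> tree_auts S" using act by (simp add: faithful_tree_action_def)
  show "subgroup (?\<phi> ` carrier \<Gamma>) (tree_Aut S)"
    unfolding tree_Aut_def
    by (rule group.subgroup_incl[OF group_BijGroup img_is_subgroup S.tree_auts_subgroup sub])
  show "level_transitive S (?\<phi> ` carrier \<Gamma>)"
    unfolding level_transitive_def S_level
  proof (intro allI ballI)
    fix n v w assume "v \<in> vt n ` X" "w \<in> vt n ` X"
    then obtain \<xi> \<eta> where x: "\<xi> \<in> X" "\<eta> \<in> X" "v = vt n \<xi>" "w = vt n \<eta>" by blast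
    obtain N where N: "\<forall>\<xi>\<in>X. \<forall>\<eta>\<in>X. \<xi> N = \<eta> N \<longrightarrow> enat n \<le> c \<xi> \<eta>" using coarse by blast
    obtain g where g: "g \<in> carrier \<Gamma>" "\<psi> g \<xi> N = \<eta> N" using trans x by blast
    have "\<psi> g \<xi> \<in> X" using invariant_closed[OF inv[OF g(1)] x(1)] .
    then have "vt n (\<psi> g \<xi>) = vt n \<eta>" using N g x by (simp add: vt_eq_iff)
    then show "\<exists>g\<in>?\<phi> ` carrier \<Gamma>. g v = w" using lift_vt[OF inv[OF g(1)] x(1)] x g(1) by (intro bexI[of _ "?\<phi> g"]) simp_all
  qed
  fix v assume "v \<in> tverts S"
  then obtain n \<xi> where v: "v = vt n \<xi>" "\<xi> \<in> X" by (auto simp: S_verts)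
  obtain N where N: "\<forall>\<xi>\<in>X. \<forall>\<eta>\<in>X. \<xi> N = \<eta> N \<longrightarrow> enat n \<le> c \<xi> \<eta>" using coarse by blast
  obtain g \<eta> where g: "g \<in> carrier \<Gamma>" "\<eta> \<in> X" "\<psi> g \<eta> \<noteq> \<eta>" "\<forall>\<eta>\<in>X. \<eta> N \<noteq> \<xi> N \<longrightarrow> \<psi> g \<eta> = \<eta>"
    using rigid[OF v(2)] by blast
  have "\<forall>\<eta>\<in>X. \<not> enat n \<le> c \<xi> \<eta> \<longrightarrow> \<psi> g \<eta> = \<eta>" using N g(4) v(2) by metis
  then have r: "?\<phi> g \<in> rist S (?\<phi> ` carrier \<Gamma>) v"
    using lift_rist[OF inv v(2), where A = "carrier \<Gamma>" and n = n] g(1) unfolding v(1) by simp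
  have "?\<phi> g \<noteq> \<one>\<^bsub>tree_Aut S\<^esub>"
  proof
    assume "?\<phi> g = \<one>\<^bsub>tree_Aut S\<^esub>"
    then have "lift (\<psi> g) (vt k \<eta>) = vt k \<eta>" for k using g(2) by (simp add: S.tree_Aut_one)
    then have "\<pi> (\<psi> g \<eta>) = \<pi> \<eta>"
      using lift_vt[OF inv[OF g(1)] g(2)] by (simp add: fun_eq_iff \<pi>_apply)
    then show False using \<pi>_inj g invariant_closed[OF inv[OF g(1)]] by blast
  qed
  then show "rist S (?\<phi> ` carrier \<Gamma>) v \<noteq> {\<one>\<^bsub>tree_Aut S\<^esub>}" using r by blast
qed

end

section \<open>Finitely generated weakly branch groups\<close>

lemma enat_leI:
  fixes a b :: enat
  assumes "\<And>n. enat n \<le> a \<Longrightarrow> enat n \<le> b" shows "a \<le> b"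
proof (cases a)
  case (enat k)
  then show ?thesis using assms[of k] by simp
next
  case infinity
  then have "enat n \<le> b \<longleftrightarrow> enat n \<le> \<infinity>" for n using assms[of n] by simp
  then have "b = \<infinity>" by (rule enat_eqI_ge)
  then show ?thesis by simp
qed

lemma (in graded_tree) ray_overlap_ge_iff:
  assumes "\<xi> \<in> rays T" "\<eta> \<in> rays T" shows "enat n \<le> ray_overlap \<xi> \<eta> \<longleftrightarrow> \<xi> n = \<eta> n"
proof
  assume "\<xi> n = \<eta> n"
  then have "n \<in> {n. \<forall>i\<le>n. \<xi> i = \<eta> i}" using ray_prefix[OF assms] by blast
  then show "enat n \<le> ray_overlap \<xi> \<eta>" unfolding ray_overlap_def by (rule SUP_upper)
next
  assume n: "enat n \<le> ray_overlap \<xi> \<eta>"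
  show "\<xi> n = \<eta> n"
  proof (rule ccontr)
    assume ne: "\<xi> n \<noteq> \<eta> n"
    \<comment> \<open>All rays start at the root, so they can differ only at a positive level
      \<open>Suc k\<close>, and \<open>k\<close> then bounds every common initial segment.\<close>
    then obtain k where k: "n = Suc k" using assms by (cases n) (simp_all add: rays_def)
    have "enat m \<le> enat k" if m: "m \<in> {n. \<forall>i\<le>n. \<xi> i = \<eta> i}" for m
    proof -
      have "\<not> n \<le> m" using m ne by blast
      then show ?thesis using k by simp
    qed
    then have "ray_overlap \<xi> \<eta> \<le> enat k" unfolding ray_overlap_def by (rule SUP_least)
    then have "enat n \<le> enat k" using n by (rule order_trans[rotated])
    then show False using k by simp
  qed
qed

text \<open>Each coset of \<open>H\<close> lies in one coset of \<open>K\<close>, and every coset of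
  \<open>K\<close> is reached in this way.\<close>

lemma (in group) finite_rcosets_mono:
  assumes H: "subgroup H G" and K: "subgroup K G" and sub: "H \<subseteq> K" and fin: "finite (rcosets H)"
  shows "finite (rcosets K)"
proof (rule finite_subset)
  show "rcosets K \<subseteq> (\<lambda>C. K #> (SOME x. x \<in> C)) ` (rcosets H)"
  proof
    fix D assume "D \<in> rcosets K"
    then obtain g where g: "g \<in> carrier G" "D = K #> g" by (auto simp: RCOSETS_def)
    define x where "x = (SOME x. x \<in> H #> g)"
    have "x \<in> H #> g" unfolding x_def by (rule someI[of "\<lambda>x. x \<in> H #> g", OF rcos_self[OF g(1) H]])
    then have "x \<in> K #> g" using sub by (auto simp: r_coset_def)
    then have "D = K #> x" unfolding g(2) by (rule repr_independence[OF _ g(1) K])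
    moreover have "H #> g \<in> rcosets H" using g(1) by (auto simp: RCOSETS_def)
    ultimately show "D \<in> (\<lambda>C. K #> (SOME x. x \<in> C)) ` (rcosets H)" unfolding x_def by (rule image_eqI)
  qed
qed (use fin in simp)

lemma (in group_hom) finite_rcosets_image:
  assumes inj: "inj_on h (carrier G)" and surj: "h ` carrier G = carrier H" and K: "K \<subseteq> carrier G"
  shows "finite (rcosets\<^bsub>H\<^esub> (h ` K)) \<longleftrightarrow> finite (rcosets\<^bsub>G\<^esub> K)"
proof -
  have "h ` (K #>\<^bsub>G\<^esub> g) = h ` K #>\<^bsub>H\<^esub> h g" if "g \<in> carrier G" for g
    using that K by (force simp: r_coset_def)
  then have "rcosets\<^bsub>H\<^esub> (h ` K) = (`) h ` (rcosets\<^bsub>G\<^esub> K)"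
    unfolding RCOSETS_def surj[symmetric] by auto
  moreover have "rcosets\<^bsub>G\<^esub> K \<subseteq> Pow (carrier G)"
    using K by (auto simp: RCOSETS_def r_coset_def)
  then have "inj_on ((`) h) (rcosets\<^bsub>G\<^esub> K)"
    using inj_on_subset[OF inj_on_image_Pow[OF inj]] by blast
  ultimately show ?thesis by (simp add: finite_image_iff)
qed

text \<open>The library's normalizer is a stabiliser in the action on subsets by coset products;
  this unfolds it to conjugation of elements.\<close>

lemma (in group) normalizer_iff:
  assumes "H \<subseteq> carrier G"
  shows "x \<in> normalizer G H \<longleftrightarrow> x \<in> carrier G \<and> (\<lambda>h. x \<otimes> h \<otimes> inv x) ` H = H"
proof -
  have "x <# H #> inv x = (\<lambda>h. x \<otimes> h \<otimes> inv x) ` H"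
    by (auto simp: l_coset_def r_coset_def)
  then show ?thesis using assms by (simp add: normalizer_def stabilizer_def)
qed

locale fg_weakly_branch = lf_graded_tree T l par for T :: "'v rgraph" and l par +
  fixes G :: "('v \<Rightarrow> 'v) set"
  assumes wb: "weakly_branch T G" and fg: "finitely_generated (sub_grp T G)"
begin

abbreviation "\<Gamma> \<equiv> sub_grp T G"

lemma G_subgroup: "subgroup G (tree_Aut T)"
  using wb by (simp add: weakly_branch_def)

lemma G_sub: "G \<subseteq> tree_auts T"
  using subgroup.subset[OF G_subgroup] by simp

lemma G_aut: "g \<in> G \<Longrightarrow> g \<in> tree_auts T"
  using G_sub by blast

lemma group_\<Gamma>: "group \<Gamma>"
  using subgroup.subgroup_is_group[OF G_subgroup group_tree_Aut] .

text \<open>Plain composition serves as the action, so that no restriction gets in the way;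
  \<open>ray_act\<close> agrees with it on rays.\<close>

sublocale B: boundary_action \<Gamma> "rays T" "\<lambda>g \<xi>. g \<circ> \<xi>"
proof (intro boundary_action.intro boundary_action_axioms.intro group_\<Gamma>)
  show "rays T \<noteq> {}" by (rule rays_ne)
  show "finite ((\<lambda>\<xi>. \<xi> n) ` rays T)" for n by (rule finite_prefixes)
  show "\<xi> m = \<eta> m" if "\<xi> \<in> rays T" "\<eta> \<in> rays T" "\<xi> n = \<eta> n" "m \<le> n" for \<xi> \<eta> n m
    using ray_prefix[OF that] .
  show "f \<in> rays T" if "\<And>n. \<exists>\<xi>\<in>rays T. \<forall>i\<le>n. \<xi> i = f i" for f
    using rays_closed[OF that] .
  show "g \<circ> \<xi> \<in> rays T" if "g \<in> carrier \<Gamma>" "\<xi> \<in> rays T" for g \<xi>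
    using that G_aut aut_ray by simp
  show "\<one>\<^bsub>\<Gamma>\<^esub> \<circ> \<xi> = \<xi>" if "\<xi> \<in> rays T" for \<xi>
    using ray_vert[OF that] by (simp add: tree_Aut_one fun_eq_iff)
  show "g \<otimes>\<^bsub>\<Gamma>\<^esub> h \<circ> \<xi> = g \<circ> (h \<circ> \<xi>)" if "g \<in> carrier \<Gamma>" "h \<in> carrier \<Gamma>" "\<xi> \<in> rays T" for g h \<xi>
    using that G_aut ray_vert by (simp add: fun_eq_iff tree_Aut_mult_apply)
  show "g = h" if "g \<in> carrier \<Gamma>" "h \<in> carrier \<Gamma>" "\<And>\<xi>. \<xi> \<in> rays T \<Longrightarrow> g \<circ> \<xi> = h \<circ> \<xi>" for g h
    using that G_aut by (intro tree_auts_ray_eqI) auto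
  show "(g \<circ> \<xi>) n = (g \<circ> \<eta>) n" if "\<xi> n = \<eta> n" for g :: "'v \<Rightarrow> 'v" and \<xi> \<eta> n
    using that by simp
  show "\<exists>g\<in>carrier \<Gamma>. (g \<circ> \<xi>) n = \<eta> n" if x: "\<xi> \<in> rays T" "\<eta> \<in> rays T" for \<xi> \<eta> n
  proof -
    have "\<xi> n \<in> level T n" "\<eta> n \<in> level T n" using x level_rays by auto
    then show ?thesis using wb by (simp add: weakly_branch_def level_transitive_def)
  qed
  show "\<exists>g\<in>carrier \<Gamma>. g \<noteq> \<one>\<^bsub>\<Gamma>\<^esub> \<and> (\<forall>\<eta>\<in>rays T. \<eta> n \<noteq> \<xi> n \<longrightarrow> g \<circ> \<eta> = \<eta>)"
    if x: "\<xi> \<in> rays T" for \<xi> n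
  proof -
    have v: "\<xi> n \<in> tverts T" "l (\<xi> n) = n" using x ray_vert ray_level by auto
    have one: "\<one>\<^bsub>tree_Aut T\<^esub> \<in> rist T G (\<xi> n)"
      using subgroup.one_closed[OF G_subgroup] by (simp add: rist_def tree_Aut_one)
    have "rist T G (\<xi> n) \<noteq> {\<one>\<^bsub>tree_Aut T\<^esub>}" using wb v(1) by (simp add: weakly_branch_def)
    then obtain g where "g \<in> rist T G (\<xi> n)" "g \<noteq> \<one>\<^bsub>tree_Aut T\<^esub>" using one by blast
    then show ?thesis using rist_rays[OF G_sub v(1)] v(2) by auto
  qed
qed

section \<open>The canonical action and the refined overlap function\<close>

lemma Homeo_iff: "h \<in> Homeo (boundary T) \<longleftrightarrow> B.homeo h"
proof -
  have cm: "continuous_map (boundary T) (boundary T) f \<longleftrightarrow> f \<in> rays T \<rightarrow> rays T \<and> B.cts f" for f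
    unfolding continuous_map_boundary[OF lf_graded_tree_axioms lf_graded_tree_axioms] B.cts_def ..
  have "homeomorphic_map (boundary T) (boundary T) h \<longleftrightarrow>
    bij_betw h (rays T) (rays T) \<and> B.cts h \<and> B.cts (inv_into (rays T) h)"
  proof
    assume "homeomorphic_map (boundary T) (boundary T) h"
    then obtain g where g: "h \<in> rays T \<rightarrow> rays T" "B.cts h" "g \<in> rays T \<rightarrow> rays T" "B.cts g"
      "\<forall>\<xi>\<in>rays T. g (h \<xi>) = \<xi>" "\<forall>\<xi>\<in>rays T. h (g \<xi>) = \<xi>"
      unfolding homeomorphic_map_maps homeomorphic_maps_def cm topspace_boundary by blast
    then have b: "bij_betw h (rays T) (rays T)" by (intro bij_betw_byWitness[of _ g]) auto
    have "inv_into (rays T) h \<xi> = g \<xi>" if "\<xi> \<in> rays T" for \<xi>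
      using that g by (intro inv_into_f_eq[OF bij_betw_imp_inj_on[OF b]]) auto
    then have "B.cts (inv_into (rays T) h)" using g(4) by (simp add: B.cts_def)
    then show "bij_betw h (rays T) (rays T) \<and> B.cts h \<and> B.cts (inv_into (rays T) h)" using b g by blast
  next
    assume a: "bij_betw h (rays T) (rays T) \<and> B.cts h \<and> B.cts (inv_into (rays T) h)"
    then have "inv_into (rays T) h \<in> rays T \<rightarrow> rays T" "h \<in> rays T \<rightarrow> rays T"
      using bij_betw_imp_funcset bij_betw_inv_into by blast+
    then show "homeomorphic_map (boundary T) (boundary T) h"
      unfolding homeomorphic_map_maps homeomorphic_maps_def cm topspace_boundary
      using a by (intro exI[of _ "inv_into (rays T) h"])
        (auto simp: bij_betw_inv_into_left bij_betw_inv_into_right)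
  qed
  then show ?thesis by (simp add: Homeo_def B.homeo_def topspace_boundary)
qed

text \<open>Both sides are definite descriptions with the same predicate, so existence and
  uniqueness carry over to \<open>canonical_act\<close>.\<close>

lemma canonical_act_eq:
  assumes \<alpha>: "\<alpha> \<in> auto \<Gamma>" shows "canonical_act T G \<alpha> = B.canon \<alpha>"
proof -
  have "(h \<in> Homeo (boundary T) \<and>
      (\<forall>g\<in>G. \<forall>\<xi>\<in>rays T. h (ray_act T g \<xi>) = ray_act T (\<alpha> g) (h \<xi>))) \<longleftrightarrow>
    (B.homeo h \<and> B.intertwines \<alpha> h)" for h
    using B.homeo_closed[of h] by (auto simp: Homeo_iff B.intertwines_def ray_act_def)
  then show ?thesis unfolding canonical_act_def B.canon_def by simp
qed

text \<open>\<open>G\<close> acts through its inner automorphisms, so invariance of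
  \<open>c_hat\<close> under all automorphisms includes invariance under \<open>G\<close>.\<close>

lemma ray_act_eq: "g \<in> G \<Longrightarrow> ray_act T g = B.canon (inner_auto \<Gamma> g)"
  using B.canon_inner[of g] by (simp add: ray_act_def)

lemma c_hat_ge_iff:
  assumes "\<xi> \<in> rays T" "\<eta> \<in> rays T"
  shows "enat n \<le> c_hat T G \<xi> \<eta> \<longleftrightarrow> (\<forall>\<alpha>\<in>auto \<Gamma>. B.canon \<alpha> \<xi> n = B.canon \<alpha> \<eta> n)"
  using assms by (simp add: c_hat_def le_INF_iff canonical_act_eq ray_overlap_ge_iff)

lemma canon_id: "B.canon (\<lambda>g\<in>carrier \<Gamma>. g) = (\<lambda>\<xi>\<in>rays T. \<xi>)"
proof (rule B.canonI)
  show "(\<lambda>g\<in>carrier \<Gamma>. g) \<in> auto \<Gamma>" by (rule B.id_in_auto)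
  show "B.homeo (\<lambda>\<xi>\<in>rays T. \<xi>)"
  proof -
    have "restrict ((\<circ>) \<one>\<^bsub>\<Gamma>\<^esub>) (rays T) = (\<lambda>\<xi>\<in>rays T. \<xi>)" by (rule restrict_ext) (rule B.act_one)
    then show ?thesis using B.homeo_act[OF B.one_closed] by (simp only:)
  qed
  show "B.intertwines (\<lambda>g\<in>carrier \<Gamma>. g) (\<lambda>\<xi>\<in>rays T. \<xi>)"
    by (simp add: B.intertwines_def G_aut aut_ray)
qed

lemma canon_comp_apply:
  assumes "\<alpha> \<in> auto \<Gamma>" "\<beta> \<in> auto \<Gamma>" "\<xi> \<in> rays T"
  shows "B.canon (compose G \<alpha> \<beta>) \<xi> = B.canon \<alpha> (B.canon \<beta> \<xi>)"
  using B.canon_compose[OF assms(1,2)] assms(3) by (simp add: compose_eq)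

sublocale R: refined_overlap T l par "c_hat T G"
proof
  show "overlap_function (rays T) (c_hat T G)" unfolding overlap_function_def
  proof (intro conjI ballI)
    fix \<xi> \<eta> assume x: "\<xi> \<in> rays T" "\<eta> \<in> rays T"
    show "c_hat T G \<xi> \<xi> = \<infinity>" using x by (intro enat_eqI_ge) (simp add: c_hat_ge_iff)
    show "c_hat T G \<xi> \<eta> = c_hat T G \<eta> \<xi>"
      using x by (intro enat_eqI_ge) (auto simp: c_hat_ge_iff)
    fix \<zeta> assume "\<zeta> \<in> rays T"
    show "min (c_hat T G \<xi> \<eta>) (c_hat T G \<eta> \<zeta>) \<le> c_hat T G \<xi> \<zeta>"
    proof (rule enat_leI)
      fix n assume "enat n \<le> min (c_hat T G \<xi> \<eta>) (c_hat T G \<eta> \<zeta>)"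
      then have "enat n \<le> c_hat T G \<xi> \<eta>" "enat n \<le> c_hat T G \<eta> \<zeta>" by simp_all
      then show "enat n \<le> c_hat T G \<xi> \<zeta>" using x \<open>\<zeta> \<in> rays T\<close> by (simp add: c_hat_ge_iff)
    qed
  qed
  \<comment> \<open>The identity is one of the automorphisms in the infimum.\<close>
  show "\<xi> n = \<eta> n" if x: "\<xi> \<in> rays T" "\<eta> \<in> rays T" "enat n \<le> c_hat T G \<xi> \<eta>" for \<xi> \<eta> n
  proof -
    have "B.canon (\<lambda>g\<in>carrier \<Gamma>. g) \<xi> n = B.canon (\<lambda>g\<in>carrier \<Gamma>. g) \<eta> n"
      using x(3) B.id_in_auto unfolding c_hat_ge_iff[OF x(1,2)] by blast
    then show ?thesis using x unfolding canon_id by simp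
  qed
  \<comment> \<open>This is equicontinuity of the canonical action; here finite generation
    enters.\<close>
  show "\<exists>N. \<forall>\<xi>\<in>rays T. \<forall>\<eta>\<in>rays T. \<xi> N = \<eta> N \<longrightarrow> enat n \<le> c_hat T G \<xi> \<eta>" for n
    using B.canon_equicontinuous[OF fg, of n] by (simp add: c_hat_ge_iff)
qed

text \<open>Composition with a fixed automorphism keeps the family in the infimum inside itself, so
  \<open>c_hat\<close> does not decrease; the same for the inverse automorphism gives
  equality.\<close>

lemma canon_invariant:
  assumes \<alpha>: "\<alpha> \<in> auto \<Gamma>" shows "R.invariant (B.canon \<alpha>)"
  unfolding R.invariant_def
proof (intro conjI ballI B.homeo_bij B.canon_homeo \<alpha>)
  have mono: "enat n \<le> c_hat T G (B.canon \<beta> \<xi>) (B.canon \<beta> \<eta>)"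
    if b: "\<beta> \<in> auto \<Gamma>" and x: "\<xi> \<in> rays T" "\<eta> \<in> rays T" "enat n \<le> c_hat T G \<xi> \<eta>" for \<beta> \<xi> \<eta> n
  proof -
    have "B.canon \<gamma> (B.canon \<beta> \<xi>) n = B.canon \<gamma> (B.canon \<beta> \<eta>) n" if g: "\<gamma> \<in> auto \<Gamma>" for \<gamma>
    proof -
      have "compose G \<gamma> \<beta> \<in> auto \<Gamma>" using B.auto_compose[OF g b] by simp
      then have "B.canon (compose G \<gamma> \<beta>) \<xi> n = B.canon (compose G \<gamma> \<beta>) \<eta> n"
        using x c_hat_ge_iff by blast
      then show ?thesis using x by (simp add: canon_comp_apply[OF g b])
    qed
    then show ?thesis using x b by (simp add: c_hat_ge_iff)
  qed
  fix \<xi> \<eta> assume x: "\<xi> \<in> rays T" "\<eta> \<in> rays T"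
  have "\<exists>\<beta>\<in>auto \<Gamma>. \<forall>g\<in>carrier \<Gamma>. \<beta> (\<alpha> g) = g"
    by (rule B.auto_inverse[OF \<alpha>]) (intro bexI ballI; assumption)
  then obtain \<beta> where \<beta>: "\<beta> \<in> auto \<Gamma>" "\<forall>g\<in>carrier \<Gamma>. \<beta> (\<alpha> g) = g" by blast
  have "compose (carrier \<Gamma>) \<beta> \<alpha> = (\<lambda>g\<in>carrier \<Gamma>. g)"
    unfolding compose_def using \<beta>(2) by (intro restrict_ext) simp
  then have comp: "compose (rays T) (B.canon \<beta>) (B.canon \<alpha>) = (\<lambda>\<xi>\<in>rays T. \<xi>)"
    using B.canon_compose[OF \<beta>(1) \<alpha>] canon_id by simp
  have inv: "B.canon \<beta> (B.canon \<alpha> \<zeta>) = \<zeta>" if "\<zeta> \<in> rays T" for \<zeta>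
    using fun_cong[OF comp, of \<zeta>] that by (simp add: compose_eq)
  show "c_hat T G (B.canon \<alpha> \<xi>) (B.canon \<alpha> \<eta>) = c_hat T G \<xi> \<eta>"
  proof (rule enat_eqI_ge)
    fix n
    show "enat n \<le> c_hat T G (B.canon \<alpha> \<xi>) (B.canon \<alpha> \<eta>) \<longleftrightarrow> enat n \<le> c_hat T G \<xi> \<eta>"
      using mono[OF \<alpha> x] mono[OF \<beta>(1), of "B.canon \<alpha> \<xi>" "B.canon \<alpha> \<eta>" n] x \<alpha> inv by auto
  qed
qed

lemma ray_act_invariant: "g \<in> G \<Longrightarrow> R.invariant (ray_act T g)"
  using canon_invariant B.inner_auto_auto by (simp add: ray_act_eq)

lemma canonical_act_invariant: "\<alpha> \<in> auto \<Gamma> \<Longrightarrow> R.invariant (canonical_act T G \<alpha>)"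
  using canon_invariant by (simp add: canonical_act_eq)

text \<open>A bijection preserving \<open>c_hat\<close> is uniformly continuous for the levels of
  \<open>T\<close>, by \<open>coarse\<close> on the source and \<open>refines\<close> on the target.
  Its inverse preserves \<open>c_hat\<close> too.\<close>

lemma invariant_homeo:
  assumes h: "R.invariant h" "h \<in> extensional (rays T)" shows "B.homeo h"
proof -
  have cts: "B.cts k" if k: "R.invariant k" for k
    unfolding B.cts_def
  proof (intro ballI allI)
    fix \<xi> n assume x: "\<xi> \<in> rays T"
    obtain N where N: "\<forall>\<xi>\<in>rays T. \<forall>\<eta>\<in>rays T. \<xi> N = \<eta> N \<longrightarrow> enat n \<le> c_hat T G \<xi> \<eta>"
      using R.coarse by blast
    have "k \<eta> n = k \<xi> n" if e: "\<eta> \<in> rays T" "\<eta> N = \<xi> N" for \<eta>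
    proof (rule R.refines)
      show "enat n \<le> c_hat T G (k \<eta>) (k \<xi>)" using N e x k by (simp add: R.invariant_def)
    qed (use k e x R.invariant_closed in auto)
    then show "\<exists>m. \<forall>\<eta>\<in>rays T. \<eta> m = \<xi> m \<longrightarrow> k \<eta> n = k \<xi> n" by blast
  qed
  have b: "bij_betw h (rays T) (rays T)" using h by (simp add: R.invariant_def)
  have i: "inv_into (rays T) h \<xi> \<in> rays T" "h (inv_into (rays T) h \<xi>) = \<xi>" if "\<xi> \<in> rays T" for \<xi>
    using that b bij_betw_inv_into_right[OF b] bij_betwE[OF bij_betw_inv_into[OF b]] by auto
  have "c_hat T G (inv_into (rays T) h \<xi>) (inv_into (rays T) h \<eta>) = c_hat T G \<xi> \<eta>"
    if "\<xi> \<in> rays T" "\<eta> \<in> rays T" for \<xi> \<eta>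
    using h(1) i[OF that(1)] i[OF that(2)] unfolding R.invariant_def by metis
  then have "R.invariant (inv_into (rays T) h)"
    using bij_betw_inv_into[OF b] by (simp add: R.invariant_def)
  then show ?thesis using cts b h by (simp add: B.homeo_def)
qed

section \<open>The two actions on the tree of classes\<close>

lemma T_hat_eq: "T_hat T G = R.S" and pi_hat_eq: "pi_hat T G = R.\<pi>"
  and G_act_hat_eq: "G_act_hat T G = (\<lambda>g. R.lift (ray_act T g))"
  and Aut_act_hat_eq: "Aut_act_hat T G = (\<lambda>\<alpha>. R.lift (canonical_act T G \<alpha>))"
  by (auto simp: T_hat_def pi_hat_def G_act_hat_def Aut_act_hat_def)

abbreviation "\<Phi> \<equiv> \<lambda>g. R.lift (ray_act T g)"
abbreviation "\<Psi> \<equiv> \<lambda>\<alpha>. R.lift (canonical_act T G \<alpha>)"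

lemma AutoGroup_mult:
  "\<lbrakk>\<alpha> \<in> auto \<Gamma>; \<beta> \<in> auto \<Gamma>\<rbrakk> \<Longrightarrow> \<alpha> \<otimes>\<^bsub>AutoGroup \<Gamma>\<^esub> \<beta> = compose (carrier \<Gamma>) \<alpha> \<beta>"
  by (simp add: AutoGroup_def BijGroup_def auto_def)

lemma AutoGroup_carrier: "carrier (AutoGroup \<Gamma>) = auto \<Gamma>"
  by (simp add: AutoGroup_def)

lemma ray_act_apply: "\<xi> \<in> rays T \<Longrightarrow> ray_act T g \<xi> = g \<circ> \<xi>"
  by (simp add: ray_act_def)

lemma \<Phi>_faithful: "faithful_tree_action \<Gamma> R.S \<Phi>"
proof (rule R.lift_faithful_action[OF group_\<Gamma>])
  show "R.invariant (ray_act T g)" if "g \<in> carrier \<Gamma>" for g using that ray_act_invariant by simp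
  show "ray_act T (g \<otimes>\<^bsub>\<Gamma>\<^esub> h) \<xi> = ray_act T g (ray_act T h \<xi>)"
    if "g \<in> carrier \<Gamma>" "h \<in> carrier \<Gamma>" "\<xi> \<in> rays T" for g h \<xi>
    using that B.act_mult[OF that] B.act_closed[OF that(2,3)] by (simp add: ray_act_apply)
  show "g = h" if "g \<in> carrier \<Gamma>" "h \<in> carrier \<Gamma>" "\<And>\<xi>. \<xi> \<in> rays T \<Longrightarrow> ray_act T g \<xi> = ray_act T h \<xi>" for g h
    using that by (intro B.act_eqI) (simp_all add: ray_act_apply)
qed

lemma \<Psi>_faithful: "faithful_tree_action (AutoGroup \<Gamma>) R.S \<Psi>"
proof (rule R.lift_faithful_action[OF B.AutoGroup])
  show "R.invariant (canonical_act T G \<alpha>)" if "\<alpha> \<in> carrier (AutoGroup \<Gamma>)" for \<alpha>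
    using that canonical_act_invariant by (simp add: AutoGroup_carrier)
  show "canonical_act T G (\<alpha> \<otimes>\<^bsub>AutoGroup \<Gamma>\<^esub> \<beta>) \<xi> = canonical_act T G \<alpha> (canonical_act T G \<beta> \<xi>)"
    if "\<alpha> \<in> carrier (AutoGroup \<Gamma>)" "\<beta> \<in> carrier (AutoGroup \<Gamma>)" "\<xi> \<in> rays T" for \<alpha> \<beta> \<xi>
    using that B.auto_compose[of \<alpha> \<beta>]
    by (simp add: AutoGroup_carrier AutoGroup_mult canonical_act_eq canon_comp_apply)
  show "\<alpha> = \<beta>" if "\<alpha> \<in> carrier (AutoGroup \<Gamma>)" "\<beta> \<in> carrier (AutoGroup \<Gamma>)"
    "\<And>\<xi>. \<xi> \<in> rays T \<Longrightarrow> canonical_act T G \<alpha> \<xi> = canonical_act T G \<beta> \<xi>" for \<alpha> \<beta>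
  proof (rule B.canon_inj)
    show "B.canon \<alpha> = B.canon \<beta>"
      using that B.homeo_ext[OF B.canon_homeo] canonical_act_eq
      by (intro extensionalityI[where A = "rays T"]) (auto simp: AutoGroup_carrier)
  qed (use that in \<open>auto simp: AutoGroup_carrier\<close>)
qed

lemma \<Psi>_inner: "g \<in> G \<Longrightarrow> \<Psi> (inner_auto \<Gamma> g) = \<Phi> g"
  using B.inner_auto_auto[of g] by (simp add: canonical_act_eq ray_act_eq)

lemma rays_rigid:
  assumes "\<xi> \<in> rays T"
  shows "\<exists>g\<in>G. (\<exists>\<eta>\<in>rays T. ray_act T g \<eta> \<noteq> \<eta>) \<and> (\<forall>\<eta>\<in>rays T. \<eta> n \<noteq> \<xi> n \<longrightarrow> ray_act T g \<eta> = \<eta>)"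
proof -
  obtain g where g: "g \<in> B.rst (B.cyl \<xi> n)" "g \<noteq> \<one>\<^bsub>\<Gamma>\<^esub>" using B.rst_cyl_nontrivial[OF assms] by blast
  obtain \<eta> where "\<eta> \<in> rays T" "g \<circ> \<eta> \<noteq> \<eta>" using B.moved_point[OF g] by blast
  then show ?thesis using g by (intro bexI[of _ g]) (auto simp: ray_act_apply B.rst_def B.cyl_def)
qed

lemma rays_trans: "\<lbrakk>\<xi> \<in> rays T; \<eta> \<in> rays T\<rbrakk> \<Longrightarrow> \<exists>g\<in>G. ray_act T g \<xi> n = \<eta> n"
  using B.act_trans[of \<xi> \<eta> n] by (simp add: ray_act_apply)

lemma \<Phi>_weakly_branch: "weakly_branch R.S (\<Phi> ` G)"
  using R.lift_weakly_branch[OF \<Phi>_faithful] ray_act_invariant rays_trans rays_rigid by simp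

text \<open>The inner automorphisms already provide transitivity and the rigid elements.\<close>

lemma \<Psi>_weakly_branch: "weakly_branch R.S (\<Psi> ` auto \<Gamma>)"
proof -
  have in_a: "inner_auto \<Gamma> g \<in> auto \<Gamma> \<and> canonical_act T G (inner_auto \<Gamma> g) = ray_act T g" if "g \<in> G" for g
    using that B.inner_auto_auto[of g] by (simp add: canonical_act_eq ray_act_eq)
  have "\<exists>\<alpha>\<in>auto \<Gamma>. canonical_act T G \<alpha> \<xi> n = \<eta> n" if "\<xi> \<in> rays T" "\<eta> \<in> rays T" for \<xi> \<eta> n
    using rays_trans[OF that] in_a by metis
  moreover have "\<exists>\<alpha>\<in>auto \<Gamma>. (\<exists>\<eta>\<in>rays T. canonical_act T G \<alpha> \<eta> \<noteq> \<eta>) \<and>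
      (\<forall>\<eta>\<in>rays T. \<eta> n \<noteq> \<xi> n \<longrightarrow> canonical_act T G \<alpha> \<eta> = \<eta>)" if "\<xi> \<in> rays T" for \<xi> n
    using rays_rigid[OF that, of n] in_a by metis
  ultimately show ?thesis
    using R.lift_weakly_branch[OF \<Psi>_faithful] canonical_act_invariant by (simp add: AutoGroup_carrier)
qed

section \<open>Comparing the branch conditions\<close>

lemma \<Phi>_hom: "group_hom \<Gamma> (BijGroup (tverts R.S)) \<Phi>"
  using \<Phi>_faithful by (simp add: faithful_tree_action_def faithful_action_def group_action_def)

lemma \<Phi>_inj: "inj_on \<Phi> G"
  using \<Phi>_faithful by (simp add: faithful_tree_action_def faithful_action_def faithful_action_axioms_def)

abbreviation rist_class :: "nat \<Rightarrow> (nat \<Rightarrow> 'v) \<Rightarrow> ('v \<Rightarrow> 'v) set" where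
  "rist_class n \<xi> \<equiv> {g \<in> G. \<forall>\<eta>\<in>rays T. \<not> enat n \<le> c_hat T G \<xi> \<eta> \<longrightarrow> ray_act T g \<eta> = \<eta>}"

lemma rist_T: "\<xi> \<in> rays T \<Longrightarrow> rist T G (\<xi> n) = {g \<in> G. \<forall>\<eta>\<in>rays T. \<eta> n \<noteq> \<xi> n \<longrightarrow> ray_act T g \<eta> = \<eta>}"
  using rist_rays[OF G_sub ray_vert, of \<xi> n] ray_level[of \<xi> n] by (auto simp: ray_act_apply)

text \<open>Both branch conditions are brought to the same form, finiteness of a coset set of a
  generated subgroup of \<open>\<Gamma>\<close>, so that only the generators remain to be
  compared.\<close>

lemma branch_T_iff:
  "branch T G \<longleftrightarrow> (\<forall>n. finite (rcosets\<^bsub>\<Gamma>\<^esub> (generate \<Gamma> (\<Union>\<xi>\<in>rays T. rist T G (\<xi> n)))))"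
proof -
  have "(\<Union>\<xi>\<in>rays T. rist T G (\<xi> n)) \<subseteq> G" for n by (auto simp: rist_def)
  from group.generate_consistent[OF group_tree_Aut this G_subgroup]
  have "rist_level T G n = generate \<Gamma> (\<Union>\<xi>\<in>rays T. rist T G (\<xi> n))" for n
    unfolding rist_level_def level_rays by simp
  then show ?thesis using wb by (simp add: branch_def weakly_branch_def)
qed

lemma branch_S_iff: "branch R.S (\<Phi> ` G) \<longleftrightarrow>
  (\<forall>n. finite (rcosets\<^bsub>\<Gamma>\<^esub> (generate \<Gamma> (\<Union>\<xi>\<in>rays T. rist_class n \<xi>))))"
proof -
  let ?\<Delta> = "sub_grp R.S (\<Phi> ` G)"
  have subS: "subgroup (\<Phi> ` G) (tree_Aut R.S)" using \<Phi>_weakly_branch by (simp add: weakly_branch_def)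
  have "group ?\<Delta>" by (rule subgroup.subgroup_is_group[OF subS R.S.group_tree_Aut])
  moreover have "\<Phi> \<in> hom \<Gamma> ?\<Delta>"
    using group_hom.homh[OF \<Phi>_hom] by (auto simp: hom_def tree_Aut_def)
  ultimately interpret h: group_hom \<Gamma> ?\<Delta> \<Phi>
    by (simp add: group_hom_def group_hom_axioms_def group_\<Gamma>)
  have "finite (rcosets\<^bsub>?\<Delta>\<^esub> (rist_level R.S (\<Phi> ` G) n)) \<longleftrightarrow>
    finite (rcosets\<^bsub>\<Gamma>\<^esub> (generate \<Gamma> (\<Union>\<xi>\<in>rays T. rist_class n \<xi>)))" for n
  proof -
    let ?K = "\<Union>\<xi>\<in>rays T. rist_class n \<xi>"
    have K: "?K \<subseteq> G" by auto
    have "(\<Union>v\<in>level R.S n. rist R.S (\<Phi> ` G) v) = \<Phi> ` ?K"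
      using R.lift_rist[where A = G and \<psi> = "ray_act T" and n = n] ray_act_invariant
      by (simp add: R.S_level image_UN)
    then have "rist_level R.S (\<Phi> ` G) n = generate ?\<Delta> (\<Phi> ` ?K)"
      unfolding rist_level_def
      using group.generate_consistent[OF R.S.group_tree_Aut _ subS, of "\<Phi> ` ?K"] K by auto
    also have "\<dots> = \<Phi> ` generate \<Gamma> ?K" using h.generate_img[of ?K] K by simp
    finally show ?thesis
      using h.finite_rcosets_image[of "generate \<Gamma> ?K"] \<Phi>_inj B.generate_incl[of ?K] K by simp
  qed
  then show ?thesis using \<Phi>_weakly_branch by (simp add: branch_def weakly_branch_def)
qed

lemma branch_iff: "branch R.S (\<Phi> ` G) \<longleftrightarrow> branch T G"
proof -
  have mono: "finite (rcosets\<^bsub>\<Gamma>\<^esub> (generate \<Gamma> L))"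
    if "K \<subseteq> L" "L \<subseteq> G" "finite (rcosets\<^bsub>\<Gamma>\<^esub> (generate \<Gamma> K))" for K L
    using that B.finite_rcosets_mono[OF B.generate_is_subgroup B.generate_is_subgroup B.mono_generate, of K L]
    by auto
  show ?thesis
  proof
    assume b: "branch R.S (\<Phi> ` G)"
    \<comment> \<open>A class of level n lies in the level-n cylinder, so its rigid stabiliser is
      the smaller one, and finite index passes to larger subgroups.\<close>
    have sub: "rist_class n \<xi> \<subseteq> rist T G (\<xi> n)" if "\<xi> \<in> rays T" for n \<xi>
      unfolding rist_T[OF that] using R.refines[OF that] by auto
    have "finite (rcosets\<^bsub>\<Gamma>\<^esub> (generate \<Gamma> (\<Union>\<xi>\<in>rays T. rist T G (\<xi> n))))" for n
    proof (rule mono)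
      show "(\<Union>\<xi>\<in>rays T. rist_class n \<xi>) \<subseteq> (\<Union>\<xi>\<in>rays T. rist T G (\<xi> n))" using sub by (intro UN_mono) auto
    qed (use b in \<open>auto simp: branch_S_iff rist_def\<close>)
    then show "branch T G" unfolding branch_T_iff by blast
  next
    assume b: "branch T G"
    show "branch R.S (\<Phi> ` G)" unfolding branch_S_iff
    proof
      fix n
      obtain N where N: "\<forall>\<xi>\<in>rays T. \<forall>\<eta>\<in>rays T. \<xi> N = \<eta> N \<longrightarrow> enat n \<le> c_hat T G \<xi> \<eta>"
        using R.coarse by blast
      \<comment> \<open>In the other direction the cylinder of the deeper level \<open>N\<close>
        lies in the class of level n.\<close>
      have sub: "rist T G (\<xi> N) \<subseteq> rist_class n \<xi>" if x: "\<xi> \<in> rays T" for \<xi>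
        unfolding rist_T[OF x] using N x by auto
      show "finite (rcosets\<^bsub>\<Gamma>\<^esub> (generate \<Gamma> (\<Union>\<xi>\<in>rays T. rist_class n \<xi>)))"
      proof (rule mono)
        show "(\<Union>\<xi>\<in>rays T. rist T G (\<xi> N)) \<subseteq> (\<Union>\<xi>\<in>rays T. rist_class n \<xi>)"
          using sub by (intro UN_mono) auto
      qed (use b in \<open>auto simp: branch_T_iff\<close>)
    qed
  qed
qed

section \<open>The normalizer in the automorphism group of the tree of classes\<close>

abbreviation "A\<^sub>S \<equiv> tree_Aut R.S"

lemma \<Phi>_aut: "g \<in> G \<Longrightarrow> \<Phi> g \<in> tree_auts R.S"
  using ray_act_invariant R.lift_aut by blast

lemma \<Psi>_aut: "\<alpha> \<in> auto \<Gamma> \<Longrightarrow> \<Psi> \<alpha> \<in> tree_auts R.S"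
  using canonical_act_invariant R.lift_aut by blast

lemma \<Psi>_inj: "inj_on \<Psi> (auto \<Gamma>)"
  using \<Psi>_faithful
  by (simp add: faithful_tree_action_def faithful_action_def faithful_action_axioms_def AutoGroup_carrier)

lemma \<Psi>_mult:
  "\<lbrakk>\<alpha> \<in> auto \<Gamma>; \<beta> \<in> auto \<Gamma>\<rbrakk> \<Longrightarrow> \<Psi> (\<alpha> \<otimes>\<^bsub>AutoGroup \<Gamma>\<^esub> \<beta>) = \<Psi> \<alpha> \<otimes>\<^bsub>A\<^sub>S\<^esub> \<Psi> \<beta>"
proof -
  assume "\<alpha> \<in> auto \<Gamma>" "\<beta> \<in> auto \<Gamma>"
  moreover have "group_hom (AutoGroup \<Gamma>) (BijGroup (tverts R.S)) \<Psi>"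
    using \<Psi>_faithful by (simp add: faithful_tree_action_def faithful_action_def group_action_def)
  ultimately show ?thesis using group_hom.hom_mult[of "AutoGroup \<Gamma>" "BijGroup (tverts R.S)" \<Psi> \<alpha> \<beta>]
    by (simp add: AutoGroup_carrier tree_Aut_def[of R.S])
qed

lemma \<Phi>_mult: "\<lbrakk>g \<in> G; h \<in> G\<rbrakk> \<Longrightarrow> \<Phi> (g \<otimes>\<^bsub>\<Gamma>\<^esub> h) = \<Phi> g \<otimes>\<^bsub>A\<^sub>S\<^esub> \<Phi> h"
  using group_hom.hom_mult[OF \<Phi>_hom, of g h] by (simp add: tree_Aut_def[of R.S])

text \<open>Equality of tree automorphisms is tested on rays \<open>\<pi> \<xi>\<close>, where both
  products can be computed on points. With \<open>h\<close> arbitrary it serves both inclusions of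
  \<open>\<Psi>_normalizer\<close>.\<close>

lemma conj_iff_intertwines:
  assumes h: "R.invariant h" and g: "g \<in> G" "k \<in> G"
  shows "\<Phi> k = R.lift h \<otimes>\<^bsub>A\<^sub>S\<^esub> \<Phi> g \<otimes>\<^bsub>A\<^sub>S\<^esub> inv\<^bsub>A\<^sub>S\<^esub> R.lift h \<longleftrightarrow>
    (\<forall>\<xi>\<in>rays T. h (g \<circ> \<xi>) = k \<circ> h \<xi>)"
proof -
  interpret S: group A\<^sub>S by (rule R.S.group_tree_Aut)
  let ?\<nu> = "R.lift h"
  have c: "?\<nu> \<in> carrier A\<^sub>S" "\<Phi> g \<in> carrier A\<^sub>S" "\<Phi> k \<in> carrier A\<^sub>S"
    using R.lift_aut[OF h] \<Phi>_aut g by auto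
  have "\<Phi> k = ?\<nu> \<otimes>\<^bsub>A\<^sub>S\<^esub> \<Phi> g \<otimes>\<^bsub>A\<^sub>S\<^esub> inv\<^bsub>A\<^sub>S\<^esub> ?\<nu> \<longleftrightarrow> \<Phi> k \<otimes>\<^bsub>A\<^sub>S\<^esub> ?\<nu> = ?\<nu> \<otimes>\<^bsub>A\<^sub>S\<^esub> \<Phi> g"
  proof
    assume "\<Phi> k = ?\<nu> \<otimes>\<^bsub>A\<^sub>S\<^esub> \<Phi> g \<otimes>\<^bsub>A\<^sub>S\<^esub> inv\<^bsub>A\<^sub>S\<^esub> ?\<nu>"
    then have "\<Phi> k \<otimes>\<^bsub>A\<^sub>S\<^esub> ?\<nu> = ?\<nu> \<otimes>\<^bsub>A\<^sub>S\<^esub> \<Phi> g \<otimes>\<^bsub>A\<^sub>S\<^esub> inv\<^bsub>A\<^sub>S\<^esub> ?\<nu> \<otimes>\<^bsub>A\<^sub>S\<^esub> ?\<nu>" by simp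
    also have "\<dots> = ?\<nu> \<otimes>\<^bsub>A\<^sub>S\<^esub> \<Phi> g" using c by (simp add: S.m_assoc del: R.S.tree_Aut_carrier)
    finally show "\<Phi> k \<otimes>\<^bsub>A\<^sub>S\<^esub> ?\<nu> = ?\<nu> \<otimes>\<^bsub>A\<^sub>S\<^esub> \<Phi> g" .
  next
    assume "\<Phi> k \<otimes>\<^bsub>A\<^sub>S\<^esub> ?\<nu> = ?\<nu> \<otimes>\<^bsub>A\<^sub>S\<^esub> \<Phi> g"
    then show "\<Phi> k = ?\<nu> \<otimes>\<^bsub>A\<^sub>S\<^esub> \<Phi> g \<otimes>\<^bsub>A\<^sub>S\<^esub> inv\<^bsub>A\<^sub>S\<^esub> ?\<nu>"
      using c S.inv_solve_right[of "\<Phi> k" "?\<nu> \<otimes>\<^bsub>A\<^sub>S\<^esub> \<Phi> g" ?\<nu>] S.m_closed by metis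
  qed
  also have "\<dots> \<longleftrightarrow> (\<forall>\<xi>\<in>rays T. k \<circ> h \<xi> = h (g \<circ> \<xi>))"
  proof -
    have gx: "g \<circ> \<xi> \<in> rays T" if "\<xi> \<in> rays T" for \<xi> using B.act_closed[of g \<xi>] that g by simp
    have hx: "h \<xi> \<in> rays T" if "\<xi> \<in> rays T" for \<xi> using R.invariant_closed[OF h that] .
    have l: "(\<Phi> k \<otimes>\<^bsub>A\<^sub>S\<^esub> ?\<nu>) \<circ> R.\<pi> \<xi> = R.\<pi> (k \<circ> h \<xi>)" if x: "\<xi> \<in> rays T" for \<xi>
      using R.S.tree_Aut_mult_apply[of "\<Phi> k" ?\<nu>] c x hx[OF x] R.lift_vt[OF h x]
        R.lift_vt[OF ray_act_invariant[OF g(2)] hx[OF x]]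
      by (simp add: fun_eq_iff[of "_ \<circ> _"] R.\<pi>_apply ray_act_apply)
    have r: "(?\<nu> \<otimes>\<^bsub>A\<^sub>S\<^esub> \<Phi> g) \<circ> R.\<pi> \<xi> = R.\<pi> (h (g \<circ> \<xi>))" if x: "\<xi> \<in> rays T" for \<xi>
      using R.S.tree_Aut_mult_apply[of ?\<nu> "\<Phi> g"] c x gx[OF x] R.lift_vt[OF h gx[OF x]]
        R.lift_vt[OF ray_act_invariant[OF g(1)] x]
      by (simp add: fun_eq_iff[of "_ \<circ> _"] R.\<pi>_apply ray_act_apply)
    show ?thesis
    proof
      assume e: "\<Phi> k \<otimes>\<^bsub>A\<^sub>S\<^esub> ?\<nu> = ?\<nu> \<otimes>\<^bsub>A\<^sub>S\<^esub> \<Phi> g"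
      show "\<forall>\<xi>\<in>rays T. k \<circ> h \<xi> = h (g \<circ> \<xi>)"
      proof
        fix \<xi> assume x: "\<xi> \<in> rays T"
        have "k \<circ> h \<xi> \<in> rays T" using B.act_closed[of k "h \<xi>"] hx[OF x] g by simp
        then show "k \<circ> h \<xi> = h (g \<circ> \<xi>)"
          using l[OF x] r[OF x] e by (intro R.\<pi>_inj hx[OF gx[OF x]]) auto
      qed
    next
      assume e: "\<forall>\<xi>\<in>rays T. k \<circ> h \<xi> = h (g \<circ> \<xi>)"
      show "\<Phi> k \<otimes>\<^bsub>A\<^sub>S\<^esub> ?\<nu> = ?\<nu> \<otimes>\<^bsub>A\<^sub>S\<^esub> \<Phi> g"
      proof (rule R.aut_eqI)
        show "\<Phi> k \<otimes>\<^bsub>A\<^sub>S\<^esub> ?\<nu> \<in> tree_auts R.S" "?\<nu> \<otimes>\<^bsub>A\<^sub>S\<^esub> \<Phi> g \<in> tree_auts R.S"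
          using S.m_closed c by simp_all
      qed (use l r e in simp)
    qed
  qed
  finally show ?thesis by (metis (no_types))
qed

lemma \<Psi>_conj:
  assumes "\<alpha> \<in> auto \<Gamma>" "g \<in> G"
  shows "\<Phi> (\<alpha> g) = \<Psi> \<alpha> \<otimes>\<^bsub>A\<^sub>S\<^esub> \<Phi> g \<otimes>\<^bsub>A\<^sub>S\<^esub> inv\<^bsub>A\<^sub>S\<^esub> \<Psi> \<alpha>"
proof -
  have "\<alpha> g \<in> G" using B.auto_closed[of \<alpha> g] assms by simp
  then show ?thesis
    using conj_iff_intertwines[OF canonical_act_invariant[OF assms(1)] assms(2)] B.canon_act[of \<alpha> g] assms
    by (simp add: canonical_act_eq)
qed

text \<open>A normalizing \<open>\<nu>\<close> is the lift of a homeomorphism \<open>h\<close> by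
  \<open>aut_is_lift\<close> and \<open>invariant_homeo\<close>. Conjugation by
  \<open>\<nu>\<close>, read back along the injective \<open>\<Phi>\<close>, is a map of
  \<open>G\<close> that intertwines with \<open>h\<close>. It is therefore an automorphism, and
  uniqueness makes \<open>h\<close> its canonical homeomorphism.\<close>

lemma \<Psi>_normalizer: "\<Psi> ` auto \<Gamma> = normalizer A\<^sub>S (\<Phi> ` G)"
proof -
  interpret S: group A\<^sub>S by (rule R.S.group_tree_Aut)
  have sub: "\<Phi> ` G \<subseteq> carrier A\<^sub>S" using \<Phi>_aut by auto
  show ?thesis
  proof (intro equalityI subsetI)
    fix \<nu> assume "\<nu> \<in> \<Psi> ` auto \<Gamma>"
    then obtain \<alpha> where a: "\<alpha> \<in> auto \<Gamma>" "\<nu> = \<Psi> \<alpha>" by blast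
    have surj: "\<alpha> ` G = G" using a(1) by (auto simp: auto_def Bij_def bij_betw_def)
    have "(\<lambda>x. \<nu> \<otimes>\<^bsub>A\<^sub>S\<^esub> x \<otimes>\<^bsub>A\<^sub>S\<^esub> inv\<^bsub>A\<^sub>S\<^esub> \<nu>) ` \<Phi> ` G = \<Phi> ` \<alpha> ` G"
      unfolding image_image a(2) using \<Psi>_conj[OF a(1)] by simp
    then show "\<nu> \<in> normalizer A\<^sub>S (\<Phi> ` G)"
      using S.normalizer_iff[OF sub] \<Psi>_aut a surj by simp
  next
    fix \<nu> assume "\<nu> \<in> normalizer A\<^sub>S (\<Phi> ` G)"
    then have n: "\<nu> \<in> tree_auts R.S" "(\<lambda>x. \<nu> \<otimes>\<^bsub>A\<^sub>S\<^esub> x \<otimes>\<^bsub>A\<^sub>S\<^esub> inv\<^bsub>A\<^sub>S\<^esub> \<nu>) ` \<Phi> ` G = \<Phi> ` G"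
      using S.normalizer_iff[OF sub] by auto
    obtain h where h: "R.invariant h" "h \<in> extensional (rays T)" "R.lift h = \<nu>"
      using R.aut_is_lift[OF n(1)] by blast
    have hh: "B.homeo h" by (rule invariant_homeo[OF h(1,2)])
    have "\<exists>k\<in>G. \<Phi> k = \<nu> \<otimes>\<^bsub>A\<^sub>S\<^esub> \<Phi> g \<otimes>\<^bsub>A\<^sub>S\<^esub> inv\<^bsub>A\<^sub>S\<^esub> \<nu>" if g: "g \<in> G" for g
    proof -
      have "\<nu> \<otimes>\<^bsub>A\<^sub>S\<^esub> \<Phi> g \<otimes>\<^bsub>A\<^sub>S\<^esub> inv\<^bsub>A\<^sub>S\<^esub> \<nu> \<in> \<Phi> ` G" using n(2) g by blast
      then show ?thesis by (auto simp: image_iff)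
    qed
    then obtain f0 where f0: "\<And>g. g \<in> G \<Longrightarrow> f0 g \<in> G"
      "\<And>g. g \<in> G \<Longrightarrow> \<Phi> (f0 g) = \<nu> \<otimes>\<^bsub>A\<^sub>S\<^esub> \<Phi> g \<otimes>\<^bsub>A\<^sub>S\<^esub> inv\<^bsub>A\<^sub>S\<^esub> \<nu>" by metis
    \<comment> \<open>Members of \<open>auto\<close> are extensional, so the chosen values are cut
      off outside \<open>G\<close>.\<close>
    define f where "f = restrict f0 G"
    have int: "B.intertwines f h" unfolding B.intertwines_def
    proof (intro ballI)
      fix g \<xi> assume "g \<in> carrier \<Gamma>" and x: "\<xi> \<in> rays T"
      then have g: "g \<in> G" by simp
      show "h (g \<circ> \<xi>) = f g \<circ> h \<xi>"
        using conj_iff_intertwines[OF h(1) g f0(1)[OF g]] f0(2)[OF g] h(3) g x by (simp add: f_def)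
    qed
    have fa: "f \<in> auto \<Gamma>"
    proof (rule B.auto_of_homeo[OF hh _ _ _ int])
      show "carrier \<Gamma> \<subseteq> f ` carrier \<Gamma>"
      proof
        fix k assume "k \<in> carrier \<Gamma>"
        then have k: "k \<in> G" by simp
        have "\<Phi> k \<in> (\<lambda>x. \<nu> \<otimes>\<^bsub>A\<^sub>S\<^esub> x \<otimes>\<^bsub>A\<^sub>S\<^esub> inv\<^bsub>A\<^sub>S\<^esub> \<nu>) ` \<Phi> ` G" unfolding n(2) using k by (rule imageI)
        then obtain g where g: "g \<in> G" "\<Phi> k = \<nu> \<otimes>\<^bsub>A\<^sub>S\<^esub> \<Phi> g \<otimes>\<^bsub>A\<^sub>S\<^esub> inv\<^bsub>A\<^sub>S\<^esub> \<nu>" by (auto simp: image_image)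
        then have "\<Phi> (f0 g) = \<Phi> k" using f0(2) by simp
        then have "f0 g = k" using inj_onD[OF \<Phi>_inj] f0(1)[OF g(1)] k by blast
        then show "k \<in> f ` carrier \<Gamma>" using g by (auto simp: f_def)
      qed
    qed (use f0(1) in \<open>auto simp: f_def\<close>)
    have "B.canon f = h" by (rule B.canonI[OF fa hh int])
    then have "\<Psi> f = \<nu>" using canonical_act_eq[OF fa] h(3) by simp
    then show "\<nu> \<in> \<Psi> ` auto \<Gamma>" using fa by blast
  qed
qed

lemma \<Psi>_iso: "\<Psi> \<in> iso (AutoGroup \<Gamma>) (A\<^sub>S\<lparr>carrier := normalizer A\<^sub>S (\<Phi> ` G)\<rparr>)"
  unfolding iso_def hom_def
  using \<Psi>_normalizer \<Psi>_inj \<Psi>_mult by (auto simp: AutoGroup_carrier bij_betw_def)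

text \<open>Multiplicativity and injectivity are read off in the tree: \<open>\<Psi>\<close> is
  injective and multiplicative and turns \<open>inner_auto\<close> into \<open>\<Phi>\<close>,
  itself an injective homomorphism. Triviality of the centre is thereby included.\<close>

lemma inner_iso: "inner_auto \<Gamma> \<in> iso \<Gamma> (InnGroup \<Gamma>)"
proof -
  have ia: "inner_auto \<Gamma> g \<in> auto \<Gamma>" if "g \<in> G" for g using B.inner_auto_auto[of g] that by simp
  have "inner_auto \<Gamma> (g \<otimes>\<^bsub>\<Gamma>\<^esub> h) = inner_auto \<Gamma> g \<otimes>\<^bsub>AutoGroup \<Gamma>\<^esub> inner_auto \<Gamma> h"
    if g: "g \<in> G" "h \<in> G" for g h
  proof (rule inj_onD[OF \<Psi>_inj])
    have gh: "g \<otimes>\<^bsub>\<Gamma>\<^esub> h \<in> G" using B.m_closed[of g h] g by simp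
    show "\<Psi> (inner_auto \<Gamma> (g \<otimes>\<^bsub>\<Gamma>\<^esub> h)) = \<Psi> (inner_auto \<Gamma> g \<otimes>\<^bsub>AutoGroup \<Gamma>\<^esub> inner_auto \<Gamma> h)"
      unfolding \<Psi>_inner[OF gh] \<Psi>_mult[OF ia[OF g(1)] ia[OF g(2)]] \<Psi>_inner[OF g(1)] \<Psi>_inner[OF g(2)]
      by (rule \<Phi>_mult[OF g])
    show "inner_auto \<Gamma> (g \<otimes>\<^bsub>\<Gamma>\<^esub> h) \<in> auto \<Gamma>" by (rule ia[OF gh])
    show "inner_auto \<Gamma> g \<otimes>\<^bsub>AutoGroup \<Gamma>\<^esub> inner_auto \<Gamma> h \<in> auto \<Gamma>"
      using B.auto_compose ia g by (simp add: AutoGroup_mult)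
  qed
  moreover have "inj_on (inner_auto \<Gamma>) G"
  proof (rule inj_onI)
    fix g h assume "g \<in> G" "h \<in> G" "inner_auto \<Gamma> g = inner_auto \<Gamma> h"
    then show "g = h" using \<Psi>_inner[of g] \<Psi>_inner[of h] \<Phi>_inj by (auto dest: inj_onD)
  qed
  ultimately show ?thesis by (auto simp: iso_def hom_def InnGroup_def bij_betw_def)
qed

end

theorem theorem5p2:
  fixes T :: "'v rgraph" and G :: "('v \<Rightarrow> 'v) set"
  assumes "lf_rooted_tree T"
    and "weakly_branch T G"
    and "finitely_generated (sub_grp T G)"
  shows
    "\<comment> \<open>(i)\<close>
     (admissible (boundary T) (c_hat T G) \<and>
     overlap_invariant (sub_grp T G) (ray_act T) (rays T) (c_hat T G) \<and>
     overlap_invariant (AutoGroup (sub_grp T G)) (canonical_act T G) (rays T) (c_hat T G) \<and>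
     lf_rooted_tree (T_hat T G)) \<and>
     \<comment> \<open>(ii)\<close>
     (homeomorphic_map (boundary T) (boundary (T_hat T G)) (pi_hat T G) \<and>
     (\<exists>p. (\<forall>n. \<forall>\<xi>\<in>rays T. p (overlap_vertex (rays T) (c_hat T G) n \<xi>) = \<xi> n) \<and>
          level_preserving (T_hat T G) T p \<and>
          surjective_simplicial (T_hat T G) T p \<and>
          (\<forall>g\<in>G. \<forall>x\<in>tverts (T_hat T G). p (G_act_hat T G g x) = g (p x)) \<and>
          (\<forall>\<xi>\<in>rays T. p \<circ> pi_hat T G \<xi> = \<xi>))) \<and>
     \<comment> \<open>(iii)\<close>
     (faithful_tree_action (sub_grp T G) (T_hat T G) (G_act_hat T G) \<and>
     weakly_branch (T_hat T G) (G_act_hat T G ` G) \<and>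
     (branch (T_hat T G) (G_act_hat T G ` G) \<longleftrightarrow> branch T G)) \<and>
     \<comment> \<open>(iv)\<close>
     (faithful_tree_action (AutoGroup (sub_grp T G)) (T_hat T G) (Aut_act_hat T G) \<and>
     (\<forall>\<alpha> \<in> auto (sub_grp T G). \<forall>\<xi>\<in>rays T.
        ray_act (T_hat T G) (Aut_act_hat T G \<alpha>) (pi_hat T G \<xi>)
          = pi_hat T G (canonical_act T G \<alpha> \<xi>)) \<and>
     (\<exists>\<kappa> \<in> iso (tree_Aut (T_hat T G)
                  \<lparr>carrier := normalizer (tree_Aut (T_hat T G)) (G_act_hat T G ` G)\<rparr>)
               (AutoGroup (sub_grp T G)).
        \<forall>\<nu> \<in> normalizer (tree_Aut (T_hat T G)) (G_act_hat T G ` G). \<forall>g\<in>G.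
          G_act_hat T G (\<kappa> \<nu> g)
            = \<nu> \<otimes>\<^bsub>tree_Aut (T_hat T G)\<^esub> G_act_hat T G g
                \<otimes>\<^bsub>tree_Aut (T_hat T G)\<^esub> inv\<^bsub>tree_Aut (T_hat T G)\<^esub> \<nu>)) \<and>
     \<comment> \<open>(v)\<close>
     (weakly_branch (T_hat T G) (Aut_act_hat T G ` auto (sub_grp T G)) \<and>
     inner_auto (sub_grp T G) \<in> iso (sub_grp T G) (InnGroup (sub_grp T G)) \<and>
     (\<forall>g\<in>G. Aut_act_hat T G (inner_auto (sub_grp T G) g) = G_act_hat T G g))"
proof -
  obtain par where "lf_graded_tree T (graph_dist T (troot T)) par"
    using lf_rooted_tree_graded[OF assms(1)] by blast
  then interpret fg_weakly_branch T "graph_dist T (troot T)" par G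
    using assms by (simp add: fg_weakly_branch_def fg_weakly_branch_axioms_def)
  let ?N = "normalizer A\<^sub>S (\<Phi> ` G)"
  have i: "admissible (boundary T) (c_hat T G) \<and>
     overlap_invariant \<Gamma> (ray_act T) (rays T) (c_hat T G) \<and>
     overlap_invariant (AutoGroup \<Gamma>) (canonical_act T G) (rays T) (c_hat T G) \<and>
     lf_rooted_tree R.S"
    using R.admissible R.S.lf_rooted_tree ray_act_invariant canonical_act_invariant
    by (simp add: overlap_invariant_def R.invariant_def AutoGroup_carrier)
  have eqv: "R.proj (\<Phi> g x) = g (R.proj x)" if g: "g \<in> G" and x: "x \<in> tverts R.S" for g x
  proof -
    obtain n \<xi> where \<xi>: "x = R.vt n \<xi>" "\<xi> \<in> rays T" using x R.S_verts by auto
    have "g \<circ> \<xi> \<in> rays T" using B.act_closed[of g \<xi>] g \<xi> by simp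
    then show ?thesis
      using R.lift_vt[OF ray_act_invariant[OF g] \<xi>(2)] \<xi> by (simp add: R.proj_vt ray_act_apply)
  qed
  have ii: "homeomorphic_map (boundary T) (boundary R.S) R.\<pi> \<and>
     (\<exists>p. (\<forall>n. \<forall>\<xi>\<in>rays T. p (R.vt n \<xi>) = \<xi> n) \<and> level_preserving R.S T p \<and>
          surjective_simplicial R.S T p \<and>
          (\<forall>g\<in>G. \<forall>x\<in>tverts R.S. p (\<Phi> g x) = g (p x)) \<and> (\<forall>\<xi>\<in>rays T. p \<circ> R.\<pi> \<xi> = \<xi>))"
    using R.\<pi>_homeomorphic R.proj_level_preserving R.proj_surjective eqv
    by (intro conjI exI[of _ R.proj]) (auto simp: R.proj_vt fun_eq_iff R.\<pi>_apply)
  have iii: "faithful_tree_action \<Gamma> R.S \<Phi> \<and> weakly_branch R.S (\<Phi> ` G) \<and>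
      (branch R.S (\<Phi> ` G) \<longleftrightarrow> branch T G)"
    using \<Phi>_faithful \<Phi>_weakly_branch branch_iff by blast
  have act: "\<forall>\<alpha>\<in>auto \<Gamma>. \<forall>\<xi>\<in>rays T. ray_act R.S (\<Psi> \<alpha>) (R.\<pi> \<xi>) = R.\<pi> (canonical_act T G \<alpha> \<xi>)"
    using R.lift_\<pi> R.\<pi>_ray canonical_act_invariant by (simp add: ray_act_def)
  have "\<exists>\<kappa>\<in>iso (A\<^sub>S\<lparr>carrier := ?N\<rparr>) (AutoGroup \<Gamma>). \<forall>\<nu>\<in>?N. \<forall>g\<in>G.
      \<Phi> (\<kappa> \<nu> g) = \<nu> \<otimes>\<^bsub>A\<^sub>S\<^esub> \<Phi> g \<otimes>\<^bsub>A\<^sub>S\<^esub> inv\<^bsub>A\<^sub>S\<^esub> \<nu>"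
  proof (intro bexI ballI)
    \<comment> \<open>\<open>\<Psi>_iso\<close> runs from the automorphism group to the normalizer.
      Its inverse sends \<open>\<nu>\<close> to the automorphism that conjugation by
      \<open>\<nu>\<close> induces.\<close>
    let ?\<kappa> = "inv_into (auto \<Gamma>) \<Psi>"
    show "?\<kappa> \<in> iso (A\<^sub>S\<lparr>carrier := ?N\<rparr>) (AutoGroup \<Gamma>)"
      using group.iso_set_sym[OF B.AutoGroup \<Psi>_iso] by (simp add: AutoGroup_carrier)
    fix \<nu> g assume "\<nu> \<in> ?N" and g: "g \<in> G"
    then obtain \<alpha> where "\<alpha> \<in> auto \<Gamma>" "\<nu> = \<Psi> \<alpha>" using \<Psi>_normalizer by blast
    then show "\<Phi> (?\<kappa> \<nu> g) = \<nu> \<otimes>\<^bsub>A\<^sub>S\<^esub> \<Phi> g \<otimes>\<^bsub>A\<^sub>S\<^esub> inv\<^bsub>A\<^sub>S\<^esub> \<nu>"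
      using \<Psi>_conj g inv_into_f_f[OF \<Psi>_inj] by simp
  qed
  then show ?thesis
    unfolding T_hat_eq pi_hat_eq G_act_hat_eq Aut_act_hat_eq
    using i ii iii act \<Psi>_faithful \<Psi>_weakly_branch inner_iso \<Psi>_inner by blast
qed

end
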